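(* Let $\phi$ be a nonconstant function in $\mathfrak{M}(\overline{\mathbb{D}})$. Then $$n(\phi)=b(\phi)=o(\phi)=N(\phi).$$
   Context: $\mathbb{D}$ is the open unit disk in $\mathbb{C}$ and $\mathbb{T}$ its boundary. $\mathfrak{M}(\overline{\mathbb{D}})$ is the set of all meromorphic functions on $\mathbb{C}$ that have no pole on $\overline{\mathbb{D}}$. $H^\infty(\mathbb{D})$ is the algebra of bounded holomorphic functions on $\mathbb{D}$. For a nonconstant $\phi$ holomorphic on a neighborhood of $\overline{\mathbb{D}}$: - $n(\phi)=\min\{\mathrm{wind}(\phi,\phi(a)): a\in\mathbb{D},\ \phi(a)\notin\phi(\mathbb{T})\}$, where for $c\notin\phi(\mathbb{T})$, $\mathrm{wind}(\phi,c)$ is the winding number of the closed curve $\phi(z)$ ($z\in\mathbb{T}$, positively oriented) around $c$. - $b(\phi)$ is the maximum of the orders of finite Blaschke products $\widetilde{B}$ for which there is $\widetilde\psi\in H^\infty(\mathbb{D})$ with $\phi=\widetilde\psi\circ\widetilde B$ on $\mathbb{D}$ (the order of a finite Blaschke product is its number of zeros in $\mathbb{D}$ counted with multiplicity). - $o(\phi)$ is the cardinality of $G(\phi)$, the set of all continuous maps $\rho:\mathbb{T}\to\mathbb{T}$ with $\phi\circ\rho=\phi$ on $\mathbb{T}$ (for such $\phi$ it is a finite group). - $N(\phi)=\min\{N(\phi-\phi(\eta),\mathbb{T}):\eta\in\mathbb{T}\}$, where $N(\phi-\phi(\eta),\mathbb{T})$ is the cardinality of $\{w\in\mathbb{T}:\phi(w)=\phi(\eta)\}$.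 *)

theory Defs
  imports "HOL-Complex_Analysis.Complex_Analysis"
begin

abbreviation unit_disk :: "complex set" where
  "unit_disk \<equiv> ball 0 1"

abbreviation unit_circle :: "complex set" where
  "unit_circle \<equiv> sphere 0 1"

(* "Nicely" meromorphic: removable singularities are removed, and the value at a pole is the
   dummy value 0, so that a total function represents exactly one meromorphic function. *)
definition mero_closed_disk :: "(complex \<Rightarrow> complex) set" where
  "mero_closed_disk =
     {\<phi>. \<phi> nicely_meromorphic_on UNIV \<and> (\<forall>z\<in>cball 0 1. \<not> is_pole \<phi> z)}"

definition H_infty :: "(complex \<Rightarrow> complex) set" where
  "H_infty = {\<psi>. \<psi> holomorphic_on unit_disk \<and> bounded (\<psi> ` unit_disk)}"

(* Of a function on the disk only the values on the disk matter. The multiset A lists the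
   zeros with multiplicity; A = {#} gives the unimodular constants. *)
definition finite_blaschke_product :: "(complex \<Rightarrow> complex) \<Rightarrow> bool" where
  "finite_blaschke_product B \<longleftrightarrow>
     (\<exists>c A. cmod c = 1 \<and> set_mset A \<subseteq> unit_disk \<and>
        (\<forall>z\<in>unit_disk. B z = c * (\<Prod>a\<in>#A. (z - a) / (1 - cnj a * z))))"

definition blaschke_order :: "(complex \<Rightarrow> complex) \<Rightarrow> nat" where
  "blaschke_order B = (\<Sum>a | a \<in> unit_disk \<and> B a = 0. nat (zorder B a))"

definition wind :: "(complex \<Rightarrow> complex) \<Rightarrow> complex \<Rightarrow> complex" where
  "wind \<phi> c = winding_number (\<phi> \<circ> circlepath 0 1) c"

(* LEAST over int and GREATEST over nat are unspecified when the minimum or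
   maximum does not exist, so the definitions below do not build in its existence. *)

(* winding_number is complex-valued; its values here are integers. *)
definition n_inv :: "(complex \<Rightarrow> complex) \<Rightarrow> int" where
  "n_inv \<phi> =
     (LEAST k. \<exists>a\<in>unit_disk. \<phi> a \<notin> \<phi> ` unit_circle \<and> wind \<phi> (\<phi> a) = of_int k)"

definition b_inv :: "(complex \<Rightarrow> complex) \<Rightarrow> nat" where
  "b_inv \<phi> =
     (GREATEST k. \<exists>B. finite_blaschke_product B \<and> blaschke_order B = k \<and>
        (\<exists>\<psi>\<in>H_infty. \<forall>z\<in>unit_disk. \<phi> z = \<psi> (B z)))"

(* The extensional function space makes each map of the circle a single element, so that
   cardinality is meaningful. *)
definition G_inv :: "(complex \<Rightarrow> complex) \<Rightarrow> (complex \<Rightarrow> complex) set" where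
  "G_inv \<phi> =
     {\<rho> \<in> unit_circle \<rightarrow>\<^sub>E unit_circle.
        continuous_on unit_circle \<rho> \<and> (\<forall>z\<in>unit_circle. \<phi> (\<rho> z) = \<phi> z)}"

definition o_inv :: "(complex \<Rightarrow> complex) \<Rightarrow> nat" where
  "o_inv \<phi> = card (G_inv \<phi>)"

definition N_inv :: "(complex \<Rightarrow> complex) \<Rightarrow> nat" where
  "N_inv \<phi> =
     (LEAST k. \<exists>\<eta>\<in>unit_circle. k = card {w \<in> unit_circle. \<phi> w = \<phi> \<eta>})"

end

theory Submission
  imports Defs
begin

text \<open>
  Call \<open>w\<close> a mate of \<open>z\<close> if \<open>\<phi> w = \<phi> z\<close> and if the reflection \<open>z \<mapsto> cnj (\<phi> (1 / cnj z))\<close> of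
  \<open>\<phi>\<close> also takes the same value at both points. This is an equivalence relation which is symmetric
  about the unit circle, and two points of the circle are mates as soon as \<open>\<phi>\<close> takes the same value
  there. The function \<open>\<phi>\<close> is meromorphic in the plane and finite at \<open>0\<close>. So when mates of \<open>z\<close>
  run off to \<open>0\<close> or to infinity, \<open>\<phi>\<close> tends to \<open>\<phi> 0\<close> at \<open>z\<close> or at its mirror image. Hence,
  for \<open>z\<close> outside a countable set, the mates stay in a compact annulus, are finite in number, and
  move analytically with \<open>z\<close> (\<open>sheets_exist\<close>, \<open>good_punctured_nhds\<close>). The good points are
  connected, and so the number \<open>m\<close> of mates is constant (\<open>card_mates_constant\<close>).

  To find \<open>m\<close>, take a good point \<open>\<eta>\<close> on the circle such that \<open>\<phi> \<eta>\<close> is on the frontier of the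
  image of the closed disk. By the open mapping theorem no point of the disk has this value, by
  reflection no mate of \<open>\<eta>\<close> is off the circle, and \<open>m\<close> is the number of points of the circle
  with the value \<open>\<phi> \<eta>\<close>. Reflecting a point near \<open>\<eta>\<close> whose value is off the image yields a
  point \<open>a\<close> of the disk with all its mates in the disk (\<open>base_point_with_mates_in_disk\<close>).

  Let \<open>b w = (w - a) / (1 - cnj a * w)\<close>. The product of \<open>b w\<close> over the mates \<open>w\<close> of \<open>z\<close> is a
  bounded holomorphic function of \<open>z\<close> near the closed disk, once its singularities are removed. It
  is unimodular on the circle, where the mates are symmetric, and its zeros in the disk are the
  \<open>m\<close> mates of \<open>a\<close>, all of them simple. So it is a finite Blaschke product \<open>B\<close> of order \<open>m\<close>. Near
  \<open>a\<close> the fibres of \<open>B\<close> are classes of mates, on which \<open>\<phi>\<close> is constant. The mean of \<open>\<phi>\<close> over the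
  fibres is a holomorphic function \<open>\<psi>\<close> with \<open>\<phi> = \<psi> \<circ> B\<close>, first near \<open>a\<close> and then on the disk by
  the identity theorem (\<open>blaschke_factorization\<close>).

  All four invariants equal \<open>m\<close>. Whenever \<open>\<phi>\<close> factors through a Blaschke product of order \<open>k\<close>,
  each fibre of \<open>\<phi>\<close> on the circle has at least \<open>k\<close> points (\<open>order_le_circle_fibre\<close>) and each winding
  number in question is at least \<open>k\<close> (\<open>order_le_wind\<close>). For \<open>k = m\<close> these bounds are attained at
  \<open>\<eta>\<close> and at \<open>a\<close>, and the fibre of \<open>\<eta>\<close> shows \<open>k \<le> m\<close> in general. Finally the symmetries of \<open>\<phi>\<close>
  on the circle are the \<open>m\<close> deck transformations of the covering of the circle by \<open>B\<close>
  (\<open>symmetry_count\<close>).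
\<close>


section \<open>Sequences, local inverses and reflection\<close>

lemma not_eventually_nhds_imp_seq:
  fixes a :: "'a::first_countable_topology"
  assumes "\<not> eventually P (nhds a)"
  obtains X where "X \<longlonglongrightarrow> a" "\<And>n::nat. \<not> P (X n)"
proof -
  have "\<exists>X. (\<forall>n::nat. X n \<in> UNIV) \<and> X \<longlonglongrightarrow> a \<and> \<not> eventually (\<lambda>n. P (X n)) sequentially"
    using sequentially_imp_eventually_nhds_within[of UNIV a P] assms by auto
  then obtain X where X: "X \<longlonglongrightarrow> a" "\<exists>\<^sub>F n in sequentially. \<not> P (X n)"
    by (auto simp: frequently_def)
  obtain s :: "nat \<Rightarrow> nat" where "strict_mono s" "\<And>n. \<not> P (X (s n))"
  proof -
    have "infinite {n. \<not> P (X n)}"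
      using X(2) by (simp add: cofinite_eq_sequentially[symmetric] frequently_cofinite)
    then show ?thesis
      using that[of "enumerate {n. \<not> P (X n)}"] strict_mono_enumerate enumerate_in_set by blast
  qed
  with X(1) show ?thesis
    using that[of "X \<circ> s"] LIMSEQ_subseq_LIMSEQ by (auto simp: o_def)
qed

lemma not_eventually_at_imp_seq:
  fixes a :: "'a::first_countable_topology"
  assumes "\<not> eventually P (at a)"
  obtains X where "X \<longlonglongrightarrow> a" "\<And>n::nat. X n \<noteq> a" "\<And>n. \<not> P (X n)"
proof -
  have "\<not> eventually (\<lambda>x. x \<noteq> a \<longrightarrow> P x) (nhds a)"
    using assms by (simp add: eventually_at_filter)
  then show ?thesis
    using that by (rule not_eventually_nhds_imp_seq) auto
qed

lemma tendsto_eventually_compose: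
  assumes "(X \<longlongrightarrow> a) F" "eventually P (nhds a)"
  shows "\<forall>\<^sub>F n in F. P (X n)"
  using assms by (simp add: filterlim_iff)

lemma eventually_nhds_compose_cont:
  assumes "isCont f z" "eventually P (nhds (f z))"
  shows "\<forall>\<^sub>F x in nhds z. P (f x)"
  using assms by (metis continuous_at filterlim_iff isCont_def tendsto_at_iff_tendsto_nhds)

lemma isCont_eventually_neq: "isCont f z \<Longrightarrow> f z \<noteq> (c::complex) \<Longrightarrow> \<forall>\<^sub>F x in nhds z. f x \<noteq> c"
  by (rule eventually_nhds_compose_cont) (auto intro: t1_space_nhds)

lemma analytic_local_inverse:
  assumes f: "f analytic_on {z}" and d: "deriv f z \<noteq> 0"
  obtains g where "g analytic_on {f z}" "g (f z) = z"
    "\<forall>\<^sub>F x in nhds z. g (f x) = x" "\<forall>\<^sub>F y in nhds (f z). f (g y) = y"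
proof -
  obtain S where S: "open S" "z \<in> S" "f holomorphic_on S"
    using f analytic_at by auto
  obtain r where r: "r > 0" "ball z r \<subseteq> S" "open (f ` ball z r)" "inj_on f (ball z r)"
    using has_complex_derivative_locally_invertible[OF S(3,2,1) d] by metis
  have holb: "f holomorphic_on ball z r" using S(3) r(2) holomorphic_on_subset by blast
  obtain g where g: "g holomorphic_on f ` ball z r" "\<And>x. x \<in> ball z r \<Longrightarrow> g (f x) = x"
    using holomorphic_has_inverse[OF holb open_ball r(4)] by metis
  have fz: "f z \<in> f ` ball z r" using r(1) by simp
  show ?thesis
  proof
    show "g analytic_on {f z}"
      using analytic_at g(1) r(3) fz by blast
    show "g (f z) = z" using g(2) r(1) by simp
    show "\<forall>\<^sub>F x in nhds z. g (f x) = x"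
      using eventually_nhds_in_open[of "ball z r" z] r(1) g(2) by (auto elim: eventually_mono)
    show "\<forall>\<^sub>F y in nhds (f z). f (g y) = y"
      using eventually_nhds_in_open[OF r(3) fz] by (rule eventually_mono) (use g(2) in auto)
  qed
qed

lemma analytic_locally_inj:
  assumes f: "f analytic_on {z}" and d: "deriv f z \<noteq> 0"
  shows "\<exists>r>0. inj_on f (ball z r)"
  using assms by (metis analytic_at has_complex_derivative_locally_injective)

lemma analytic_frequently_zero:
  fixes h :: "complex \<Rightarrow> complex"
  assumes "h analytic_on {w}" and fr: "\<exists>\<^sub>F x in at w. h x = 0"
  shows "\<forall>\<^sub>F x in nhds w. h x = 0"
proof -
  have ev: "\<forall>\<^sub>F x in at w. h x = 0"
    using not_essential_frequently_0_imp_eventually_0[OF _ _ fr] assms(1)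
      isolated_singularity_at_analytic not_essential_analytic by blast
  then have "(h \<longlongrightarrow> 0) (at w)" by (rule tendsto_eventually)
  moreover have "(h \<longlongrightarrow> h w) (at w)"
    using analytic_at_imp_isCont[OF assms(1)] by (simp add: isCont_def)
  ultimately have "h w = 0" using LIM_unique by blast
  with ev show ?thesis by (simp add: eventually_nhds_conv_at)
qed

text \<open>The identity theorem for a sequence of zeros.\<close>
lemma analytic_eventually_zero_of_seq:
  assumes "h analytic_on {w}" "Y \<longlonglongrightarrow> w" "\<And>n::nat. Y n \<noteq> w" "\<forall>\<^sub>F n in sequentially. h (Y n) = (0::complex)"
  shows "\<forall>\<^sub>F x in nhds w. h x = 0"
proof -
  have "filterlim Y (at w) sequentially"
    unfolding filterlim_at using assms(2,3) by simp
  have fr: "\<exists>\<^sub>F x in at w. h x = 0"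
    unfolding frequently_def
  proof
    assume "\<forall>\<^sub>F x in at w. h x \<noteq> 0"
    then have "\<forall>\<^sub>F n in sequentially. h (Y n) \<noteq> 0"
      using \<open>filterlim Y (at w) sequentially\<close> unfolding filterlim_iff by blast
    with assms(4) have "\<forall>\<^sub>F n::nat in sequentially. False"
      by eventually_elim simp
    then show False by simp
  qed
  show ?thesis by (rule analytic_frequently_zero[OF assms(1) fr])
qed

lemma deriv_of_linear_factor:
  fixes g H :: "complex \<Rightarrow> complex"
  assumes "\<forall>\<^sub>F x in nhds a. g x = (x - a) * H x" "H analytic_on {a}"
  shows "deriv g a = H a"
proof -
  have H: "(H has_field_derivative deriv H a) (at a)"
    using assms(2) by (metis analytic_on_imp_differentiable_at DERIV_deriv_iff_field_differentiable singletonI)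
  have "((\<lambda>x. (x - a) * H x) has_field_derivative H a) (at a)"
    using H by (auto intro!: derivative_eq_intros)
  then have "deriv (\<lambda>x. (x - a) * H x) a = H a" by (rule DERIV_imp_deriv)
  then show ?thesis using deriv_cong_ev[OF assms(1) refl] by simp
qed

lemma prod_norm_ge_power:
  fixes f :: "complex \<Rightarrow> complex"
  assumes "\<And>w. w \<in> S \<Longrightarrow> \<epsilon> \<le> norm (f w)" "\<epsilon> \<ge> 0"
  shows "\<epsilon> ^ card S \<le> norm (\<Prod>w\<in>S. f w)"
proof -
  have "(\<Prod>w\<in>S. \<epsilon>) \<le> (\<Prod>w\<in>S. norm (f w))" using assms by (intro prod_mono) auto
  then show ?thesis by (simp add: prod_norm)
qed

lemma prod_norm_le_power:
  fixes f :: "complex \<Rightarrow> complex"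
  assumes "\<And>w. w \<in> S \<Longrightarrow> norm (f w) \<le> M"
  shows "norm (\<Prod>w\<in>S. f w) \<le> M ^ card S"
proof -
  have "(\<Prod>w\<in>S. norm (f w)) \<le> (\<Prod>w\<in>S. M)" using assms by (intro prod_mono) auto
  then show ?thesis by (simp add: prod_norm)
qed

text \<open>Reflection in the unit circle, with the junk value \<open>mirror 0 = 0\<close>.\<close>
definition mirror :: "complex \<Rightarrow> complex" where "mirror z = 1 / cnj z"

lemma mirror_mirror [simp]: "mirror (mirror z) = z"
  by (simp add: mirror_def)

lemma mirror_eq_0_iff [simp]: "mirror z = 0 \<longleftrightarrow> z = 0"
  by (simp add: mirror_def)

lemma mirror_eq_iff [simp]: "mirror z = mirror w \<longleftrightarrow> z = w"
  by (metis mirror_mirror)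

lemma norm_mirror: "norm (mirror z) = 1 / norm z"
  by (simp add: mirror_def norm_divide)

lemma mirror_on_circle: "norm z = 1 \<Longrightarrow> mirror z = z"
  by (metis complex_norm_square mirror_def mult_cancel_left2 nonzero_eq_divide_eq of_real_1 one_power2 zero_neq_one complex_cnj_zero_iff norm_zero)

lemma isCont_mirror: "z \<noteq> 0 \<Longrightarrow> isCont mirror z"
  unfolding mirror_def by (intro continuous_intros) auto

lemma tendsto_mirror: "(f \<longlongrightarrow> z) F \<Longrightarrow> z \<noteq> 0 \<Longrightarrow> ((\<lambda>x. mirror (f x)) \<longlongrightarrow> mirror z) F"
  using isCont_mirror isCont_tendsto_compose by blast

lemma filterlim_mirror_at: "z \<noteq> 0 \<Longrightarrow> filterlim mirror (at (mirror z)) (at z)"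
  using isCont_mirror[of z] by (auto simp: filterlim_at isCont_def eventually_at_filter)

text \<open>Conjugation on both sides turns the antiholomorphic reflection into a holomorphic operation.\<close>
lemma analytic_cnj_comp_mirror:
  assumes "f analytic_on {mirror z}" "z \<noteq> 0"
  shows "(\<lambda>x. cnj (f (mirror x))) analytic_on {z}"
proof -
  obtain S where S: "open S" "mirror z \<in> S" "f holomorphic_on S"
    using assms(1) analytic_at by auto
  have o: "open (cnj ` S)"
    unfolding image_cnj_conv_vimage_cnj by (intro open_vimage S(1) continuous_intros)
  have "(cnj \<circ> f \<circ> cnj) holomorphic_on cnj ` S"
    using S o by (intro holomorphic_on_compose_cnj_cnj) (auto simp: image_image)
  moreover have "inverse z \<in> cnj ` S"
    using S(2) by (force simp: mirror_def inverse_eq_divide)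
  ultimately have "(cnj \<circ> f \<circ> cnj) analytic_on inverse ` {z}"
    using analytic_at o by auto
  moreover have "inverse analytic_on {z}"
    using assms(2) by (intro analytic_intros) auto
  ultimately have "((cnj \<circ> f \<circ> cnj) \<circ> inverse) analytic_on {z}"
    using analytic_on_compose by blast
  then show ?thesis
    by (simp add: o_def mirror_def inverse_eq_divide)
qed

section \<open>Counting zeros in the disk; removable singularities\<close>

lemma cball_nbhd_radius:
  fixes U :: "complex set"
  assumes "open U" "cball 0 1 \<subseteq> U"
  obtains R where "R > 1" "ball 0 R \<subseteq> U"
proof -
  obtain e where e: "e > 0" "(\<Union>x\<in>cball 0 1. ball x e) \<subseteq> U"
    using compact_subset_open_imp_ball_epsilon_subset[OF compact_cball assms] by blast
  have "ball 0 (1 + e) \<subseteq> U"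
  proof
    fix z :: complex assume z: "z \<in> ball 0 (1 + e)"
    show "z \<in> U"
    proof (cases "norm z \<le> 1")
      case False
      then have "dist (sgn z) z = norm z - 1"
      proof -
        have "dist (sgn z) z = norm (z - sgn z)" by (simp add: dist_norm norm_minus_commute)
        also have "z - sgn z = of_real (norm z - 1) * sgn z"
          using False by (auto simp: sgn_eq left_diff_distrib diff_divide_distrib)
        also have "norm \<dots> = \<bar>norm z - 1\<bar> * norm (sgn z)"
          by (simp only: norm_mult norm_of_real)
        also have "\<dots> = norm z - 1" using False by (auto simp: norm_sgn)
        finally show ?thesis .
      qed
      then have "z \<in> ball (sgn z) e" using z by simp
      moreover have "sgn z \<in> cball 0 1" by (simp add: norm_sgn)
      ultimately show ?thesis using e(2) by blast
    qed (use assms in auto)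
  qed
  then show ?thesis using that[of "1 + e"] e(1) by simp
qed

text \<open>The argument principle on a slightly larger disk: zeros outside the unit disk have winding number
  \<open>0\<close>. The weight \<open>h\<close> is what later yields the mean of a function over a
  fibre.\<close>
lemma argument_principle_circle:
  fixes f h :: "complex \<Rightarrow> complex"
  assumes R: "R > 1" and f: "f holomorphic_on ball 0 R" and h: "h holomorphic_on ball 0 R"
    and nz: "\<And>t. norm t = 1 \<Longrightarrow> f t \<noteq> v"
  shows "finite {p \<in> ball 0 1. f p = v}"
    and "contour_integral (circlepath 0 1) (\<lambda>x. deriv f x * h x / (f x - v)) =
         2 * pi * \<i> * (\<Sum>p\<in>{p \<in> ball 0 1. f p = v}. h p * of_int (zorder (\<lambda>x. f x - v) p))"
proof -
  define r where "r = (1 + R) / 2"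
  have r: "1 < r" "r < R" using R by (auto simp: r_def)
  define S where "S = (ball 0 r :: complex set)"
  define pz where "pz = {w \<in> S. f w - v = 0 \<or> w \<in> {}}"
  have hol: "(\<lambda>x. f x - v) holomorphic_on ball 0 R" by (intro holomorphic_intros f)
  have fin': "finite {z \<in> cball 0 r. f z - v = 0}"
  proof (cases "(\<lambda>x. f x - v) constant_on ball 0 R")
    case True
    then obtain c where c: "\<And>z. z \<in> ball 0 R \<Longrightarrow> f z - v = c" by (auto simp: constant_on_def)
    have "c \<noteq> 0" using c[of 1] nz[of 1] R by auto
    moreover have "cball 0 r \<subseteq> ball (0::complex) R" using r by auto
    ultimately have "{z \<in> cball 0 r. f z - v = 0} = {}" using c by blast
    then show ?thesis by (metis finite.emptyI)
  next
    case False
    then show ?thesis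
      by (intro holomorphic_compact_finite_zeros[OF hol open_ball connected_ball compact_cball]) (use r in auto)
  qed
  show "finite {p \<in> ball 0 1. f p = v}"
    by (rule finite_subset[OF _ fin']) (use r in auto)
  have finpz: "finite pz"
    by (rule finite_subset[OF _ fin']) (auto simp: pz_def S_def)
  have "contour_integral (circlepath 0 1) (\<lambda>x. deriv (\<lambda>x. f x - v) x * h x / (f x - v)) =
         2 * pi * \<i> * (\<Sum>p\<in>pz. winding_number (circlepath 0 1) p * h p * of_int (zorder (\<lambda>x. f x - v) p))"
    unfolding pz_def
  proof (rule argument_principle)
    show "(\<lambda>x. f x - v) holomorphic_on S - {}" "h holomorphic_on S"
      using hol h r by (auto simp: S_def intro: holomorphic_on_subset)
    show "path_image (circlepath 0 1) \<subseteq> S - {w \<in> S. f w - v = 0 \<or> w \<in> {}}"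
    proof
      fix t assume "t \<in> path_image (circlepath 0 1)"
      then show "t \<in> S - {w \<in> S. f w - v = 0 \<or> w \<in> {}}" using nz[of t] r by (simp add: S_def)
    qed
    show "\<forall>z. z \<notin> S \<longrightarrow> winding_number (circlepath 0 1) z = 0"
      using r by (auto simp: S_def intro!: winding_number_zero_outside[of _ "cball 0 1"])
    show "finite {w \<in> S. f w - v = 0 \<or> w \<in> {}}" using finpz by (simp add: pz_def)
  qed (auto simp: S_def)
  also have "(\<Sum>p\<in>pz. winding_number (circlepath 0 1) p * h p * of_int (zorder (\<lambda>x. f x - v) p)) =
     (\<Sum>p\<in>{p \<in> ball 0 1. f p = v}. h p * of_int (zorder (\<lambda>x. f x - v) p))"
  proof (rule sum.mono_neutral_cong_right[OF finpz])
    show "{p \<in> ball 0 1. f p = v} \<subseteq> pz" using r by (auto simp: pz_def S_def)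
    show "\<forall>p\<in>pz - {p \<in> ball 0 1. f p = v}. winding_number (circlepath 0 1) p * h p * of_int (zorder (\<lambda>x. f x - v) p) = 0"
    proof
      fix p assume p: "p \<in> pz - {p \<in> ball 0 1. f p = v}"
      then have "norm p > 1" using nz[of p] by (auto simp: pz_def S_def not_less le_less)
      then have "winding_number (circlepath 0 1) p = 0"
        by (intro winding_number_zero_outside[of _ "cball 0 1"]) auto
      then show "winding_number (circlepath 0 1) p * h p * of_int (zorder (\<lambda>x. f x - v) p) = 0" by simp
    qed
    show "winding_number (circlepath 0 1) p * h p * of_int (zorder (\<lambda>x. f x - v) p) = h p * of_int (zorder (\<lambda>x. f x - v) p)"
      if "p \<in> {p \<in> ball 0 1. f p = v}" for p
    proof -
      have "winding_number (circlepath 0 1) p = winding_number (circlepath 0 1) 0"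
        by (rule winding_number_eq[of _ _ "ball 0 1"]) (use that in auto)
      then show ?thesis by (simp add: winding_number_circlepath_centre)
    qed
  qed
  also have "contour_integral (circlepath 0 1) (\<lambda>x. deriv (\<lambda>x. f x - v) x * h x / (f x - v)) =
      contour_integral (circlepath 0 1) (\<lambda>x. deriv f x * h x / (f x - v))"
  proof (rule contour_integral_eq)
    fix x assume "x \<in> path_image (circlepath 0 1)"
    then have "f field_differentiable at x"
      using f R by (intro holomorphic_on_imp_differentiable_at[OF f open_ball]) auto
    then show "deriv (\<lambda>x. f x - v) x * h x / (f x - v) = deriv f x * h x / (f x - v)" by simp
  qed
  finally show "contour_integral (circlepath 0 1) (\<lambda>x. deriv f x * h x / (f x - v)) =
         2 * pi * \<i> * (\<Sum>p\<in>{p \<in> ball 0 1. f p = v}. h p * of_int (zorder (\<lambda>x. f x - v) p))" .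
qed

lemma winding_number_image_circle:
  assumes R: "R > 1" and f: "f holomorphic_on ball 0 R" and nz: "\<And>t. norm t = 1 \<Longrightarrow> f t \<noteq> v"
  shows "winding_number (f \<circ> circlepath 0 1) v =
    of_int (\<Sum>p\<in>{p \<in> ball 0 1. f p = v}. zorder (\<lambda>x. f x - v) p)"
proof -
  have sub: "path_image (circlepath 0 1) \<subseteq> ball (0::complex) R" using R by auto
  have "valid_path (f \<circ> circlepath 0 1)"
    by (rule valid_path_compose_holomorphic[OF _ f open_ball sub]) simp
  moreover have "v \<notin> path_image (f \<circ> circlepath 0 1)"
  proof
    assume "v \<in> path_image (f \<circ> circlepath 0 1)"
    then obtain t where "norm t = 1" "v = f t" by (auto simp: path_image_compose)
    with nz[of t] show False by simp
  qed
  ultimately have "winding_number (f \<circ> circlepath 0 1) v =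
      1 / (2 * pi * \<i>) * contour_integral (f \<circ> circlepath 0 1) (\<lambda>w. 1 / (w - v))"
    by (rule winding_number_valid_path)
  also have "contour_integral (f \<circ> circlepath 0 1) (\<lambda>w. 1 / (w - v)) =
      contour_integral (circlepath 0 1) (\<lambda>w. deriv f w * (1 / (f w - v)))"
    using f sub by (intro contour_integral_comp_analyticW[of f "ball 0 R"]) (auto simp: analytic_on_open)
  also have "\<dots> = contour_integral (circlepath 0 1) (\<lambda>w. deriv f w * 1 / (f w - v))"
    by simp
  also have "\<dots> = 2 * pi * \<i> * (\<Sum>p\<in>{p \<in> ball 0 1. f p = v}. 1 * of_int (zorder (\<lambda>x. f x - v) p))"
    by (rule argument_principle_circle(2)[OF R f _ nz]) auto
  finally show ?thesis by (simp add: o_def)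
qed

lemma zorder_zero_pos:
  assumes "f holomorphic_on S" "open S" "connected S" "p \<in> S" "f p = v" "q \<in> S" "f q \<noteq> v"
  shows "zorder (\<lambda>x. f x - v) p > 0"
proof -
  have "(\<lambda>x. f x - v) holomorphic_on S" by (intro holomorphic_intros assms)
  from zorder_exist_zero[OF this assms(2-4)] show ?thesis
    using assms(5-7) by auto
qed

text \<open>The divided difference of \<open>\<psi>\<close> shows \<open>B - B p\<close> to be a divisor of
  \<open>f - f p\<close>.\<close>
lemma zorder_composition_ge:
  assumes B: "B holomorphic_on ball 0 1" "\<And>z. norm z < 1 \<Longrightarrow> norm (B z) < 1"
    and \<psi>: "\<psi> holomorphic_on ball 0 1" and fac: "\<And>z. norm z < 1 \<Longrightarrow> f z = \<psi> (B z)"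
    and p: "norm p < 1" and nc: "\<exists>q. norm q < 1 \<and> f q \<noteq> f p"
  shows "zorder (\<lambda>x. B x - B p) p \<le> zorder (\<lambda>x. f x - f p) p"
proof -
  define v where "v = B p"
  have v: "norm v < 1" using B(2) p by (simp add: v_def)
  \<comment> \<open>The divided difference of \<open>\<psi>\<close> at \<open>v\<close>.\<close>
  define h where "h u = (if u = v then deriv \<psi> v else (\<psi> u - \<psi> v) / (u - v))" for u
  have h: "h holomorphic_on ball 0 1"
    unfolding h_def using \<psi> v by (intro pole_lemma) auto
  have eq: "f x - f p = (B x - v) * h (B x)" if "norm x < 1" for x
    using fac[OF that] fac[OF p] by (simp add: h_def v_def)
  have sub: "B ` ball 0 1 \<subseteq> ball 0 1" using B(2) by auto
  have h1: "(\<lambda>x. B x - v) holomorphic_on ball 0 1" by (intro holomorphic_intros B)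
  have h2: "(\<lambda>x. h (B x)) holomorphic_on ball 0 1"
    using holomorphic_on_compose_gen[OF B(1) h sub] by (simp add: o_def)
  obtain q where q: "norm q < 1" "f q \<noteq> f p" using nc by blast
  have q': "B q - v \<noteq> 0" "h (B q) \<noteq> 0" using eq[OF q(1)] q(2) by auto
  have pb: "p \<in> ball 0 1" and qb: "q \<in> ball 0 1" using p q(1) by auto
  have "zorder (\<lambda>x. f x - f p) p = zorder (\<lambda>x. (B x - v) * h (B x)) p"
  proof (rule zorder_cong)
    have "\<forall>\<^sub>F x in at p. x \<in> ball 0 1" by (rule eventually_at_in_open'[OF open_ball pb])
    then show "\<forall>\<^sub>F x in at p. f x - f p = (B x - v) * h (B x)"
      by eventually_elim (use eq in auto)
  qed simp
  also have "\<dots> = zorder (\<lambda>x. B x - v) p + zorder (\<lambda>x. h (B x)) p"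
  proof (rule zorder_mult)
    have nzf: "\<exists>\<^sub>F x in at p. F x \<noteq> 0" if F: "F holomorphic_on ball 0 1" "F q \<noteq> 0" for F :: "complex \<Rightarrow> complex"
    proof (rule ccontr)
      assume "\<not> ?thesis"
      then have "\<forall>\<^sub>F x in at p. F x = 0" by (simp add: frequently_def)
      moreover have "\<forall>\<^sub>F x in at p. x \<in> ball 0 1" by (rule eventually_at_in_open'[OF open_ball pb])
      ultimately have "\<forall>\<^sub>F x in at p. F x = 0 \<and> x \<in> ball 0 1" by (rule eventually_conj)
      then obtain T where T: "open T" "p \<in> T" "\<And>x. x \<in> T \<Longrightarrow> x \<noteq> p \<Longrightarrow> F x = 0 \<and> x \<in> ball 0 1"
        unfolding eventually_at_topological by blast
      have "F q = 0"
      proof (rule analytic_continuation[OF F(1) open_ball connected_ball _ pb _ _ qb])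
        show "T \<inter> ball 0 1 - {p} \<subseteq> ball 0 1" by blast
        show "p islimpt (T \<inter> ball 0 1 - {p})"
          using T(1,2) pb by (metis IntI islimpt_punctured interior_limit_point interior_open open_Int open_ball)
        show "F z = 0" if "z \<in> T \<inter> ball 0 1 - {p}" for z using T(3) that by blast
      qed
      with F(2) show False by simp
    qed
    show "\<exists>\<^sub>F x in at p. B x - v \<noteq> 0" "\<exists>\<^sub>F x in at p. h (B x) \<noteq> 0"
      using nzf[OF h1] nzf[OF h2] q' by auto
    show "(\<lambda>x. B x - v) meromorphic_on {p}" "(\<lambda>x. h (B x)) meromorphic_on {p}"
      using h1 h2 pb holomorphic_on_imp_analytic_at analytic_on_imp_meromorphic_on open_ball by blast+
  qed
  finally have eqz: "zorder (\<lambda>x. f x - f p) p = zorder (\<lambda>x. B x - v) p + zorder (\<lambda>x. h (B x)) p" .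
  have "zorder (\<lambda>x. h (B x)) p \<ge> 0"
  proof -
    have "\<exists>w\<in>ball 0 1. h (B w) \<noteq> 0" using q'(2) qb by blast
    from zorder_exist_zero[OF h2 open_ball connected_ball pb this] show ?thesis
      by (cases "h (B p) = 0") simp_all
  qed
  then show ?thesis using eqz by (simp add: v_def)
qed

lemma bound_from_dense:
  fixes g :: "complex \<Rightarrow> complex"
  assumes g: "g holomorphic_on U" "open U" and dense: "\<And>x. x \<in> U \<Longrightarrow> \<forall>\<^sub>F y in at x. y \<in> V"
    and bd: "\<forall>\<^sub>F x in nhds z. x \<in> V \<longrightarrow> norm (g x) \<le> M"
  shows "\<forall>\<^sub>F x in nhds z. x \<in> U \<longrightarrow> norm (g x) \<le> M"
proof -
  from bd have "\<forall>\<^sub>F x in nhds z. \<forall>\<^sub>F y in nhds x. y \<in> V \<longrightarrow> norm (g y) \<le> M"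
    by (simp add: eventually_eventually)
  then show ?thesis
  proof eventually_elim
    case (elim x)
    show ?case
    proof
      assume x: "x \<in> U"
      have "isCont g x"
        using g x holomorphic_on_imp_continuous_on continuous_on_eq_continuous_at by blast
      then have "((\<lambda>y. norm (g y)) \<longlongrightarrow> norm (g x)) (at x)"
        by (simp add: isCont_def tendsto_norm)
      moreover have "\<forall>\<^sub>F y in at x. y \<in> V \<longrightarrow> norm (g y) \<le> M"
        using elim by (simp add: eventually_nhds_conv_at)
      with dense[OF x] have "\<forall>\<^sub>F y in at x. norm (g y) \<le> M"
        by eventually_elim simp
      ultimately show "norm (g x) \<le> M"
        using tendsto_upperbound at_neq_bot by blast
    qed
  qed
qed

text \<open>One round of Riemann's theorem on removable singularities. The local bounds are required on a larger
  set \<open>W\<close> and handed on to the extension, so that rounds can be chained.\<close>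
lemma removable_extension:
  fixes f :: "complex \<Rightarrow> complex"
  assumes U: "open U" "V \<subseteq> U" "U \<subseteq> W" and dense: "\<And>x. x \<in> U \<Longrightarrow> \<forall>\<^sub>F y in at x. y \<in> V"
    and f: "f holomorphic_on V" "open V"
    and bd: "\<And>z. z \<in> W \<Longrightarrow> \<exists>M. \<forall>\<^sub>F x in nhds z. x \<in> V \<longrightarrow> norm (f x) \<le> M"
  shows "\<exists>g. g holomorphic_on U \<and> (\<forall>x\<in>V. g x = f x) \<and>
    (\<forall>z\<in>W. \<exists>M. \<forall>\<^sub>F x in nhds z. x \<in> U \<longrightarrow> norm (g x) \<le> M)"
proof -
  have an: "remove_sings f analytic_on {z}" if z: "z \<in> U" for z
  proof -
    obtain M where M: "\<forall>\<^sub>F x in nhds z. x \<in> V \<longrightarrow> norm (f x) \<le> M" using bd z U(3) by blast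
    have Mat: "\<forall>\<^sub>F x in at z. norm (f x) \<le> M"
    proof -
      have "\<forall>\<^sub>F x in at z. x \<in> V \<longrightarrow> norm (f x) \<le> M" using M by (simp add: eventually_nhds_conv_at)
      with dense[OF z] show ?thesis by eventually_elim simp
    qed
    obtain r where r0: "r > 0" "\<And>y. y \<noteq> z \<Longrightarrow> dist y z < r \<Longrightarrow> y \<in> V"
      using dense[OF z] unfolding eventually_at by blast
    then have r: "r > 0" "\<And>y. y \<in> ball z r \<Longrightarrow> y \<noteq> z \<Longrightarrow> y \<in> V"
      by (auto simp: dist_commute)
    have hol: "f holomorphic_on ball z r - {z}"
    proof (rule holomorphic_on_subset[OF f(1)])
      show "ball z r - {z} \<subseteq> V" using r(2) by blast
    qed
    have "\<exists>h. h holomorphic_on ball z r \<and> (\<forall>x\<in>ball z r - {z}. h x = f x)"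
      using holomorphic_on_extend_bounded[OF hol, of] Mat r(1) by auto
    then obtain h where h: "h holomorphic_on ball z r" "\<And>x. x \<in> ball z r - {z} \<Longrightarrow> h x = f x" by blast
    have "(h \<longlongrightarrow> h z) (at z)"
      using h(1) r(1) holomorphic_on_imp_continuous_on continuous_on_eq_continuous_at[OF open_ball] 
      by (metis centre_in_ball isCont_def)
    moreover have "\<forall>\<^sub>F x in at z. h x = f x"
      using r(1) h(2) unfolding eventually_at by (auto intro!: exI[of _ r] simp: dist_commute)
    ultimately have "(f \<longlongrightarrow> h z) (at z)" by (rule Lim_transform_eventually)
    moreover have "isolated_singularity_at f z"
      unfolding isolated_singularity_at_def using r(1) hol
      by (intro exI[of _ r]) (simp add: analytic_on_open open_Diff)
    ultimately show ?thesis using remove_sings_analytic_at by blast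
  qed
  have eq: "remove_sings f x = f x" if "x \<in> V" for x
    using f that by (intro remove_sings_at_analytic) (simp add: holomorphic_on_imp_analytic_at)
  have hol: "remove_sings f holomorphic_on U"
    using an by (metis analytic_imp_holomorphic analytic_on_analytic_at)
  show ?thesis
  proof (intro exI[of _ "remove_sings f"] conjI ballI)
    show "remove_sings f holomorphic_on U" by (rule hol)
    show "remove_sings f x = f x" if "x \<in> V" for x using that by (rule eq)
    fix z assume "z \<in> W"
    then obtain M where M: "\<forall>\<^sub>F x in nhds z. x \<in> V \<longrightarrow> norm (f x) \<le> M" using bd by blast
    then have "\<forall>\<^sub>F x in nhds z. x \<in> V \<longrightarrow> norm (remove_sings f x) \<le> M"
      by eventually_elim (simp add: eq)
    then show "\<exists>M. \<forall>\<^sub>F x in nhds z. x \<in> U \<longrightarrow> norm (remove_sings f x) \<le> M"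
      using bound_from_dense[OF hol U(1) dense] by blast
  qed
qed

text \<open>Differentiation under the integral sign.\<close>
lemma contour_integral_quotient_holomorphic:
  assumes f: "continuous_on (sphere 0 1) f" and B: "continuous_on (sphere 0 1) B"
    and nz: "\<And>t v. norm t = 1 \<Longrightarrow> norm v < 1 \<Longrightarrow> B t \<noteq> v"
  shows "(\<lambda>v. contour_integral (circlepath 0 1) (\<lambda>x. f x / (B x - v))) holomorphic_on ball 0 1"
proof -
  define \<gamma> where "\<gamma> = circlepath (0::complex) 1"
  define D where "D s = 2 * of_real pi * \<i> * exp (2 * of_real pi * \<i> * complex_of_real s)" for s
  have \<gamma>c: "continuous_on (cbox 0 1) \<gamma>"
    unfolding \<gamma>_def using path_circlepath[of 0 1] by (simp add: path_def)
  have \<gamma>1: "norm (\<gamma> s) = 1" for s by (simp add: \<gamma>_def circlepath norm_exp_eq_Re)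
  have c1: "continuous_on (cbox 0 1) (\<lambda>s. f (\<gamma> s))"
    by (rule continuous_on_compose2[OF f \<gamma>c]) (use \<gamma>1 in auto)
  have c2: "continuous_on (cbox 0 1) (\<lambda>s. B (\<gamma> s))"
    by (rule continuous_on_compose2[OF B \<gamma>c]) (use \<gamma>1 in auto)
  have "(\<lambda>v. integral (cbox 0 1) (\<lambda>s. f (\<gamma> s) / (B (\<gamma> s) - v) * D s)) holomorphic_on ball 0 1"
  proof (rule leibniz_rule_holomorphic)
    show "((\<lambda>v. f (\<gamma> s) / (B (\<gamma> s) - v) * D s) has_field_derivative
        f (\<gamma> s) / (B (\<gamma> s) - v) ^ 2 * D s) (at v within ball 0 1)"
      if "v \<in> ball 0 1" "s \<in> cbox 0 1" for v s
      using nz[OF \<gamma>1[of s], of v] that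
      by (auto intro!: derivative_eq_intros simp: power2_eq_square)
    show "(\<lambda>s. f (\<gamma> s) / (B (\<gamma> s) - v) * D s) integrable_on cbox 0 1" if "v \<in> ball 0 1" for v
      using nz[OF \<gamma>1, of v] that unfolding D_def
      by (intro integrable_continuous continuous_intros c1 c2) auto
    have p1: "continuous_on (ball 0 1 \<times> cbox 0 1) (\<lambda>p::complex\<times>real. f (\<gamma> (snd p)))"
      by (rule continuous_on_compose2[OF c1]) (auto intro!: continuous_intros)
    have p2: "continuous_on (ball 0 1 \<times> cbox 0 1) (\<lambda>p::complex\<times>real. B (\<gamma> (snd p)))"
      by (rule continuous_on_compose2[OF c2]) (auto intro!: continuous_intros)
    show "continuous_on (ball 0 1 \<times> cbox 0 1) (\<lambda>(v, s). f (\<gamma> s) / (B (\<gamma> s) - v) ^ 2 * D s)"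
      unfolding D_def case_prod_unfold
      using nz[OF \<gamma>1] by (intro continuous_intros p1 p2) auto
  qed simp
  moreover have "contour_integral (circlepath 0 1) (\<lambda>x. f x / (B x - v)) =
      integral (cbox 0 1) (\<lambda>s. f (\<gamma> s) / (B (\<gamma> s) - v) * D s)" for v
    by (simp add: contour_integral_integral vector_derivative_circlepath \<gamma>_def D_def)
  ultimately show ?thesis by simp
qed

section \<open>Finite Blaschke products\<close>

definition blaschke_factor :: "complex \<Rightarrow> complex \<Rightarrow> complex" where
  "blaschke_factor a z = (z - a) / (1 - cnj a * z)"

definition blaschke :: "complex \<Rightarrow> complex multiset \<Rightarrow> complex \<Rightarrow> complex" where
  "blaschke c A z = c * (\<Prod>a\<in>#A. blaschke_factor a z)"

lemma blaschke_factor_denom: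
  assumes "norm a < 1" "norm z \<le> 1"
  shows "1 - cnj a * z \<noteq> 0"
proof
  assume "1 - cnj a * z = 0"
  then have "norm (cnj a * z) = 1" by simp
  moreover have "norm a * norm z < 1"
    using assms by (metis mult_left_le norm_ge_zero order.strict_trans1)
  ultimately show False by (simp add: norm_mult)
qed

lemma norm_blaschke_factor_circle:
  assumes "norm a < 1" "norm z = 1"
  shows "norm (blaschke_factor a z) = 1"
proof -
  have "z * cnj z = 1" using complex_norm_square[of z] assms(2) by simp
  then have "1 - cnj a * z = z * cnj (z - a)" by (simp add: algebra_simps)
  moreover have "z \<noteq> a" using assms by auto
  ultimately show ?thesis
    using assms(2) by (simp add: blaschke_factor_def norm_divide norm_mult del: complex_cnj_diff)
qed

lemma norm_blaschke_factor_less: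
  assumes "norm a < 1" "norm z < 1"
  shows "norm (blaschke_factor a z) < 1"
  using Moebius_function_norm_lt_1[OF assms, of 0]
  by (simp add: Moebius_function_def blaschke_factor_def)

lemma norm_blaschke_factor_mirror:
  assumes "w \<noteq> 0"
  shows "norm (blaschke_factor a (mirror w)) = 1 / norm (blaschke_factor a w)"
proof -
  have cw: "cnj w \<noteq> 0" using assms by simp
  have "1 / cnj w - a = (1 - a * cnj w) / cnj w" "1 - cnj a * (1 / cnj w) = (cnj w - cnj a) / cnj w"
    using cw by (simp_all add: diff_divide_distrib)
  then have "blaschke_factor a (mirror w) = cnj (1 - cnj a * w) / cnj (w - a)"
    using cw by (simp add: blaschke_factor_def mirror_def)
  then show ?thesis by (simp add: blaschke_factor_def norm_divide del: complex_cnj_diff)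
qed

lemma norm_blaschke_factor_ge_1:
  assumes a: "norm a < 1" and z: "norm z \<ge> 1" "1 - cnj a * z \<noteq> 0"
  shows "norm (blaschke_factor a z) \<ge> 1"
proof -
  have z0: "z \<noteq> 0" using z(1) by auto
  have "z \<noteq> a" using a z(1) by auto
  then have nz: "norm (blaschke_factor a z) > 0" using z(2) by (simp add: blaschke_factor_def)
  have "norm (blaschke_factor a (mirror z)) \<le> 1"
  proof (cases "norm z = 1")
    case True
    then show ?thesis using norm_blaschke_factor_circle[OF a] by (simp add: mirror_on_circle)
  next
    case False
    then have "norm z > 1" using z(1) by linarith
    then have "norm (mirror z) < 1" by (simp add: norm_mirror divide_less_eq)
    then show ?thesis using norm_blaschke_factor_less[OF a] by (simp add: less_imp_le)
  qed
  then show ?thesis using nz by (simp add: norm_blaschke_factor_mirror[OF z0])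
qed

lemma blaschke_factor_mirror: "a \<noteq> 0 \<Longrightarrow> blaschke_factor a w = (w - a) / (- cnj a * (w - mirror a))"
  by (simp add: blaschke_factor_def mirror_def algebra_simps)

text \<open>On a set of \<open>w\<close> that avoids the pole \<open>mirror a\<close>, the factor is bounded
  even for unbounded \<open>w\<close>.\<close>
lemma blaschke_factor_le:
  assumes "a \<noteq> 0" "\<delta> > 0" "\<delta> \<le> norm (w - mirror a)"
  shows "norm (blaschke_factor a w) \<le> (1 + norm (mirror a - a) / \<delta>) / norm a"
proof -
  have n: "norm (w - mirror a) > 0" using assms(2,3) by linarith
  have "norm (w - a) \<le> norm (w - mirror a) + norm (mirror a - a)"
    using norm_triangle_ineq[of "w - mirror a" "mirror a - a"] by simp
  also have "\<dots> \<le> norm (w - mirror a) + norm (mirror a - a) * (norm (w - mirror a) / \<delta>)"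
  proof -
    have "norm (mirror a - a) * 1 \<le> norm (mirror a - a) * (norm (w - mirror a) / \<delta>)"
      using assms by (intro mult_left_mono) (auto simp: field_simps)
    then show ?thesis by simp
  qed
  also have "\<dots> = (1 + norm (mirror a - a) / \<delta>) * norm (w - mirror a)"
    by (simp add: algebra_simps)
  finally have "norm (w - a) / norm (w - mirror a) \<le> 1 + norm (mirror a - a) / \<delta>"
    using n by (simp add: pos_divide_le_eq)
  then have "norm (w - a) / norm (w - mirror a) / norm a \<le> (1 + norm (mirror a - a) / \<delta>) / norm a"
    using assms(1) by (intro divide_right_mono) auto
  moreover have "norm (blaschke_factor a w) = norm (w - a) / norm (w - mirror a) / norm a"
    by (simp add: blaschke_factor_mirror[OF assms(1)] norm_divide norm_mult mult.commute)
  ultimately show ?thesis by simp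
qed

text \<open>Dually, away from the zero \<open>a\<close> the factor is bounded below, again uniformly in
  unbounded \<open>w\<close>. At \<open>mirror a\<close> itself the quotient has the junk value
  \<open>0\<close>, which has to be excluded.\<close>
lemma blaschke_factor_ge:
  assumes "a \<noteq> 0" "\<delta> > 0" "\<delta> \<le> norm (w - a)" "w \<noteq> mirror a"
  shows "norm (blaschke_factor a w) \<ge> 1 / (norm a * (1 + norm (a - mirror a) / \<delta>))"
proof -
  have n: "norm (w - a) > 0" "norm (w - mirror a) > 0" using assms by auto
  have "norm (w - mirror a) \<le> norm (w - a) + norm (a - mirror a)"
    using norm_triangle_ineq[of "w - a" "a - mirror a"] by simp
  also have "\<dots> \<le> norm (w - a) + norm (a - mirror a) * (norm (w - a) / \<delta>)"
  proof -
    have "norm (a - mirror a) * 1 \<le> norm (a - mirror a) * (norm (w - a) / \<delta>)"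
      using assms by (intro mult_left_mono) (auto simp: field_simps)
    then show ?thesis by simp
  qed
  also have "\<dots> = (1 + norm (a - mirror a) / \<delta>) * norm (w - a)"
    by (simp add: algebra_simps)
  finally have le: "norm (w - mirror a) \<le> (1 + norm (a - mirror a) / \<delta>) * norm (w - a)" .
  have K: "1 + norm (a - mirror a) / \<delta> > 0" using assms(2) by (simp add: add_pos_nonneg)
  have "1 / (1 + norm (a - mirror a) / \<delta>) \<le> norm (w - a) / norm (w - mirror a)"
    using le n K by (simp add: field_simps)
  then have "1 / (1 + norm (a - mirror a) / \<delta>) / norm a \<le> norm (w - a) / norm (w - mirror a) / norm a"
    by (intro divide_right_mono) auto
  moreover have "norm (blaschke_factor a w) = norm (w - a) / norm (w - mirror a) / norm a"
    by (simp add: blaschke_factor_mirror[OF assms(1)] norm_divide norm_mult mult.commute)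
  ultimately show ?thesis by (simp add: mult.commute)
qed

lemma blaschke_factor_analytic:
  assumes "\<rho> analytic_on {z}" "\<rho> z \<noteq> mirror a" "a \<noteq> 0"
  shows "(\<lambda>x. blaschke_factor a (\<rho> x)) analytic_on {z}"
proof -
  have "1 - cnj a * \<rho> z \<noteq> 0"
    using assms(2,3) by (auto simp: mirror_def field_simps)
  then show ?thesis
    unfolding blaschke_factor_def using assms(1) by (intro analytic_intros) auto
qed

lemma blaschke_empty [simp]: "blaschke c {#} z = c"
  by (simp add: blaschke_def)

lemma blaschke_add: "blaschke c (add_mset a A) z = blaschke_factor a z * blaschke c A z"
  by (simp add: blaschke_def)

lemma norm_blaschke_circle:
  assumes "set_mset A \<subseteq> ball 0 1" "norm c = 1" "norm z = 1"
  shows "norm (blaschke c A z) = 1"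
  using assms
  by (induction A) (auto simp: blaschke_add norm_mult norm_blaschke_factor_circle)

lemma norm_blaschke_less:
  assumes "set_mset A \<subseteq> ball 0 1" "norm c = 1" "norm z < 1" "A \<noteq> {#}"
  shows "norm (blaschke c A z) < 1"
proof -
  have le: "norm (blaschke c B z) \<le> 1" if "set_mset B \<subseteq> ball 0 1" for B
    using that
  proof (induction B)
    case (add b B)
    then show ?case
      using norm_blaschke_factor_less[of b z] assms(3) by (auto simp: blaschke_add norm_mult intro!: mult_le_one)
  qed (use assms in auto)
  obtain a B where A: "A = add_mset a B" using assms(4) by (cases A) auto
  have "norm (blaschke_factor a z) < 1" using norm_blaschke_factor_less assms(1,3) A by simp
  moreover have "norm (blaschke c B z) \<le> 1" using le assms(1) A by simp
  ultimately show ?thesis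
    by (simp add: A blaschke_add norm_mult) (metis mult_left_le norm_ge_zero order.strict_trans1)
qed

lemma norm_blaschke_ge_1:
  assumes "set_mset A \<subseteq> ball 0 1" "norm c = 1" "norm z \<ge> 1" "\<And>a. a \<in># A \<Longrightarrow> 1 - cnj a * z \<noteq> 0"
  shows "norm (blaschke c A z) \<ge> 1"
  using assms
proof (induction A)
  case (add a A)
  have "1 * 1 \<le> norm (blaschke_factor a z) * norm (blaschke c A z)"
    using add by (intro mult_mono norm_blaschke_factor_ge_1 add.IH) auto
  then show ?case by (simp add: blaschke_add norm_mult)
qed simp

lemma blaschke_eq_0_iff:
  assumes "set_mset A \<subseteq> ball 0 1" "norm c = 1" "norm z < 1"
  shows "blaschke c A z = 0 \<longleftrightarrow> z \<in># A"
proof -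
  have "blaschke_factor a z = 0 \<longleftrightarrow> z = a" if "a \<in># A" for a
    using blaschke_factor_denom[of a z] that assms by (auto simp: blaschke_factor_def)
  moreover have "c \<noteq> 0" using assms(2) by auto
  ultimately show ?thesis by (auto simp: blaschke_def prod_mset_zero_iff image_iff intro!: bexI[of _ z])
qed

lemma blaschke_holomorphic:
  assumes "\<And>a z. a \<in># A \<Longrightarrow> z \<in> S \<Longrightarrow> 1 - cnj a * z \<noteq> 0"
  shows "blaschke c A holomorphic_on S"
  using assms
proof (induction A)
  case empty
  then show ?case by (simp add: blaschke_def[abs_def])
next
  case (add a A)
  have "(\<lambda>z. blaschke_factor a z * blaschke c A z) holomorphic_on S"
    using add unfolding blaschke_factor_def by (intro holomorphic_intros add.IH) auto
  then show ?case by (simp add: blaschke_add cong: holomorphic_cong)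
qed

lemma blaschke_denom_radius:
  fixes A :: "complex multiset"
  assumes "set_mset A \<subseteq> ball 0 1"
  obtains R where "R > 1" "\<And>a z :: complex. a \<in># A \<Longrightarrow> norm z < R \<Longrightarrow> 1 - cnj a * z \<noteq> 0"
proof -
  define U where "U = (\<Inter>a\<in>set_mset A. {z. 1 - cnj a * z \<noteq> 0})"
  have "open U"
    unfolding U_def by (intro open_INT ballI open_Collect_neq continuous_intros) auto
  moreover have "cball 0 1 \<subseteq> U"
    unfolding U_def using assms blaschke_factor_denom by auto
  ultimately obtain R where R: "R > 1" "ball 0 R \<subseteq> U" by (rule cball_nbhd_radius)
  show ?thesis
  proof (rule that[OF R(1)])
    fix a z :: complex assume "a \<in># A" "norm z < R"
    then show "1 - cnj a * z \<noteq> 0" using R(2) by (force simp: U_def)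
  qed
qed

lemma blaschke_holomorphic_radius:
  assumes "set_mset A \<subseteq> ball 0 1"
  obtains R where "R > 1" "blaschke c A holomorphic_on ball 0 R"
proof -
  obtain R where R: "R > 1" "\<And>a z :: complex. a \<in># A \<Longrightarrow> norm z < R \<Longrightarrow> 1 - cnj a * z \<noteq> 0"
    using blaschke_denom_radius[OF assms] by blast
  have "blaschke c A holomorphic_on ball 0 R"
    using R(2) by (intro blaschke_holomorphic) auto
  with R(1) show ?thesis by (rule that)
qed

text \<open>Separating the factors with zero at \<open>p\<close> exhibits the power of
  \<open>x - p\<close>.\<close>
lemma zorder_blaschke:
  assumes A: "set_mset A \<subseteq> ball 0 1" and c: "norm c = 1" and p: "norm p < 1"
  shows "zorder (blaschke c A) p = int (count A p)"
proof -
  define A' where "A' = filter_mset (\<lambda>a. a \<noteq> p) A"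
  define n where "n = count A p"
  define g where "g z = blaschke c A' z * (1 / (1 - cnj p * z)) ^ n" for z
  have split: "A = replicate_mset n p + A'"
    unfolding n_def A'_def by (rule multiset_eqI) auto
  have A': "set_mset A' \<subseteq> ball 0 1" using A by (auto simp: A'_def)
  have eq: "blaschke c A z = g z * (z - p) ^ n" for z
    by (subst split) (simp add: blaschke_def g_def blaschke_factor_def power_divide)
  show ?thesis
  proof (rule zorder_eqI[of "ball 0 1"])
    have "blaschke c A' holomorphic_on ball 0 1"
      by (rule blaschke_holomorphic) (use A' blaschke_factor_denom in auto)
    then show "g holomorphic_on ball 0 1"
      unfolding g_def using blaschke_factor_denom[OF p] by (intro holomorphic_intros) auto
    have "blaschke c A' p \<noteq> 0" using blaschke_eq_0_iff[OF A' c p] by (simp add: A'_def)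
    then show "g p \<noteq> 0" using blaschke_factor_denom[OF p, of p] p by (simp add: g_def)
    show "blaschke c A w = g w * (w - p) powi int (count A p)" for w
      using eq by (simp add: n_def)
  qed (use p in auto)
qed

lemma finite_blaschke_product_iff:
  "finite_blaschke_product B \<longleftrightarrow>
     (\<exists>c A. norm c = 1 \<and> set_mset A \<subseteq> ball 0 1 \<and> (\<forall>z\<in>ball 0 1. B z = blaschke c A z))"
  by (simp add: finite_blaschke_product_def blaschke_def blaschke_factor_def)

lemma blaschke_order_eq_size:
  assumes A: "set_mset A \<subseteq> ball 0 1" and c: "norm c = 1"
    and B: "\<And>z. norm z < 1 \<Longrightarrow> B z = blaschke c A z"
  shows "blaschke_order B = size A"
proof -
  have "{a \<in> ball 0 1. B a = 0} = set_mset A"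
    using B blaschke_eq_0_iff[OF A c] A by auto
  moreover have "nat (zorder B a) = count A a" if "a \<in># A" for a
  proof -
    have a: "norm a < 1" using that A by auto
    have "\<forall>\<^sub>F z in at a. z \<in> ball 0 1" using a by (intro eventually_at_in_open') auto
    then have "\<forall>\<^sub>F z in at a. B z = blaschke c A z"
      by eventually_elim (use B in simp)
    then have "zorder B a = zorder (blaschke c A) a" by (rule zorder_cong) simp
    then show ?thesis using zorder_blaschke[OF A c a] by simp
  qed
  ultimately show ?thesis
    by (simp add: blaschke_order_def size_multiset_overloaded_eq)
qed

text \<open>The image of the circle lies on the circle, so its winding number is the same about all points of
  the disk; about \<open>0\<close> it counts the zeros.\<close>
lemma sum_zorder_blaschke:
  assumes A: "set_mset A \<subseteq> ball 0 1" and c: "norm c = 1" and v: "norm v < 1"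
  shows "(\<Sum>p\<in>{p \<in> ball 0 1. blaschke c A p = v}. zorder (\<lambda>x. blaschke c A x - v) p) = int (size A)"
proof -
  obtain R where R: "R > 1" "blaschke c A holomorphic_on ball 0 R"
    using blaschke_holomorphic_radius[OF A] by blast
  have nz: "blaschke c A t \<noteq> u" if "norm u < 1" "norm t = 1" for u t
    using norm_blaschke_circle[OF A c that(2)] that(1) by auto
  let ?\<gamma> = "blaschke c A \<circ> circlepath 0 1"
  have wn: "winding_number ?\<gamma> u =
      of_int (\<Sum>p\<in>{p \<in> ball 0 1. blaschke c A p = u}. zorder (\<lambda>x. blaschke c A x - u) p)"
    if "norm u < 1" for u
    by (rule winding_number_image_circle[OF R nz[OF that]])
  have "path_image (circlepath 0 1) \<subseteq> ball (0::complex) R" using R by auto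
  then have "valid_path ?\<gamma>"
    by (intro valid_path_compose_holomorphic[OF _ R(2) open_ball]) simp
  moreover have "path_image ?\<gamma> \<subseteq> sphere 0 1"
    using norm_blaschke_circle[OF A c] by (auto simp: path_image_compose)
  ultimately have "winding_number ?\<gamma> v = winding_number ?\<gamma> 0"
    by (intro winding_number_eq[of _ _ "ball 0 1"])
       (use v in \<open>auto simp: valid_path_imp_path pathfinish_compose pathstart_compose\<close>)
  moreover have Z: "{p \<in> ball 0 1. blaschke c A p = 0} = set_mset A"
    using blaschke_eq_0_iff[OF A c] A by auto
  moreover have "(\<Sum>p\<in>set_mset A. zorder (\<lambda>x. blaschke c A x - 0) p) = int (size A)"
  proof -
    have "(\<Sum>p\<in>set_mset A. zorder (\<lambda>x. blaschke c A x - 0) p) = (\<Sum>p\<in>set_mset A. int (count A p))"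
      using zorder_blaschke[OF A c] A by (intro sum.cong) auto
    then show ?thesis by (simp add: size_multiset_overloaded_eq)
  qed
  ultimately have "complex_of_int (\<Sum>p\<in>{p \<in> ball 0 1. blaschke c A p = v}. zorder (\<lambda>x. blaschke c A x - v) p)
      = of_int (int (size A))"
    using wn[OF v] wn[of 0, unfolded Z] by (simp only: norm_zero zero_less_one simp_thms)
  then show ?thesis using of_int_eq_iff by blast
qed

lemma zorder_blaschke_pos:
  assumes A: "set_mset A \<subseteq> ball 0 1" and c: "norm c = 1" and ne: "A \<noteq> {#}" and p: "norm p < 1"
  shows "zorder (\<lambda>x. blaschke c A x - blaschke c A p) p > 0"
proof -
  have hol: "blaschke c A holomorphic_on ball 0 1"
    by (rule blaschke_holomorphic) (use A blaschke_factor_denom in auto)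
  have "\<exists>q. norm q < 1 \<and> blaschke c A q \<noteq> blaschke c A p"
  proof (cases "blaschke c A p = 0")
    case True
    have "infinite (ball (0::complex) 1)" using uncountable_ball countable_finite zero_less_one by blast
    then have "\<not> ball 0 1 \<subseteq> set_mset A" using finite_subset finite_set_mset by blast
    then obtain q where q: "q \<in> ball 0 1" "q \<notin> set_mset A" by blast
    then have "norm q < 1" by simp
    then show ?thesis using True q(2) blaschke_eq_0_iff[OF A c, of q] by metis
  next
    case False
    obtain q where q: "q \<in># A" using ne by auto
    then have "norm q < 1" using A by auto
    then show ?thesis using q False blaschke_eq_0_iff[OF A c, of q] by metis
  qed
  then obtain q where "norm q < 1" "blaschke c A q \<noteq> blaschke c A p" by blast
  then show ?thesis
    by (intro zorder_zero_pos[OF hol open_ball connected_ball _ refl, of _ q]) (use p in auto)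
qed

lemma finite_blaschke_fibre:
  assumes A: "set_mset A \<subseteq> ball 0 1" and c: "norm c = 1" and v: "norm v < 1"
  shows "finite {p \<in> ball 0 1. blaschke c A p = v}"
proof -
  obtain R where R: "R > 1" "blaschke c A holomorphic_on ball 0 R"
    by (rule blaschke_holomorphic_radius[OF A])
  show ?thesis
    by (rule argument_principle_circle(1)[OF R R(2)]) (use norm_blaschke_circle[OF A c] v in auto)
qed

text \<open>A fibre has at most as many points as the order, since each of them counts at least once.\<close>
lemma blaschke_fibre_eqI:
  assumes A: "set_mset A \<subseteq> ball 0 1" and c: "norm c = 1" and ne: "A \<noteq> {#}" and v: "norm v < 1"
    and S: "S \<subseteq> {p \<in> ball 0 1. blaschke c A p = v}" "card S = size A"
  shows "S = {p \<in> ball 0 1. blaschke c A p = v}"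
proof (rule card_seteq[OF _ S(1)])
  let ?F = "{p \<in> ball 0 1. blaschke c A p = v}"
  show fin: "finite ?F" by (rule finite_blaschke_fibre[OF A c v])
  have "int (card ?F) = (\<Sum>p\<in>?F. 1)" by simp
  also have "\<dots> \<le> (\<Sum>p\<in>?F. zorder (\<lambda>x. blaschke c A x - v) p)"
    using zorder_blaschke_pos[OF A c ne] by (intro sum_mono) force
  also have "\<dots> = int (size A)" by (rule sum_zorder_blaschke[OF A c v])
  finally show "card ?F \<le> card S" using S(2) by simp
qed

text \<open>Dividing off one zero at a time leaves a function without zeros whose modulus is \<open>1\<close> on
  the circle; the maximum principle for it and for its inverse makes it constant.\<close>
lemma unimodular_simple_zeros_imp_blaschke:
  assumes "finite Z" and \<Omega>: "open \<Omega>" "cball 0 1 \<subseteq> \<Omega>" and "f holomorphic_on \<Omega>"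
    and "\<And>t. norm t = 1 \<Longrightarrow> norm (f t) = 1" and "Z \<subseteq> ball 0 1"
    and "\<And>z. norm z < 1 \<Longrightarrow> f z = 0 \<longleftrightarrow> z \<in> Z"
    and "\<And>z. z \<in> Z \<Longrightarrow> deriv f z \<noteq> 0"
  shows "\<exists>c. norm c = 1 \<and> (\<forall>z\<in>ball 0 1. f z = blaschke c (mset_set Z) z)"
  using assms(1,4-)
proof (induction Z arbitrary: f rule: finite_induct)
  case empty
  have nz: "f z \<noteq> 0" if "norm z \<le> 1" for z
    using empty(2)[of z] empty(4)[of z] that by (cases "norm z = 1") auto
  have hol: "f holomorphic_on cball 0 1" using empty(1) \<Omega>(2) by (rule holomorphic_on_subset)
  have holi: "(\<lambda>z. inverse (f z)) holomorphic_on cball 0 1"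
    using hol nz by (intro holomorphic_intros) auto
  have le: "norm (f z) \<le> 1" if "norm z < 1" for z
    by (rule maximum_modulus_frontier[of f "cball 0 1"])
       (use hol that empty(2) in \<open>auto intro: holomorphic_on_subset holomorphic_on_imp_continuous_on\<close>)
  have "norm (inverse (f z)) \<le> 1" if "norm z < 1" for z
    by (rule maximum_modulus_frontier[of "\<lambda>z. inverse (f z)" "cball 0 1"])
       (use holi that empty(2) in \<open>auto simp: norm_inverse intro: holomorphic_on_subset holomorphic_on_imp_continuous_on\<close>)
  then have ge: "norm (f z) \<ge> 1" if "norm z < 1" for z
    using that nz[of z] by (auto simp: norm_inverse inverse_le_1_iff)
  have n1: "norm (f z) = 1" if "norm z < 1" for z using le ge that by (meson antisym)
  have "f constant_on ball 0 1"
  proof (rule maximum_modulus_principle[where U="ball 0 1" and \<xi>=0])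
    show "f holomorphic_on ball 0 1" using hol by (rule holomorphic_on_subset) auto
  qed (use n1 in auto)
  then obtain c where c: "\<And>z. z \<in> ball 0 1 \<Longrightarrow> f z = c" by (auto simp: constant_on_def)
  have "norm c = 1" using n1[of 0] c[of 0] by simp
  with c show ?case by auto
next
  case (insert a Z)
  have a: "norm a < 1" using insert.prems(3) by simp
  have a\<Omega>: "a \<in> \<Omega>" using \<Omega>(2) a by auto
  have fa: "f a = 0" using insert.prems(4)[OF a] by simp
  have da: "deriv f a \<noteq> 0" using insert.prems(5) by simp
  define h where "h z = (if z = a then deriv f a else (f z - f a) / (z - a))" for z
  have hol_h: "h holomorphic_on \<Omega>"
    unfolding h_def using insert.prems(1) \<Omega>(1) a\<Omega> by (intro pole_lemma) (auto simp: interior_open)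
  have fh: "f z = (z - a) * h z" for z by (simp add: h_def fa)
  \<comment> \<open>Dividing \<open>f\<close> by \<open>blaschke_factor a\<close> keeps it unimodular on the
    circle and removes the zero \<open>a\<close>.\<close>
  define k where "k z = h z * (1 - cnj a * z)" for z
  have hol_k: "k holomorphic_on \<Omega>" unfolding k_def by (intro holomorphic_intros hol_h)
  have fk: "f z = blaschke_factor a z * k z" if "norm z \<le> 1" for z
    using blaschke_factor_denom[OF a that] by (simp add: fh k_def blaschke_factor_def)
  have "\<exists>c. norm c = 1 \<and> (\<forall>z\<in>ball 0 1. k z = blaschke c (mset_set Z) z)"
  proof (rule insert.IH[OF hol_k])
    show "norm (k t) = 1" if "norm t = 1" for t
      using insert.prems(2)[OF that] fk[of t] norm_blaschke_factor_circle[OF a that] that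
      by (simp add: norm_mult)
    show "Z \<subseteq> ball 0 1" using insert.prems(3) by simp
    show kz: "k z = 0 \<longleftrightarrow> z \<in> Z" if z: "norm z < 1" for z
    proof (cases "z = a")
      case True
      have "k a \<noteq> 0" using da blaschke_factor_denom[OF a, of a] a by (simp add: k_def h_def)
      then show ?thesis using True insert.hyps by simp
    next
      case False
      then have "blaschke_factor a z \<noteq> 0" using blaschke_factor_denom[OF a, of z] z by (simp add: blaschke_factor_def)
      then show ?thesis using fk[of z] insert.prems(4)[OF z] False z by simp
    qed
    show "deriv k z \<noteq> 0" if z: "z \<in> Z" for z
    proof
      assume dk: "deriv k z = 0"
      have z1: "norm z < 1" using z insert.prems(3) by auto
      have 1: "(k has_field_derivative 0) (at z)"
      proof -
        have "z \<in> \<Omega>" using z1 \<Omega>(2) by auto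
        then show ?thesis using holomorphic_derivI[OF hol_k \<Omega>(1), of z] dk by simp
      qed
      have "blaschke_factor a holomorphic_on ball 0 1"
        unfolding blaschke_factor_def using blaschke_factor_denom[OF a] by (intro holomorphic_intros) auto
      then have 2: "(blaschke_factor a has_field_derivative deriv (blaschke_factor a) z) (at z)"
        using holomorphic_derivI[OF _ open_ball] z1 by simp
      have "((\<lambda>x. blaschke_factor a x * k x) has_field_derivative 0) (at z)"
        using DERIV_mult[OF 2 1] kz[OF z1] z by simp
      then have "(f has_field_derivative 0) (at z)"
        by (rule has_field_derivative_transform_within_open[of _ _ _ "ball 0 1"]) (use fk z1 in auto)
      then show False using insert.prems(5)[of z] z DERIV_imp_deriv by auto
    qed
  qed
  then obtain c where c: "norm c = 1" "\<And>z. z \<in> ball 0 1 \<Longrightarrow> k z = blaschke c (mset_set Z) z" by blast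
  have "f z = blaschke c (mset_set (insert a Z)) z" if "z \<in> ball 0 1" for z
    using fk[of z] c(2)[OF that] that insert.hyps by (simp add: blaschke_add)
  with c(1) show ?case by blast
qed

text \<open>If \<open>f\<close> is constant on the fibres over a small open set, it is constant on all fibres:
  the mean of \<open>f\<close> over a fibre depends holomorphically on the value of the Blaschke product, it
  agrees with \<open>f\<close> on the small set, and the identity theorem does the rest.\<close>
lemma factor_through_blaschke:
  assumes A: "set_mset A \<subseteq> ball 0 1" and c: "norm c = 1" and ne: "A \<noteq> {#}"
    and R: "R > 1" and f: "f holomorphic_on ball 0 R"
    and V: "open V" "V \<noteq> {}" "V \<subseteq> ball 0 1"
    and fib: "\<And>x p. x \<in> V \<Longrightarrow> norm p < 1 \<Longrightarrow> blaschke c A p = blaschke c A x \<Longrightarrow> f p = f x"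
  shows "\<exists>\<psi>. \<psi> holomorphic_on ball 0 1 \<and> bounded (\<psi> ` ball 0 1) \<and>
    (\<forall>z\<in>ball 0 1. f z = \<psi> (blaschke c A z))"
proof -
  define B where "B = blaschke c A"
  define m where "m = size A"
  have m: "m > 0" using ne by (simp add: m_def nonempty_has_size)
  obtain R2 where R2: "R2 > 1" "B holomorphic_on ball 0 R2"
    unfolding B_def by (rule blaschke_holomorphic_radius[OF A])
  define R' where "R' = min R R2"
  have R': "R' > 1" "f holomorphic_on ball 0 R'" "B holomorphic_on ball 0 R'"
    using R R2 f by (auto simp: R'_def intro: holomorphic_on_subset)
  have lt: "norm (B z) < 1" if "norm z < 1" for z
    unfolding B_def using norm_blaschke_less[OF A c that ne] .
  have nz: "B t \<noteq> v" if "norm t = 1" "norm v < 1" for t v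
    using norm_blaschke_circle[OF A c that(1)] that(2) by (auto simp: B_def)
  \<comment> \<open>The mean of \<open>f\<close> over the fibre of the Blaschke product above \<open>v\<close>,
    written as a contour integral.\<close>
  define \<psi> where "\<psi> v = contour_integral (circlepath 0 1) (\<lambda>x. deriv B x * f x / (B x - v)) / (2 * pi * \<i> * m)" for v
  have sub: "sphere 0 1 \<subseteq> ball (0::complex) R'" using R'(1) by auto
  have "continuous_on (sphere 0 1) (\<lambda>x. deriv B x * f x)"
    using holomorphic_on_imp_continuous_on[OF holomorphic_on_mult[OF holomorphic_deriv[OF R'(3) open_ball] R'(2)]] sub
    by (rule continuous_on_subset)
  moreover have "continuous_on (sphere 0 1) B"
    using holomorphic_on_imp_continuous_on[OF R'(3)] sub by (rule continuous_on_subset)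
  ultimately have hol0: "(\<lambda>v. contour_integral (circlepath 0 1) (\<lambda>x. deriv B x * f x / (B x - v))) holomorphic_on ball 0 1"
    by (rule contour_integral_quotient_holomorphic) (use nz in auto)
  then have hol: "\<psi> holomorphic_on ball 0 1"
    unfolding \<psi>_def using m by (intro holomorphic_intros) auto
  have eqV: "\<psi> (B x) = f x" if x: "x \<in> V" for x
  proof -
    have bx: "norm (B x) < 1" using lt V(3) x by auto
    let ?F = "{p \<in> ball 0 1. B p = B x}"
    have "contour_integral (circlepath 0 1) (\<lambda>y. deriv B y * f y / (B y - B x)) =
         2 * pi * \<i> * (\<Sum>p\<in>?F. f p * of_int (zorder (\<lambda>y. B y - B x) p))"
      by (rule argument_principle_circle(2)[OF R'(1,3,2)]) (use nz bx in auto)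
    also have "(\<Sum>p\<in>?F. f p * of_int (zorder (\<lambda>y. B y - B x) p)) =
        (\<Sum>p\<in>?F. f x * of_int (zorder (\<lambda>y. B y - B x) p))"
      by (rule sum.cong) (use fib[OF x] in \<open>auto simp: B_def\<close>)
    also have "\<dots> = f x * of_int (\<Sum>p\<in>?F. zorder (\<lambda>y. B y - B x) p)"
      by (simp add: sum_distrib_left)
    also have "(\<Sum>p\<in>?F. zorder (\<lambda>y. B y - B x) p) = int m"
      using sum_zorder_blaschke[OF A c, of "B x"] bx by (simp add: B_def m_def)
    finally show ?thesis using m by (simp add: \<psi>_def)
  qed
  have holB: "B holomorphic_on ball 0 1" using R'(1,3) by (auto intro: holomorphic_on_subset)
  have holc: "(\<lambda>z. \<psi> (B z)) holomorphic_on ball 0 1"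
  proof -
    have "B ` ball 0 1 \<subseteq> ball 0 1" using lt by auto
    from holomorphic_on_compose_gen[OF holB hol this] show ?thesis by (simp add: o_def)
  qed
  have holf: "f holomorphic_on ball 0 1" using R'(1,2) by (auto intro: holomorphic_on_subset)
  have eq: "f z = \<psi> (B z)" if "z \<in> ball 0 1" for z
    by (rule analytic_continuation_open[OF V(1) open_ball V(2) connected_ball V(3) holf holc _ that])
       (use eqV in auto)
  have "\<psi> ` ball 0 1 \<subseteq> f ` cball 0 1"
  proof
    fix y assume "y \<in> \<psi> ` ball 0 1"
    then obtain v where v: "norm v < 1" "y = \<psi> v" by auto
    have sum: "(\<Sum>p\<in>{p \<in> ball 0 1. B p = v}. zorder (\<lambda>x. B x - v) p) = int m"
      unfolding B_def m_def by (rule sum_zorder_blaschke[OF A c v(1)])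
    have "{p \<in> ball 0 1. B p = v} \<noteq> {}"
    proof
      assume e: "{p \<in> ball 0 1. B p = v} = {}"
      show False using sum m unfolding e by simp
    qed
    then obtain p where p: "p \<in> ball 0 1" "B p = v" by blast
    then have "y = f p" using eq[OF p(1)] v by simp
    moreover have "p \<in> cball 0 1" using p(1) by simp
    ultimately show "y \<in> f ` cball 0 1" by (rule image_eqI)
  qed
  moreover have "bounded (f ` cball 0 1)"
    using R'(1) holomorphic_on_imp_continuous_on[OF R'(2)]
    by (intro compact_imp_bounded compact_continuous_image) (auto intro: continuous_on_subset)
  ultimately have "bounded (\<psi> ` ball 0 1)" using bounded_subset by blast
  with hol eq show ?thesis by (auto simp: B_def)
qed

text \<open>The factorization is given inside the disk only, where \<open>\<psi>\<close> lives; points on the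
  circle are reached as limits of pairs with equal values of the Blaschke product.\<close>
lemma factor_boundary:
  assumes A: "set_mset A \<subseteq> ball 0 1" and c: "norm c = 1" and ne: "A \<noteq> {#}"
    and f: "continuous_on (cball 0 1) f"
    and fac: "\<And>z. norm z < 1 \<Longrightarrow> f z = \<psi> (blaschke c A z)"
    and t: "norm t = 1" "norm w = 1" "blaschke c A w = blaschke c A t"
  shows "f w = (f t :: complex)"
proof (rule ccontr)
  assume neq: "f w \<noteq> f t"
  define d where "d = dist (f w) (f t) / 2"
  have d: "d > 0" using neq by (simp add: d_def)
  define B where "B = blaschke c A"
  obtain R where R0: "R > 1" "\<And>a z :: complex. a \<in># A \<Longrightarrow> norm z < R \<Longrightarrow> 1 - cnj a * z \<noteq> 0"
    using blaschke_denom_radius[OF A] by blast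
  have R: "R > 1" "B holomorphic_on ball 0 R"
    unfolding B_def using R0 by (auto intro!: blaschke_holomorphic)
  have "\<exists>e>0. \<forall>x\<in>cball 0 1. dist x u < e \<longrightarrow> dist (f x) (f u) < d" if "norm u = 1" for u
    using f d that unfolding continuous_on_iff by simp
  then obtain e1 e2 where e1: "e1 > 0" "\<And>x. x \<in> cball 0 1 \<Longrightarrow> dist x w < e1 \<Longrightarrow> dist (f x) (f w) < d"
    and e2: "e2 > 0" "\<And>x. x \<in> cball 0 1 \<Longrightarrow> dist x t < e2 \<Longrightarrow> dist (f x) (f t) < d"
    using t by metis
  \<comment> \<open>The image of \<open>U\<close> is a neighbourhood of \<open>B t = B w\<close>, so points of
    the disk near \<open>t\<close> have partners in the disk near \<open>w\<close> with the same value of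
    \<open>B\<close>.\<close>
  define U where "U = ball w e1 \<inter> ball 0 R"
  have wU: "w \<in> U" using e1(1) t(2) R(1) by (simp add: U_def)
  have "open (B ` U)"
  proof (rule open_mapping_thm[OF R(2) open_ball connected_ball])
    show "\<not> B constant_on ball 0 R"
    proof
      assume "B constant_on ball 0 R"
      then obtain k where k: "\<And>z. z \<in> ball 0 R \<Longrightarrow> B z = k" by (auto simp: constant_on_def)
      have "norm (B 0) < 1" unfolding B_def by (rule norm_blaschke_less[OF A c _ ne]) simp
      moreover have "norm (B t) = 1" unfolding B_def by (rule norm_blaschke_circle[OF A c t(1)])
      ultimately show False using k[of 0] k[of t] R(1) t(1) by simp
    qed
  qed (auto simp: U_def)
  then have nb: "\<forall>\<^sub>F y in nhds (B t). y \<in> B ` U"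
    by (rule eventually_nhds_in_open) (use wU t(3) in \<open>auto simp: B_def intro!: image_eqI[of _ _ w]\<close>)
  have "isCont B t"
    using R t(1) by (intro analytic_at_imp_isCont holomorphic_on_imp_analytic_at[OF R(2) open_ball]) simp
  then have "\<forall>\<^sub>F x in nhds t. B x \<in> B ` U"
    using nb by (rule eventually_nhds_compose_cont)
  moreover have "\<forall>\<^sub>F x in nhds t. dist x t < e2" unfolding eventually_nhds_metric using e2(1) by blast
  ultimately have "\<forall>\<^sub>F x in nhds t. B x \<in> B ` U \<and> dist x t < e2" by (rule eventually_conj)
  then obtain r where r: "r > 0" "\<And>x. dist x t < r \<Longrightarrow> B x \<in> B ` U \<and> dist x t < e2"
    unfolding eventually_nhds_metric by blast
  have "t \<in> closure (ball 0 1)" using t(1) by simp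
  then obtain x where x: "x \<in> ball 0 1" "dist x t < r" using r(1) closure_approachable by blast
  obtain y where y: "y \<in> U" "B y = B x" using r(2)[OF x(2)] by (metis imageE)
  have Bx: "norm (B x) < 1" unfolding B_def using x(1) by (intro norm_blaschke_less[OF A c _ ne]) simp
  have yn: "norm y < 1"
  proof (rule ccontr)
    assume "\<not> norm y < 1"
    then have "norm (blaschke c A y) \<ge> 1"
      using y(1) R0(2) by (intro norm_blaschke_ge_1[OF A c]) (auto simp: U_def)
    then show False using y(2) Bx by (simp add: B_def)
  qed
  have "f y = f x" using fac[OF yn] fac[of x] y(2) x(1) by (simp add: B_def)
  moreover have "dist (f y) (f w) < d"
    using e1(2)[of y] y(1) yn by (simp add: U_def dist_commute)
  moreover have "dist (f x) (f t) < d"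
    using e2(2)[of x] x r(2)[OF x(2)] by simp
  ultimately have "dist (f w) (f t) < d + d"
    using dist_triangle_less_add[of "f w" "f y" d "f t" d] by (simp add: dist_commute)
  then show False by (simp add: d_def)
qed

section \<open>Blaschke products as coverings of the circle\<close>

lemma cis_eq_cis_iff: "cis x = cis y \<longleftrightarrow> (\<exists>n::int. x = y + 2 * pi * n)"
  using sin_cos_eq_iff[of x y] by (auto simp: complex_eq_iff)

lemma unit_circle_cis: "norm t = 1 \<Longrightarrow> cis (Arg t) = t"
  by (metis cis_Arg norm_zero sgn_eq div_by_1 of_real_1 zero_neq_one)

text \<open>Arcs are uncountable.\<close>
lemma circle_avoids_countable:
  fixes t :: complex
  assumes C: "countable C" and t: "norm t = 1" and N: "open N" "t \<in> N"
  obtains s where "norm s = 1" "s \<in> N" "s \<notin> C"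
proof -
  define x where "x = Arg t"
  have tx: "cis x = t" using unit_circle_cis[OF t] by (simp add: x_def)
  have "((\<lambda>y. cis y) \<longlongrightarrow> cis x) (nhds x)"
    by (intro tendsto_cis filterlim_ident)
  then have "\<forall>\<^sub>F y in nhds x. cis y \<in> N"
    by (rule topological_tendstoD) (use N tx in auto)
  then obtain d where d: "d > 0" "\<And>y. dist y x < d \<Longrightarrow> cis y \<in> N"
    unfolding eventually_nhds_metric by blast
  define e where "e = min (d / 2) 1"
  have e: "e > 0" "e < d" "e < 2 * pi" using d(1) pi_gt3 by (auto simp: e_def)
  have con: "connected (cis ` {x..x + e})"
    by (intro connected_continuous_image continuous_intros) simp
  have neq: "cis x \<noteq> cis (x + e)"
  proof
    assume "cis x = cis (x + e)"
    then have "cis (x + e) = cis x" by simp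
    then obtain n :: int where "x + e = x + 2 * pi * n" by (subst (asm) cis_eq_cis_iff) (elim exE)
    then have en: "e = 2 * pi * n" by simp
    with e have "real_of_int n > 0" "real_of_int n < 1"
      by (simp_all add: zero_less_mult_iff)
    then have "0 < n" "n < 1" by (simp_all only: of_int_0_less_iff of_int_less_1_iff)
    then show False by simp
  qed
  have "uncountable (cis ` {x..x + e})"
    by (rule connected_uncountable[OF con _ _ neq]) (use e in auto)
  then have "\<not> cis ` {x..x + e} \<subseteq> C" using C countable_subset by blast
  then obtain y where y: "y \<in> {x..x + e}" "cis y \<notin> C" by blast
  have "dist y x < d" using y(1) e by (auto simp: dist_real_def)
  then show ?thesis using that[of "cis y"] d(2) y(2) by simp
qed

lemma blaschke_factor_inj_circle:
  assumes a: "norm a < 1" and t: "norm t = 1" "norm w = 1" and eq: "blaschke_factor a t = blaschke_factor a w"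
  shows "t = w"
proof -
  have nz: "1 - cnj a * t \<noteq> 0" "1 - cnj a * w \<noteq> 0" using blaschke_factor_denom a t by auto
  have "(t - a) * (1 - cnj a * w) = (w - a) * (1 - cnj a * t)"
    using eq nz by (simp add: blaschke_factor_def frac_eq_eq)
  then have "(t - w) * (1 - a * cnj a) = 0" by (simp add: algebra_simps)
  moreover have "1 - a * cnj a \<noteq> 0"
    using blaschke_factor_denom[OF a, of a] a by (simp add: mult.commute)
  ultimately show ?thesis by simp
qed

lemma periodic_shift_int:
  fixes f :: "real \<Rightarrow> real"
  assumes "\<And>x. f (x + p) = f x + q"
  shows "f (x + p * of_int n) = f x + q * of_int n"
proof -
  have nat: "f (x + p * of_nat n) = f x + q * of_nat n" for x and n :: nat
  proof (induction n)
    case (Suc n)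
    have "f (x + p * of_nat (Suc n)) = f ((x + p * of_nat n) + p)" by (simp add: algebra_simps)
    then show ?case using assms[of "x + p * of_nat n"] Suc by (simp add: algebra_simps)
  qed simp
  show ?thesis
  proof (cases n)
    case (nonneg k)
    then show ?thesis using nat[of x k] by simp
  next
    case (neg k)
    then have n: "real_of_int n = - real (Suc k)" by simp
    have "x + p * of_int n + p * real (Suc k) = x" unfolding n by (simp add: algebra_simps)
    then show ?thesis using nat[of "x + p * of_int n" "Suc k"] unfolding n by (simp add: algebra_simps)
  qed
qed

text \<open>A Blaschke factor is an orientation preserving homeomorphism of the circle, and its argument can be
  written down with the principal logarithm.\<close>
lemma blaschke_factor_lift:
  assumes a: "norm a < 1"
  shows "\<exists>\<beta>. continuous_on UNIV \<beta> \<and> strict_mono \<beta> \<and>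
    (\<forall>x. blaschke_factor a (cis x) = cis (\<beta> x)) \<and> (\<forall>x. \<beta> (x + 2 * pi) = \<beta> x + 2 * pi)"
proof -
  \<comment> \<open>For \<open>z = cis x\<close> the factor is \<open>z * u / cnj u\<close>, where
    \<open>u = 1 - a / z\<close> lies in the right half plane; so the principal logarithm gives the
    argument.\<close>
  define u where "u x = 1 - a * cis (- x)" for x
  define \<beta> where "\<beta> x = x + 2 * Im (Ln (u x))" for x
  have Re: "Re (u x) > 0" for x
  proof -
    have "Re (a * cis (- x)) \<le> norm (a * cis (- x))" by (rule complex_Re_le_cmod)
    also have "\<dots> < 1" using a by (simp add: norm_mult)
    finally show ?thesis by (simp add: u_def)
  qed
  have un: "u x \<noteq> 0" "u x \<notin> \<real>\<^sub>\<le>\<^sub>0" for x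
    using Re[of x] by (auto simp: complex_nonpos_Reals_iff)
  have cont: "continuous_on UNIV \<beta>"
    unfolding \<beta>_def u_def by (intro continuous_intros) (use un in \<open>auto simp: u_def\<close>)
  have eq: "blaschke_factor a (cis x) = cis (\<beta> x)" for x
  proof -
    have "cis x - a = cis x * u x" by (simp add: u_def algebra_simps cis_mult)
    moreover have "1 - cnj a * cis x = cnj (u x)" by (simp add: u_def cis_cnj)
    ultimately have "blaschke_factor a (cis x) = cis x * (u x / cnj (u x))"
      by (simp add: blaschke_factor_def)
    also have "u x / cnj (u x) = exp (Ln (u x)) / cnj (exp (Ln (u x)))"
      using un by simp
    also have "\<dots> = exp (Ln (u x) - cnj (Ln (u x)))"
      by (simp add: exp_diff exp_cnj)
    also have "Ln (u x) - cnj (Ln (u x)) = \<i> * of_real (2 * Im (Ln (u x)))"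
      by (simp add: complex_eq_iff)
    also have "exp \<dots> = cis (2 * Im (Ln (u x)))" by (simp add: cis_conv_exp)
    finally show ?thesis by (simp add: cis_mult \<beta>_def)
  qed
  have per: "\<beta> (x + 2 * pi) = \<beta> x + 2 * pi" for x
  proof -
    have "cis (- (x + 2 * pi)) = cis (- x)"
      by (subst cis_eq_cis_iff) (auto intro!: exI[of _ "-1"])
    then show ?thesis by (simp add: \<beta>_def u_def)
  qed
  \<comment> \<open>Injective and continuous with a positive period increment, hence increasing.\<close>
  have inj: "inj \<beta>"
  proof
    fix x y assume xy: "\<beta> x = \<beta> y"
    then have "cis x = cis y" using blaschke_factor_inj_circle[OF a, of "cis x" "cis y"] eq by simp
    then obtain n :: int where n: "x = y + 2 * pi * n" using cis_eq_cis_iff by blast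
    have "\<beta> x = \<beta> y + 2 * pi * n" unfolding n by (rule periodic_shift_int[of \<beta> "2 * pi" "2 * pi", OF per])
    then show "x = y" using xy n by simp
  qed
  have "strict_mono \<beta>"
  proof
    fix x y :: real assume xy: "x < y"
    obtain n :: nat where n: "(y - x) / (2 * pi) < n" using reals_Archimedean2 by blast
    then have y: "y < x + 2 * pi * n" by (simp add: field_simps)
    have \<beta>M: "\<beta> (x + 2 * pi * n) = \<beta> x + 2 * pi * n"
      using periodic_shift_int[of \<beta> "2 * pi" "2 * pi" x "int n", OF per] by simp
    have "n > 0" using xy y by (cases n) auto
    then have "\<beta> x < \<beta> (x + 2 * pi * n)" unfolding \<beta>M by simp
    moreover have "(\<beta> x < \<beta> y \<and> \<beta> y < \<beta> (x + 2 * pi * n)) \<or> (\<beta> (x + 2 * pi * n) < \<beta> y \<and> \<beta> y < \<beta> x)"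
      using cont inj by (intro continuous_inj_imp_mono[OF xy y]) (auto intro: continuous_on_subset inj_on_subset)
    ultimately show "\<beta> x < \<beta> y" by linarith
  qed
  with cont eq per show ?thesis by blast
qed

text \<open>Arguments add up; one increasing summand is enough to make the sum increasing.\<close>
lemma blaschke_lift:
  assumes "set_mset A \<subseteq> ball 0 1" "norm c = 1"
  shows "\<exists>\<beta>. continuous_on UNIV \<beta> \<and> mono \<beta> \<and> (A \<noteq> {#} \<longrightarrow> strict_mono \<beta>) \<and>
    (\<forall>x. blaschke c A (cis x) = cis (\<beta> x)) \<and> (\<forall>x. \<beta> (x + 2 * pi) = \<beta> x + 2 * pi * size A)"
  using assms
proof (induction A)
  case empty
  then show ?case
    using unit_circle_cis[of c] by (intro exI[of _ "\<lambda>_. Arg c"]) (auto intro: monoI)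
next
  case (add a A)
  obtain \<beta> where \<beta>: "continuous_on UNIV \<beta>" "mono \<beta>" "\<And>x. blaschke c A (cis x) = cis (\<beta> x)"
    "\<And>x. \<beta> (x + 2 * pi) = \<beta> x + 2 * pi * size A"
    using add by auto
  obtain \<alpha> where \<alpha>: "continuous_on UNIV \<alpha>" "strict_mono \<alpha>" "\<And>x. blaschke_factor a (cis x) = cis (\<alpha> x)"
    "\<And>x. \<alpha> (x + 2 * pi) = \<alpha> x + 2 * pi"
    using blaschke_factor_lift[of a] add.prems by auto
  have sm: "strict_mono (\<lambda>x. \<alpha> x + \<beta> x)"
    using \<alpha>(2) \<beta>(2) by (auto simp: strict_mono_def mono_def intro!: add_less_le_mono)
  show ?case
  proof (intro exI[of _ "\<lambda>x. \<alpha> x + \<beta> x"] conjI impI allI)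
    show "continuous_on UNIV (\<lambda>x. \<alpha> x + \<beta> x)" by (intro continuous_intros \<alpha> \<beta>)
    show "mono (\<lambda>x. \<alpha> x + \<beta> x)" using sm by (rule strict_mono_mono)
    show "blaschke c (add_mset a A) (cis x) = cis (\<alpha> x + \<beta> x)" for x
      by (simp add: blaschke_add \<alpha> \<beta> cis_mult)
    show "\<alpha> (x + 2 * pi) + \<beta> (x + 2 * pi) = \<alpha> x + \<beta> x + 2 * pi * size (add_mset a A)" for x
      unfolding \<alpha>(4) \<beta>(4) by (simp add: algebra_simps)
  qed (rule sm)
qed

text \<open>On the circle a Blaschke product of order \<open>m\<close> is an \<open>m\<close>-fold covering.
  Conjugating by an increasing lift turns it into \<open>x \<mapsto> m x\<close>, whose deck transformations are
  visible.\<close>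
lemma blaschke_deck_maps:
  assumes A: "set_mset A \<subseteq> ball 0 1" and c: "norm c = 1" and ne: "A \<noteq> {#}"
  obtains \<sigma> :: "nat \<Rightarrow> complex \<Rightarrow> complex" where
    "\<And>k t. norm t = 1 \<Longrightarrow> norm (\<sigma> k t) = 1"
    "\<And>k. continuous_on (sphere 0 1) (\<sigma> k)"
    "\<And>t w. norm t = 1 \<Longrightarrow> norm w = 1 \<Longrightarrow>
       blaschke c A w = blaschke c A t \<longleftrightarrow> (\<exists>k<size A. w = \<sigma> k t)"
    "\<And>k l t. norm t = 1 \<Longrightarrow> k < size A \<Longrightarrow> l < size A \<Longrightarrow> \<sigma> k t = \<sigma> l t \<Longrightarrow> k = l"
proof -
  define m where "m = size A"
  have m: "m > 0" using ne by (simp add: m_def nonempty_has_size)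
  obtain \<beta> where \<beta>: "continuous_on UNIV \<beta>" "strict_mono \<beta>" "\<And>x. blaschke c A (cis x) = cis (\<beta> x)"
    "\<And>x. \<beta> (x + 2 * pi) = \<beta> x + 2 * pi * m"
    using blaschke_lift[OF A c] ne by (auto simp: m_def)
  have \<beta>s: "\<beta> (x + 2 * pi * of_int n) = \<beta> x + 2 * pi * m * of_int n" for x and n :: int
    using periodic_shift_int[of \<beta> "2 * pi" "2 * pi * m" x n] \<beta>(4) by simp
  have "surj \<beta>"
  proof -
    have "\<exists>x. \<beta> x = y" for y
    proof -
      obtain n :: nat where n: "\<bar>y - \<beta> 0\<bar> / (2 * pi * m) < n" using reals_Archimedean2 by blast
      then have n': "\<bar>y - \<beta> 0\<bar> < 2 * pi * m * n" using m by (simp add: field_simps)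
      have "\<beta> (2 * pi * n) = \<beta> 0 + 2 * pi * m * n" "\<beta> (- (2 * pi * n)) = \<beta> 0 - 2 * pi * m * n"
        using \<beta>s[of 0 "int n"] \<beta>s[of 0 "- int n"] by auto
      then have "\<exists>x. - (2 * pi * n) \<le> x \<and> x \<le> 2 * pi * n \<and> \<beta> x = y"
        using n' by (intro IVT') (auto intro: continuous_on_subset[OF \<beta>(1)] mult_nonneg_nonneg)
      then show ?thesis by blast
    qed
    then show ?thesis by (metis surjI surj_def)
  qed
  define \<gamma> where "\<gamma> = inv \<beta>"
  have \<beta>\<gamma>: "\<beta> (\<gamma> y) = y" for y using \<open>surj \<beta>\<close> by (simp add: \<gamma>_def surj_f_inv_f)
  have \<gamma>\<beta>: "\<gamma> (\<beta> x) = x" for x using \<beta>(2) by (simp add: \<gamma>_def strict_mono_imp_inj_on inv_f_f)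
  have \<beta>_eq: "\<beta> x = \<beta> y \<longleftrightarrow> x = y" for x y using \<beta>(2) strict_mono_eq by blast
  have \<gamma>c: "continuous_on UNIV \<gamma>"
  proof (rule continuous_onI_mono)
    have "\<gamma> ` UNIV = UNIV" using \<gamma>\<beta> by (metis surjI)
    then show "open (\<gamma> ` UNIV)" by simp
    show "\<gamma> x \<le> \<gamma> y" if "x \<le> y" for x y
      using that \<beta>\<gamma> \<beta>(2) by (metis strict_mono_less_eq)
  qed
  \<comment> \<open>Adding \<open>2 * pi * k\<close> to the argument of the product does not change its
    value.\<close>
  define d where "d k x = \<gamma> (\<beta> x + 2 * pi * real k)" for k x
  have \<beta>d: "\<beta> (d k x) = \<beta> x + 2 * pi * k" for k x by (simp add: d_def \<beta>\<gamma>)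
  have ds: "d k (x + 2 * pi * of_int n) = d k x + 2 * pi * of_int n" for k x and n :: int
    using \<beta>_eq[of "d k (x + 2 * pi * of_int n)" "d k x + 2 * pi * of_int n"] by (simp add: \<beta>d \<beta>s)
  have dc: "continuous_on UNIV (d k)" for k
    unfolding d_def by (intro continuous_on_compose2[OF \<gamma>c] continuous_intros \<beta>) auto
  define \<sigma> where "\<sigma> k t = cis (d k (Arg t))" for k t
  have \<sigma>: "\<sigma> k (cis x) = cis (d k x)" for k x
  proof -
    have "cis (Arg (cis x)) = cis x" by (rule unit_circle_cis) simp
    then obtain n :: int where "Arg (cis x) = x + 2 * pi * n" using cis_eq_cis_iff by blast
    then show ?thesis unfolding \<sigma>_def by (subst cis_eq_cis_iff) (auto simp: ds)
  qed
  show ?thesis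
  proof
    show "norm (\<sigma> k t) = 1" for k t by (simp add: \<sigma>_def)
    show "continuous_on (sphere 0 1) (\<sigma> k)" for k
      unfolding continuous_on_eq_continuous_within
    proof
      fix t :: complex assume t: "t \<in> sphere 0 1"
      then have t0: "t \<noteq> 0" and t1: "cis (Arg t) = t" by (auto simp: unit_circle_cis)
      have div: "isCont (\<lambda>w. w / t) t"
        using t0 by (intro continuous_intros)
      have "isCont Arg (t / t)"
        using t0 by (intro continuous_at_Arg) simp
      with div have "isCont (\<lambda>w. Arg (w / t)) t"
        by (rule isCont_o2)
      then have arg: "isCont (\<lambda>w. Arg t + Arg (w / t)) t"
        by (intro isCont_add continuous_const)
      have dck: "isCont (d k) y" for y
        using dc by (simp add: continuous_on_eq_continuous_at)
      have "isCont (\<lambda>w. d k (Arg t + Arg (w / t))) t"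
        using isCont_o2[OF arg dck] .
      then have "isCont (\<lambda>w. cis (d k (Arg t + Arg (w / t)))) t"
        unfolding isCont_def by (rule tendsto_cis)
      then have "continuous (at t within sphere 0 1) (\<lambda>w. cis (d k (Arg t + Arg (w / t))))"
        by (rule continuous_at_imp_continuous_at_within)
      then show "continuous (at t within sphere 0 1) (\<sigma> k)"
      proof (rule continuous_transform_within[where \<delta>=1])
        show "cis (d k (Arg t + Arg (w / t))) = \<sigma> k w" if "w \<in> sphere 0 1" for w
        proof -
          have "cis (Arg t + Arg (w / t)) = t * (w / t)"
            using t1 unit_circle_cis[of "w / t"] that t by (simp add: norm_divide flip: cis_mult)
          then have "w = cis (Arg t + Arg (w / t))" using t0 by simp
          then show ?thesis using \<sigma>[of k "Arg t + Arg (w / t)"] by simp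
        qed
      qed (use t in auto)
    qed
    fix t :: complex assume t: "norm t = 1"
    define x where "x = Arg t"
    have tx: "t = cis x" using unit_circle_cis[OF t] by (simp add: x_def)
    show "blaschke c A w = blaschke c A t \<longleftrightarrow> (\<exists>k<size A. w = \<sigma> k t)" if w: "norm w = 1" for w
    proof
      assume "\<exists>k<size A. w = \<sigma> k t"
      then obtain k where "w = cis (d k x)" by (auto simp: tx \<sigma>)
      then have "blaschke c A w = cis (\<beta> x + 2 * pi * k)" by (simp add: \<beta> \<beta>d)
      also have "\<dots> = cis (\<beta> x)" by (subst cis_eq_cis_iff) (auto intro!: exI[of _ "int k"])
      finally show "blaschke c A w = blaschke c A t" by (simp add: tx \<beta>)
    next
      assume eq: "blaschke c A w = blaschke c A t"
      define y where "y = Arg w"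
      have wy: "w = cis y" using unit_circle_cis[OF w] by (simp add: y_def)
      from eq have "cis (\<beta> y) = cis (\<beta> x)" by (simp add: tx wy \<beta>)
      then obtain j :: int where j: "\<beta> y = \<beta> x + 2 * pi * j" by (subst (asm) cis_eq_cis_iff) (elim exE)
      \<comment> \<open>A shift by \<open>m\<close> turns of the product is one turn of the circle, so only
        \<open>j mod m\<close> matters.\<close>
      define k where "k = nat (j mod int m)"
      define q where "q = j div int m"
      have jk: "j = int m * q + int k" "k < m" using m by (auto simp: k_def q_def nat_less_iff)
      have "\<beta> (y + 2 * pi * of_int (- q)) = \<beta> (d k x)"
      proof -
        have "real_of_int j = real m * of_int q + real k"
          using arg_cong[OF jk(1), of real_of_int] by simp
        then show ?thesis unfolding \<beta>s \<beta>d j by (simp add: algebra_simps)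
      qed
      then have "d k x = y + 2 * pi * of_int (- q)" by (simp only: \<beta>_eq)
      then have "cis (d k x) = cis y" by (subst cis_eq_cis_iff) (rule exI)
      then have "w = \<sigma> k t" by (simp add: wy tx \<sigma>)
      with jk(2) show "\<exists>k<size A. w = \<sigma> k t" by (auto simp: m_def)
    qed
    show "k = l" if kl: "k < size A" "l < size A" "\<sigma> k t = \<sigma> l t" for k l
    proof -
      have "cis (d k x) = cis (d l x)" using kl(3) by (simp add: tx \<sigma>)
      then obtain n :: int where n: "d k x = d l x + 2 * pi * n" by (subst (asm) cis_eq_cis_iff) (elim exE)
      then have "\<beta> (d k x) = \<beta> (d l x) + 2 * pi * m * n" by (simp add: \<beta>s)
      then have "2 * pi * (real k) = 2 * pi * (real l + m * n)" by (simp add: \<beta>d algebra_simps)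
      then have "real k = real l + m * n" using pi_gt_zero by simp
      then have "real_of_int (int k) = real_of_int (int l + int m * n)" by simp
      then have "int k = int l + int m * n" by (simp only: of_int_eq_iff)
      then have "int k mod int m = int l mod int m" by simp
      then show ?thesis using kl by (simp add: m_def flip: zmod_int)
    qed
  qed
qed

section \<open>Mates\<close>

locale mero_disk =
  fixes \<phi> :: "complex \<Rightarrow> complex"
  assumes mero: "\<phi> nicely_meromorphic_on UNIV"
    and no_pole: "\<And>z. norm z \<le> 1 \<Longrightarrow> \<not> is_pole \<phi> z"
    and nonconst: "\<not> \<phi> constant_on UNIV"
begin

text \<open>The points at which \<open>\<phi>\<close> and its reflection
  \<open>z \<mapsto> cnj (\<phi> (mirror z))\<close> are both analytic.\<close>
definition regular :: "complex set" where
  "regular = {z. z \<noteq> 0 \<and> \<not> is_pole \<phi> z \<and> \<not> is_pole \<phi> (mirror z)}"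

text \<open>An equivalence relation on the regular points. The second condition says that the reflection of
  \<open>\<phi>\<close> takes the same value at \<open>w\<close> and \<open>z\<close>; it makes the relation
  symmetric about the circle, and on the circle it is the same as the first one.\<close>
definition mates :: "complex \<Rightarrow> complex set" where
  "mates z = {w \<in> regular. \<phi> w = \<phi> z \<and> \<phi> (mirror w) = \<phi> (mirror z)}"

text \<open>If mates \<open>w\<close> escape to \<open>0\<close> then \<open>\<phi> w\<close> tends to
  \<open>\<phi> 0\<close>, if they escape to infinity then \<open>\<phi> (mirror w)\<close> does. The two
  inequalities prevent both; the derivative makes \<open>\<phi>\<close> a coordinate near
  \<open>z\<close>.\<close>
definition tame :: "complex set" where
  "tame = {z \<in> regular. deriv \<phi> z \<noteq> 0 \<and> \<phi> z \<noteq> \<phi> 0 \<and> \<phi> (mirror z) \<noteq> \<phi> 0}"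

text \<open>The mate \<open>w\<close> of \<open>z\<close> moves analytically with \<open>z\<close>. Isolated
  coincidences of the two defining equations do not.\<close>
definition persistent :: "complex \<Rightarrow> complex \<Rightarrow> bool" where
  "persistent z w \<longleftrightarrow> (\<exists>\<rho>. \<rho> analytic_on {z} \<and> \<rho> z = w \<and> (\<forall>\<^sub>F x in nhds z. \<rho> x \<in> mates x))"

text \<open>The points near which the mates form an unramified covering.\<close>
definition good :: "complex set" where
  "good = {z \<in> tame. \<forall>w\<in>mates z. deriv \<phi> w \<noteq> 0 \<and> persistent z w}"

lemma analytic_off_poles: "\<not> is_pole \<phi> z \<Longrightarrow> \<phi> analytic_on {z}"
  using nicely_meromorphic_on_imp_analytic_at[OF mero] by simp

lemma isCont_off_poles: "\<not> is_pole \<phi> z \<Longrightarrow> isCont \<phi> z"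
  using analytic_off_poles analytic_at_imp_isCont by blast

lemma not_pole_nhds: "\<not> is_pole \<phi> z \<Longrightarrow> \<forall>\<^sub>F x in nhds z. \<not> is_pole \<phi> x"
  using analytic_off_poles analytic_at_imp_no_pole eventually_mono
  by (smt (verit, best) analytic_at eventually_nhds holomorphic_on_imp_analytic_at)

lemma not_pole_at: "\<forall>\<^sub>F x in at z. \<not> is_pole \<phi> x"
proof -
  have "\<phi> meromorphic_on UNIV" using mero nicely_meromorphic_on_def by blast
  from meromorphic_on_imp_not_pole_cosparse[OF this] show ?thesis
    by (simp add: eventually_cosparse_open_eq)
qed

lemma avoids_value: "\<forall>\<^sub>F x in at z. \<phi> x \<noteq> c"
  using nicely_meromorphic_imp_constant_or_avoid[OF mero open_UNIV connected_UNIV, of c] nonconst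
  by (auto simp: eventually_cosparse_open_eq constant_on_def)

text \<open>Otherwise the derivative, being meromorphic on the plane, would vanish identically.\<close>
lemma deriv_nonzero_at: "\<forall>\<^sub>F x in at z. deriv \<phi> x \<noteq> 0"
proof -
  have m: "\<phi> meromorphic_on UNIV" using mero nicely_meromorphic_on_def by blast
  have "deriv \<phi> meromorphic_on UNIV"
    using m by (rule meromorphic_on_deriv)
  from meromorphic_imp_constant_or_avoid[OF this open_UNIV connected_UNIV, of 0]
  consider "\<forall>x. \<forall>\<^sub>F y in at x. deriv \<phi> y = 0" | "\<forall>x. \<forall>\<^sub>F y in at x. deriv \<phi> y \<noteq> 0"
    by (auto simp: eventually_cosparse_open_eq)
  then show ?thesis
  proof cases
    case 1
    have np: "\<not> is_pole \<phi> 0" using no_pole by simp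
    have "\<forall>\<^sub>F y in at 0. deriv \<phi> y = 0 \<and> \<not> is_pole \<phi> y"
      using 1 not_pole_at eventually_conj by blast
    then obtain r where r: "r > 0" "\<And>y. y \<in> ball 0 r \<Longrightarrow> y \<noteq> 0 \<Longrightarrow> deriv \<phi> y = 0 \<and> \<not> is_pole \<phi> y"
      unfolding eventually_at by (auto simp: dist_norm)
    have hol: "\<phi> holomorphic_on ball 0 r"
    proof -
      have "\<phi> analytic_on {y}" if "y \<in> ball 0 r" for y
        using analytic_off_poles np r(2)[OF that] by (cases "y = 0") auto
      then show ?thesis
        using analytic_imp_holomorphic analytic_on_analytic_at by blast
    qed
    have d0: "deriv \<phi> y = 0" if "y \<in> ball 0 r" for y
    proof (cases "y = 0")
      case True
      have "isCont (deriv \<phi>) 0"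
        using analytic_off_poles[OF np] analytic_deriv analytic_at_imp_isCont by blast
      then have "(deriv \<phi> \<longlongrightarrow> deriv \<phi> 0) (at 0)" by (simp add: isCont_def)
      moreover have "(deriv \<phi> \<longlongrightarrow> 0) (at 0)" using 1 by (simp add: tendsto_eventually)
      ultimately show ?thesis using True LIM_unique by blast
    qed (use r that in auto)
    have "\<exists>c. \<forall>y\<in>ball 0 r. \<phi> y = c"
    proof -
      have "(\<phi> has_field_derivative 0) (at y within ball 0 r)" if "y \<in> ball 0 r" for y
        using hol d0[OF that] holomorphic_derivI[OF hol open_ball that] that by simp
      then obtain c where "\<And>y. y \<in> ball 0 r \<Longrightarrow> \<phi> y = c"
        using has_field_derivative_zero_constant[OF convex_ball] by blast
      then show ?thesis by blast
    qed
    then obtain c where "\<forall>y\<in>ball 0 r. \<phi> y = c" by blast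
    then have "\<forall>\<^sub>F y in at 0. \<phi> y = c"
      using r(1) by (auto simp: eventually_at dist_norm intro!: exI[of _ r])
    with avoids_value[of c 0] have "\<forall>\<^sub>F y in at (0::complex). False"
      by eventually_elim auto
    then show ?thesis by simp
  qed auto
qed

lemma locally_inj: "\<not> is_pole \<phi> w \<Longrightarrow> deriv \<phi> w \<noteq> 0 \<Longrightarrow> \<exists>r>0. inj_on \<phi> (ball w r)"
  using analytic_locally_inj analytic_off_poles by blast

lemma regular_mirror: "mirror z \<in> regular \<longleftrightarrow> z \<in> regular"
  by (auto simp: regular_def)

lemma mates_mirror: "w \<in> mates (mirror z) \<longleftrightarrow> mirror w \<in> mates z"
  using regular_mirror by (auto simp: mates_def)

lemma mates_refl: "z \<in> regular \<Longrightarrow> z \<in> mates z"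
  by (simp add: mates_def)

lemma mates_eq: "w \<in> mates z \<Longrightarrow> mates w = mates z"
  by (auto simp: mates_def)

lemma mates_sym: "w \<in> mates z \<Longrightarrow> z \<in> regular \<Longrightarrow> z \<in> mates w"
  by (auto simp: mates_def)

lemma mates_regular: "w \<in> mates z \<Longrightarrow> w \<in> regular"
  by (simp add: mates_def)

lemma good_tame: "z \<in> good \<Longrightarrow> z \<in> tame" by (simp add: good_def)

lemma tame_regular: "z \<in> tame \<Longrightarrow> z \<in> regular" by (simp add: tame_def)

lemma regularD: "z \<in> regular \<Longrightarrow> z \<noteq> 0" "z \<in> regular \<Longrightarrow> \<not> is_pole \<phi> z"
  "z \<in> regular \<Longrightarrow> \<not> is_pole \<phi> (mirror z)"
  by (auto simp: regular_def)

lemma regular_nhds: "z \<in> regular \<Longrightarrow> \<forall>\<^sub>F x in nhds z. x \<in> regular"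
proof -
  assume z: "z \<in> regular"
  have "\<forall>\<^sub>F x in nhds z. x \<noteq> 0"
    using regularD(1)[OF z] by (rule t1_space_nhds)
  moreover have "\<forall>\<^sub>F x in nhds z. \<not> is_pole \<phi> x"
    using not_pole_nhds regularD z by blast
  moreover have "\<forall>\<^sub>F x in nhds z. \<not> is_pole \<phi> (mirror x)"
    using eventually_nhds_compose_cont[OF isCont_mirror not_pole_nhds] regularD z by blast
  ultimately show ?thesis
    by eventually_elim (auto simp: regular_def)
qed

lemma isCont_deriv: "\<not> is_pole \<phi> z \<Longrightarrow> isCont (deriv \<phi>) z"
  using analytic_off_poles analytic_deriv analytic_at_imp_isCont by blast

lemma isCont_mirrored: "z \<in> regular \<Longrightarrow> isCont (\<lambda>x. \<phi> (mirror x)) z"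
  using isCont_o2[OF isCont_mirror isCont_off_poles] regularD by blast

lemma tame_nhds: "z \<in> tame \<Longrightarrow> \<forall>\<^sub>F x in nhds z. x \<in> tame"
proof -
  assume z: "z \<in> tame"
  then have zr: "z \<in> regular" by (simp add: tame_def)
  have "\<forall>\<^sub>F x in nhds z. deriv \<phi> x \<noteq> 0"
    using z isCont_deriv regularD[OF zr] by (intro isCont_eventually_neq) (auto simp: tame_def)
  moreover have "\<forall>\<^sub>F x in nhds z. \<phi> x \<noteq> \<phi> 0"
    using z isCont_off_poles regularD[OF zr] by (intro isCont_eventually_neq) (auto simp: tame_def)
  moreover have "\<forall>\<^sub>F x in nhds z. \<phi> (mirror x) \<noteq> \<phi> 0"
    using z isCont_mirrored[OF zr] by (intro isCont_eventually_neq) (auto simp: tame_def)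
  ultimately show ?thesis
    using regular_nhds[OF zr] by eventually_elim (auto simp: tame_def)
qed

lemma tame_punctured_nhds: "z \<noteq> 0 \<Longrightarrow> \<forall>\<^sub>F x in at z. x \<in> tame"
proof -
  assume z: "z \<noteq> 0"
  have m: "\<forall>\<^sub>F x in at z. P (mirror x)" if "\<forall>\<^sub>F x in at (mirror z). P x" for P
    using filterlim_mirror_at[OF z] that by (simp add: filterlim_iff)
  have nz: "\<forall>\<^sub>F x in at z. x \<noteq> 0"
    using t1_space_nhds[OF z] by (simp add: eventually_at_filter eventually_mono)
  show ?thesis
    using nz not_pole_at[of z] m[OF not_pole_at] deriv_nonzero_at[of z] avoids_value[of "\<phi> 0" z]
      m[OF avoids_value[of "\<phi> 0" "mirror z"]]
    by eventually_elim (auto simp: tame_def regular_def)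
qed

text \<open>A pole cannot be the limit of points with bounded values. This is how equations between values pass
  to limits, without prior knowledge that the limit is regular.\<close>
lemma value_limit:
  assumes X: "X \<longlonglongrightarrow> z" and Y: "Y \<longlonglongrightarrow> w" and z: "\<not> is_pole \<phi> z"
    and ev: "\<forall>\<^sub>F n in sequentially. \<phi> (Y n) = \<phi> (X n) \<and> \<not> is_pole \<phi> (Y n)"
  shows "\<not> is_pole \<phi> w" "\<phi> w = \<phi> z"
proof -
  have lim: "(\<lambda>n. \<phi> (X n)) \<longlonglongrightarrow> \<phi> z"
    using isCont_tendsto_compose[OF isCont_off_poles[OF z] X] .
  then have lim': "(\<lambda>n. \<phi> (Y n)) \<longlonglongrightarrow> \<phi> z"
    by (rule Lim_transform_eventually) (use ev in \<open>auto elim: eventually_mono\<close>)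
  show w: "\<not> is_pole \<phi> w"
  proof
    assume p: "is_pole \<phi> w"
    have "filterlim Y (at w) sequentially"
      unfolding filterlim_at using Y ev p by (auto elim: eventually_mono)
    with p have "filterlim (\<lambda>n. \<phi> (Y n)) at_infinity sequentially"
      unfolding is_pole_def by (rule filterlim_compose)
    with lim' show False
      using not_tendsto_and_filterlim_at_infinity[OF sequentially_bot] by blast
  qed
  have "(\<lambda>n. \<phi> (Y n)) \<longlonglongrightarrow> \<phi> w"
    using isCont_tendsto_compose[OF isCont_off_poles[OF w] Y] .
  then show "\<phi> w = \<phi> z" using lim' LIMSEQ_unique by blast
qed

lemma mates_limit:
  assumes X: "X \<longlonglongrightarrow> z" and z: "z \<in> regular" and Y: "Y \<longlonglongrightarrow> w" and w: "w \<noteq> 0"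
    and m: "\<And>n. Y n \<in> mates (X n)"
  shows "w \<in> mates z"
proof -
  note z' = regularD[OF z]
  have 1: "\<not> is_pole \<phi> w" "\<phi> w = \<phi> z"
    using value_limit[OF X Y z'(2)] m by (auto simp: mates_def regular_def)
  have "(\<lambda>n. mirror (X n)) \<longlonglongrightarrow> mirror z" "(\<lambda>n. mirror (Y n)) \<longlonglongrightarrow> mirror w"
    using tendsto_mirror X Y z' w by auto
  from value_limit[OF this z'(3)] have "\<not> is_pole \<phi> (mirror w)" "\<phi> (mirror w) = \<phi> (mirror z)"
    using m by (auto simp: mates_def regular_def)
  with 1 w show ?thesis by (auto simp: mates_def regular_def)
qed

lemma avoid_zero_value_gap:
  assumes "c \<noteq> \<phi> 0"
  obtains e where "e > 0" "\<forall>\<^sub>F y in nhds c. \<forall>w. \<phi> w = y \<longrightarrow> e \<le> norm w"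
proof -
  define d where "d = dist c (\<phi> 0) / 2"
  have d: "d > 0" using assms by (simp add: d_def)
  have "isCont \<phi> 0" using isCont_off_poles[of 0] no_pole[of 0] by simp
  then obtain e where e: "e > 0" "\<And>w. norm w < e \<Longrightarrow> dist (\<phi> w) (\<phi> 0) < d"
    using d unfolding continuous_at_eps_delta by (metis dist_0_norm dist_commute)
  have "\<forall>\<^sub>F y in nhds c. dist y c < d"
    unfolding eventually_nhds_metric using d by blast
  then have "\<forall>\<^sub>F y in nhds c. \<forall>w. \<phi> w = y \<longrightarrow> e \<le> norm w"
  proof eventually_elim
    case (elim y)
    show ?case
    proof safe
      fix w assume "y = \<phi> w"
      show "e \<le> norm w"
      proof (rule ccontr)
        assume "\<not> e \<le> norm w"
        then have "dist y (\<phi> 0) < d" using e \<open>y = \<phi> w\<close> by auto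
        with elim have "dist c (\<phi> 0) < d + d"
          using dist_triangle3[of c "\<phi> 0" y] by (simp add: dist_commute)
        then show False by (simp add: d_def)
      qed
    qed
  qed
  with e show ?thesis using that by blast
qed

text \<open>This is what finiteness of \<open>\<phi>\<close> at \<open>0\<close> gives: points near
  \<open>0\<close> have values near \<open>\<phi> 0\<close>, which tame points and their mirror images
  avoid.\<close>
lemma mates_annulus:
  assumes z: "z \<in> tame"
  obtains e where "e > 0" "\<forall>\<^sub>F x in nhds z. \<forall>w\<in>mates x. e \<le> norm w \<and> norm w \<le> 1 / e"
proof -
  have z': "z \<in> regular" "\<phi> z \<noteq> \<phi> 0" "\<phi> (mirror z) \<noteq> \<phi> 0" using z by (auto simp: tame_def)
  obtain e1 where e1: "e1 > 0" "\<forall>\<^sub>F y in nhds (\<phi> z). \<forall>w. \<phi> w = y \<longrightarrow> e1 \<le> norm w"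
    using avoid_zero_value_gap[OF z'(2)] by blast
  obtain e2 where e2: "e2 > 0" "\<forall>\<^sub>F y in nhds (\<phi> (mirror z)). \<forall>w. \<phi> w = y \<longrightarrow> e2 \<le> norm w"
    using avoid_zero_value_gap[OF z'(3)] by blast
  have ev1: "\<forall>\<^sub>F x in nhds z. \<forall>w. \<phi> w = \<phi> x \<longrightarrow> e1 \<le> norm w"
    using eventually_nhds_compose_cont[OF isCont_off_poles e1(2)] regularD z'(1) by blast
  have ev2: "\<forall>\<^sub>F x in nhds z. \<forall>w. \<phi> w = \<phi> (mirror x) \<longrightarrow> e2 \<le> norm w"
    using eventually_nhds_compose_cont[OF isCont_mirrored[OF z'(1)] e2(2)] by blast
  show ?thesis
  proof
    show "min e1 e2 > 0" using e1 e2 by simp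
    show "\<forall>\<^sub>F x in nhds z. \<forall>w\<in>mates x. min e1 e2 \<le> norm w \<and> norm w \<le> 1 / min e1 e2"
      using ev1 ev2
    proof eventually_elim
      case (elim x)
      show ?case
      proof (intro ballI conjI)
        fix w assume w: "w \<in> mates x"
        then have wn: "norm w > 0" by (auto simp: mates_def regular_def)
        show "min e1 e2 \<le> norm w" using elim(1) w by (force simp: mates_def)
        have "e2 \<le> norm (mirror w)" using elim(2) w by (auto simp: mates_def)
        then have "min e1 e2 \<le> 1 / norm w" by (simp add: norm_mirror)
        then have "min e1 e2 * norm w \<le> 1" using wn by (simp add: field_simps)
        then show "norm w \<le> 1 / min e1 e2" using e1 e2 by (simp add: field_simps)
      qed
    qed
  qed
qed

lemma mates_compactness:
  assumes z: "z \<in> tame" and X: "X \<longlonglongrightarrow> z" and Y: "\<And>n::nat. Y n \<in> mates (X n)"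
  obtains s w where "strict_mono s" "(Y \<circ> s) \<longlonglongrightarrow> w" "w \<in> mates z"
proof -
  obtain e where e: "e > 0" "\<forall>\<^sub>F x in nhds z. \<forall>w\<in>mates x. e \<le> norm w \<and> norm w \<le> 1 / e"
    by (rule mates_annulus[OF z])
  from tendsto_eventually_compose[OF X e(2)]
  have "\<forall>\<^sub>F n in sequentially. e \<le> norm (Y n) \<and> norm (Y n) \<le> 1 / e"
    by eventually_elim (use Y in blast)
  then obtain N where N: "\<And>n. n \<ge> N \<Longrightarrow> e \<le> norm (Y n) \<and> norm (Y n) \<le> 1 / e"
    by (auto simp: eventually_sequentially)
  have C: "compact (cball 0 (1/e) - ball 0 e :: complex set)"
    by (intro compact_diff) auto
  have D: "\<And>n. Y (n + N) \<in> cball 0 (1/e) - ball 0 e"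
    using N by (auto simp: not_less)
  obtain w s where s: "w \<in> cball 0 (1/e) - ball 0 e" "strict_mono s"
    "((\<lambda>n. Y (n + N)) \<circ> s) \<longlonglongrightarrow> w"
    by (rule seq_compactE[OF compact_imp_seq_compact[OF C], of "\<lambda>n. Y (n + N)"]) (use D in auto)
  define t where "t = (\<lambda>n. s n + N)"
  have t: "strict_mono t" using s(2) by (auto simp: t_def strict_mono_def)
  have "Y \<circ> t = (\<lambda>n. Y (n + N)) \<circ> s" by (simp add: t_def fun_eq_iff)
  then have Yt: "(Y \<circ> t) \<longlonglongrightarrow> w" using s(3) by simp
  moreover have "w \<noteq> 0" using s(1) e(1) by auto
  moreover have "(X \<circ> t) \<longlonglongrightarrow> z" using X t by (rule LIMSEQ_subseq_LIMSEQ)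
  ultimately have "w \<in> mates z"
    using mates_limit[of "X \<circ> t" z "Y \<circ> t" w] Y tame_regular[OF z] Yt by simp
  with t Yt show ?thesis using that by blast
qed

text \<open>An accumulation point of mates would make \<open>\<phi>\<close> constant.\<close>
lemma finite_mates:
  assumes z: "z \<in> tame"
  shows "finite (mates z)"
proof (rule ccontr)
  assume inf: "infinite (mates z)"
  obtain Y :: "nat \<Rightarrow> complex" where Y: "inj Y" "range Y \<subseteq> mates z"
    using infinite_countable_subset[OF inf] by auto
  have Ym: "Y n \<in> mates z" for n using Y(2) by auto
  obtain s w where s: "strict_mono s" "(Y \<circ> s) \<longlonglongrightarrow> w" "w \<in> mates z"
    by (rule mates_compactness[OF z tendsto_const Ym])
  have inj: "inj (Y \<circ> s)" by (rule inj_compose[OF Y(1) strict_mono_imp_inj_on[OF s(1)]])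
  have nw: "\<forall>\<^sub>F n in sequentially. (Y \<circ> s) n \<noteq> w"
  proof (cases "\<exists>k. (Y \<circ> s) k = w")
    case True
    then obtain k where k: "(Y \<circ> s) k = w" by blast
    show ?thesis
      using eventually_gt_at_top[of k]
    proof eventually_elim
      case (elim n)
      then show ?case using injD[OF inj, of n k] k by auto
    qed
  qed simp
  have "filterlim (Y \<circ> s) (at w) sequentially"
    unfolding filterlim_at using s(2) nw by simp
  then have "\<forall>\<^sub>F n in sequentially. \<phi> ((Y \<circ> s) n) \<noteq> \<phi> z"
    using avoids_value[of "\<phi> z" w] unfolding filterlim_iff by blast
  moreover have "\<phi> ((Y \<circ> s) n) = \<phi> z" for n using Ym by (simp add: mates_def)
  ultimately show False by simp
qed

section \<open>The covering formed by the mates\<close>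

text \<open>A sheet is named after the mate of \<open>z\<close> through which it passes.\<close>
definition sheets :: "complex \<Rightarrow> (complex \<Rightarrow> complex \<Rightarrow> complex) \<Rightarrow> bool" where
  "sheets z \<rho> \<longleftrightarrow>
     (\<forall>w\<in>mates z. \<rho> w analytic_on {z} \<and> \<rho> w z = w \<and> (\<forall>\<^sub>F x in nhds z. \<rho> w x \<in> mates x)) \<and>
     (\<forall>\<^sub>F x in nhds z. mates x = (\<lambda>w. \<rho> w x) ` mates z \<and> inj_on (\<lambda>w. \<rho> w x) (mates z))"

lemma sheetsD:
  assumes "sheets z \<rho>"
  shows "w \<in> mates z \<Longrightarrow> \<rho> w analytic_on {z}" "w \<in> mates z \<Longrightarrow> \<rho> w z = w"
    "w \<in> mates z \<Longrightarrow> \<forall>\<^sub>F x in nhds z. \<rho> w x \<in> mates x"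
    "\<forall>\<^sub>F x in nhds z. mates x = (\<lambda>w. \<rho> w x) ` mates z"
    "\<forall>\<^sub>F x in nhds z. inj_on (\<lambda>w. \<rho> w x) (mates z)"
  using assms by (simp_all add: sheets_def eventually_conj_iff)

text \<open>Each mate contributes its sheet. There are no further mates nearby: by compactness a further one
  would converge to a mate \<open>w\<close> of \<open>z\<close>, near which \<open>\<phi>\<close> is injective,
  and so coincide with the sheet through \<open>w\<close>.\<close>
lemma sheets_exist:
  assumes z: "z \<in> good"
  shows "\<exists>\<rho>. sheets z \<rho>"
proof -
  have "\<forall>w\<in>mates z. \<exists>\<rho>. \<rho> analytic_on {z} \<and> \<rho> z = w \<and> (\<forall>\<^sub>F x in nhds z. \<rho> x \<in> mates x)"
    using z by (simp add: good_def persistent_def)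
  then obtain \<rho> where \<rho>: "\<And>w. w \<in> mates z \<Longrightarrow> \<rho> w analytic_on {z}"
    "\<And>w. w \<in> mates z \<Longrightarrow> \<rho> w z = w"
    "\<And>w. w \<in> mates z \<Longrightarrow> \<forall>\<^sub>F x in nhds z. \<rho> w x \<in> mates x"
    by metis
  have fin: "finite (mates z)" using finite_mates good_tame z by blast
  have cont: "isCont (\<rho> w) z" if "w \<in> mates z" for w
    using \<rho>(1)[OF that] analytic_at_imp_isCont by blast
  have sub: "\<forall>\<^sub>F x in nhds z. \<forall>w\<in>mates z. \<rho> w x \<in> mates x"
    using fin \<rho>(3) by (simp add: eventually_ball_finite_distrib)
  have inj: "\<forall>\<^sub>F x in nhds z. inj_on (\<lambda>w. \<rho> w x) (mates z)"
  proof -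
    have "\<forall>\<^sub>F x in nhds z. \<rho> w x \<noteq> \<rho> w' x" if "w \<in> mates z" "w' \<in> mates z" "w \<noteq> w'" for w w'
    proof -
      have "isCont (\<lambda>x. \<rho> w x - \<rho> w' x) z"
        using cont that by (intro continuous_intros) auto
      then have "\<forall>\<^sub>F x in nhds z. \<rho> w x - \<rho> w' x \<noteq> 0"
        by (rule isCont_eventually_neq) (use \<rho>(2) that in simp)
      then show ?thesis by simp
    qed
    then have "\<forall>\<^sub>F x in nhds z. \<forall>w\<in>mates z. \<forall>w'\<in>mates z. w \<noteq> w' \<longrightarrow> \<rho> w x \<noteq> \<rho> w' x"
      using fin by (simp add: eventually_ball_finite_distrib)
    then show ?thesis by eventually_elim (auto simp: inj_on_def)
  qed
  have sup: "\<forall>\<^sub>F x in nhds z. mates x \<subseteq> (\<lambda>w. \<rho> w x) ` mates z"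
  proof (rule ccontr)
    assume "\<not> ?thesis"
    then obtain X where X: "X \<longlonglongrightarrow> z" "\<And>n. \<not> mates (X n) \<subseteq> (\<lambda>w. \<rho> w (X n)) ` mates z"
      using not_eventually_nhds_imp_seq[of "\<lambda>x. mates x \<subseteq> (\<lambda>w. \<rho> w x) ` mates z" z] by blast
    then have "\<forall>n. \<exists>y. y \<in> mates (X n) \<and> y \<notin> (\<lambda>w. \<rho> w (X n)) ` mates z" by blast
    then obtain Y where Y: "\<And>n. Y n \<in> mates (X n)" "\<And>n. Y n \<notin> (\<lambda>w. \<rho> w (X n)) ` mates z"
      by metis
    obtain s w where s: "strict_mono s" "(Y \<circ> s) \<longlonglongrightarrow> w" "w \<in> mates z"
      by (rule mates_compactness[OF good_tame[OF z] X(1) Y(1)])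
    have Xs: "(X \<circ> s) \<longlonglongrightarrow> z" using X(1) s(1) by (rule LIMSEQ_subseq_LIMSEQ)
    have "deriv \<phi> w \<noteq> 0" using z s(3) by (simp add: good_def)
    then obtain r where r: "r > 0" "inj_on \<phi> (ball w r)"
      using locally_inj regularD(2)[OF mates_regular[OF s(3)]] by blast
    have 1: "\<forall>\<^sub>F n in sequentially. (Y \<circ> s) n \<in> ball w r"
      using s(2) r(1) by (metis centre_in_ball open_ball topological_tendstoD)
    have "(\<lambda>n. \<rho> w ((X \<circ> s) n)) \<longlonglongrightarrow> \<rho> w z"
      using isCont_tendsto_compose[OF cont[OF s(3)] Xs] .
    then have 2: "\<forall>\<^sub>F n in sequentially. \<rho> w ((X \<circ> s) n) \<in> ball w r"
      using r(1) \<rho>(2)[OF s(3)] by (metis centre_in_ball open_ball topological_tendstoD)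
    have 3: "\<forall>\<^sub>F n in sequentially. \<rho> w ((X \<circ> s) n) \<in> mates ((X \<circ> s) n)"
      using tendsto_eventually_compose[OF Xs \<rho>(3)[OF s(3)]] .
    from 1 2 3 have "\<forall>\<^sub>F n::nat in sequentially. False"
    proof eventually_elim
      case (elim n)
      have "\<phi> (\<rho> w ((X \<circ> s) n)) = \<phi> ((Y \<circ> s) n)"
        using elim(3) Y(1)[of "s n"] by (simp add: mates_def)
      with elim(1,2) have "\<rho> w ((X \<circ> s) n) = (Y \<circ> s) n"
        using r(2) by (auto dest: inj_onD)
      then show ?case using Y(2)[of "s n"] s(3) by (auto simp: image_iff)
    qed
    then show False by simp
  qed
  have "\<forall>\<^sub>F x in nhds z. mates x = (\<lambda>w. \<rho> w x) ` mates z"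
    using sub sup by eventually_elim auto
  with \<rho> inj have "sheets z \<rho>" by (simp add: sheets_def eventually_conj_iff)
  then show ?thesis by blast
qed

lemma good_nhds:
  assumes z: "z \<in> good"
  shows "\<forall>\<^sub>F x in nhds z. x \<in> good"
proof -
  obtain \<rho> where "sheets z \<rho>" using sheets_exist[OF z] by blast
  note \<rho> = sheetsD[OF this]
  have fin: "finite (mates z)" using finite_mates good_tame z by blast
  have an: "\<forall>\<^sub>F x in nhds z. \<rho> w analytic_on {x}" if "w \<in> mates z" for w
    using \<rho>(1)[OF that] by (smt (verit, best) analytic_at eventually_nhds holomorphic_on_imp_analytic_at)
  have der: "\<forall>\<^sub>F x in nhds z. deriv \<phi> (\<rho> w x) \<noteq> 0" if w: "w \<in> mates z" for w
  proof -
    have "isCont (deriv \<phi>) w"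
      using isCont_deriv regularD(2)[OF mates_regular[OF w]] by blast
    moreover have "isCont (\<rho> w) z" using \<rho>(1)[OF w] analytic_at_imp_isCont by blast
    ultimately have "isCont (\<lambda>x. deriv \<phi> (\<rho> w x)) z"
      using isCont_o2[of z "\<rho> w" "deriv \<phi>"] \<rho>(2)[OF w] by simp
    then show ?thesis
      by (rule isCont_eventually_neq) (use z w \<rho>(2) in \<open>simp add: good_def\<close>)
  qed
  have ev: "\<forall>\<^sub>F x in nhds z. \<forall>w\<in>mates z. deriv \<phi> (\<rho> w x) \<noteq> 0 \<and> \<rho> w analytic_on {x}
      \<and> (\<forall>\<^sub>F y in nhds x. \<rho> w y \<in> mates y)"
    using fin an der \<rho>(3)
    by (simp add: eventually_ball_finite_distrib eventually_conj_iff eventually_eventually)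
  show ?thesis
    using tame_nhds[OF good_tame[OF z]] \<rho>(4) ev
    by eventually_elim (auto simp: good_def persistent_def)
qed

lemma open_good: "open good"
  by (subst open_subopen) (use good_nhds in \<open>fastforce simp: eventually_nhds\<close>)

text \<open>Suppose bad points \<open>x n\<close> converge to \<open>z\<close>, with offending mates
  \<open>y n\<close> converging to a mate \<open>w\<close>. Near \<open>(z, w)\<close> the first equation is a
  graph \<open>x = Z u\<close>, and the second one holds at infinitely many points of it, hence on all of it. So
  all points of the graph other than \<open>(z, w)\<close> belong to a sheet, and \<open>y n\<close> was not
  offending.\<close>
lemma good_punctured_nhds:
  assumes z: "z \<in> tame"
  shows "\<forall>\<^sub>F x in at z. x \<in> good"
proof (rule ccontr)
  assume "\<not> ?thesis"
  then obtain X0 where X0: "X0 \<longlonglongrightarrow> z" "\<And>n. X0 n \<noteq> z" "\<And>n. X0 n \<notin> good"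
    using not_eventually_at_imp_seq[of "\<lambda>x. x \<in> good" z] by blast
  obtain N where N: "\<And>n. n \<ge> N \<Longrightarrow> X0 n \<in> tame"
    using tendsto_eventually_compose[OF X0(1) tame_nhds[OF z]] unfolding eventually_sequentially by blast
  define X where "X n = X0 (n + N)" for n
  have X: "X \<longlonglongrightarrow> z" "\<And>n. X n \<noteq> z" "\<And>n. X n \<notin> good" "\<And>n. X n \<in> tame"
    unfolding X_def using X0 N LIMSEQ_ignore_initial_segment[OF X0(1), of N] by auto
  have "\<forall>n. \<exists>y. y \<in> mates (X n) \<and> \<not> (deriv \<phi> y \<noteq> 0 \<and> persistent (X n) y)"
    using X(3,4) unfolding good_def by blast
  then obtain Y where Y: "\<And>n. Y n \<in> mates (X n)" "\<And>n. \<not> (deriv \<phi> (Y n) \<noteq> 0 \<and> persistent (X n) (Y n))"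
    by metis
  obtain s w where s: "strict_mono s" "(Y \<circ> s) \<longlonglongrightarrow> w" "w \<in> mates z"
    by (rule mates_compactness[OF z X(1) Y(1)])
  define x y where "x = X \<circ> s" and "y = Y \<circ> s"
  have x: "x \<longlonglongrightarrow> z" "\<And>n. x n \<noteq> z" "\<And>n. x n \<in> tame"
    using LIMSEQ_subseq_LIMSEQ[OF X(1) s(1)] X by (auto simp: x_def)
  have y: "y \<longlonglongrightarrow> w" "\<And>n. y n \<in> mates (x n)"
    "\<And>n. \<not> (deriv \<phi> (y n) \<noteq> 0 \<and> persistent (x n) (y n))"
    using s(2) Y by (auto simp: x_def y_def)
  have zr: "z \<in> regular" and dz: "deriv \<phi> z \<noteq> 0" using z by (auto simp: tame_def)
  have wr: "w \<in> regular" and \<phi>w: "\<phi> w = \<phi> z" using s(3) by (auto simp: mates_def)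
  obtain g where g: "g analytic_on {\<phi> z}" "g (\<phi> z) = z"
    "\<forall>\<^sub>F u in nhds z. g (\<phi> u) = u" "\<forall>\<^sub>F v in nhds (\<phi> z). \<phi> (g v) = v"
    by (rule analytic_local_inverse[OF analytic_off_poles[OF regularD(2)[OF zr]] dz])
  \<comment> \<open>Near \<open>(z, w)\<close> the relation \<open>\<phi> x = \<phi> u\<close> is the graph
    \<open>x = Z u\<close>, because \<open>\<phi>\<close> is injective near \<open>z\<close>.\<close>
  define Z where "Z u = g (\<phi> u)" for u
  have Zan: "Z analytic_on {w}"
    unfolding Z_def using analytic_on_compose[OF analytic_off_poles[OF regularD(2)[OF wr]], of g] g(1) \<phi>w
    by (simp add: o_def)
  have Zw: "Z w = z" by (simp add: Z_def \<phi>w g(2))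
  have \<phi>cont: "isCont \<phi> w" using isCont_off_poles regularD(2)[OF wr] by blast
  have \<phi>Z: "\<forall>\<^sub>F u in nhds w. \<phi> (Z u) = \<phi> u"
    unfolding Z_def using eventually_nhds_compose_cont[OF \<phi>cont, of "\<lambda>v. \<phi> (g v) = v"] g(4) \<phi>w by simp
  have xZ: "\<forall>\<^sub>F n in sequentially. x n = Z (y n)"
    using tendsto_eventually_compose[OF x(1) g(3)]
  proof eventually_elim
    case (elim n)
    then show ?case using y(2)[of n] by (simp add: Z_def mates_def)
  qed
  have Zcont: "isCont Z w" using Zan analytic_at_imp_isCont by blast
  have yw: "\<forall>\<^sub>F n in sequentially. y n \<noteq> w"
    using xZ
  proof eventually_elim
    case (elim n)
    then show ?case using x(2)[of n] Zw by auto
  qed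
  then obtain M where M: "\<And>n. n \<ge> M \<Longrightarrow> y n \<noteq> w" unfolding eventually_sequentially by blast
  \<comment> \<open>The second relation on that graph is the zero set of one analytic function \<open>h\<close>;
    the conjugates make it analytic.\<close>
  define h where "h u = cnj (\<phi> (mirror (Z u))) - cnj (\<phi> (mirror u))" for u
  have han: "h analytic_on {w}"
  proof -
    have 1: "(\<lambda>u. cnj (\<phi> (mirror u))) analytic_on {w}" "(\<lambda>u. cnj (\<phi> (mirror u))) analytic_on {Z w}"
      using analytic_cnj_comp_mirror[OF analytic_off_poles] regularD wr zr Zw by auto
    have "((\<lambda>u. cnj (\<phi> (mirror u))) \<circ> Z) analytic_on {w}"
      using analytic_on_compose[OF Zan, of "\<lambda>u. cnj (\<phi> (mirror u))"] 1(2) by simp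
    with 1(1) show ?thesis
      unfolding h_def o_def by (intro analytic_intros)
  qed
  have h0: "\<forall>\<^sub>F u in nhds w. h u = 0"
  proof (rule analytic_eventually_zero_of_seq[OF han])
    show "(\<lambda>n. y (n + M)) \<longlonglongrightarrow> w" using y(1) by (rule LIMSEQ_ignore_initial_segment)
    show "y (n + M) \<noteq> w" for n using M by simp
    have "\<forall>\<^sub>F n in sequentially. h (y n) = 0"
      using xZ
    proof eventually_elim
      case (elim n)
      have "\<phi> (mirror (y n)) = \<phi> (mirror (x n))" using y(2)[of n] by (simp add: mates_def)
      then show ?case by (simp add: h_def flip: elim)
    qed
    then show "\<forall>\<^sub>F n in sequentially. h (y (n + M)) = 0"
      using eventually_sequentially_seg[of "\<lambda>n. h (y n) = 0" M] by simp
  qed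
  have Zreg: "\<forall>\<^sub>F u in nhds w. Z u \<in> regular"
    using eventually_nhds_compose_cont[OF Zcont, of "\<lambda>u. u \<in> regular"] regular_nhds[OF zr] Zw by simp
  have core: "\<forall>\<^sub>F u in nhds w. u \<in> mates (Z u)"
    using \<phi>Z h0 regular_nhds[OF wr] by eventually_elim (auto simp: mates_def h_def)
  have nz: "\<forall>\<^sub>F u in nhds w. u \<noteq> w \<longrightarrow> deriv \<phi> u \<noteq> 0"
    using deriv_nonzero_at[of w] by (simp add: eventually_at_filter)
  have nb: "\<forall>\<^sub>F u in nhds w. (\<forall>\<^sub>F v in nhds u. v \<in> mates (Z v)) \<and> (\<forall>\<^sub>F v in nhds u. \<phi> (Z v) = \<phi> v)
     \<and> Z analytic_on {u} \<and> (u \<noteq> w \<longrightarrow> deriv \<phi> u \<noteq> 0) \<and> Z u \<in> regular \<and> u \<in> regular"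
  proof (intro eventually_conj)
    show "\<forall>\<^sub>F u in nhds w. Z analytic_on {u}"
      using Zan by (smt (verit, best) analytic_at eventually_nhds holomorphic_on_imp_analytic_at)
  qed (use core \<phi>Z nz Zreg regular_nhds[OF wr] in \<open>simp_all add: eventually_eventually\<close>)
  have "\<forall>\<^sub>F n in sequentially. False"
    using tendsto_eventually_compose[OF y(1) nb] yw xZ
  proof eventually_elim
    case (elim n)
    define u where "u = y n"
    have u: "\<forall>\<^sub>F v in nhds u. v \<in> mates (Z v)" "\<forall>\<^sub>F v in nhds u. \<phi> (Z v) = \<phi> v"
      "Z analytic_on {u}" "deriv \<phi> u \<noteq> 0" "Z u = x n" "Z u \<in> regular" "u \<in> regular"
      using elim by (auto simp: u_def)
    have dZ: "deriv Z u \<noteq> 0"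
    proof
      assume "deriv Z u = 0"
      then have "(Z has_field_derivative 0) (at u)"
        using u(3) by (metis analytic_on_imp_differentiable_at DERIV_deriv_iff_field_differentiable singletonI)
      moreover have "(\<phi> has_field_derivative deriv \<phi> (Z u)) (at (Z u))"
        using analytic_off_poles[OF regularD(2)[OF u(6)]] by (metis analytic_on_imp_differentiable_at DERIV_deriv_iff_field_differentiable singletonI)
      ultimately have "((\<phi> \<circ> Z) has_field_derivative deriv \<phi> (Z u) * 0) (at u)"
        using DERIV_chain by blast
      then have "deriv (\<lambda>v. \<phi> (Z v)) u = 0" by (simp add: o_def DERIV_imp_deriv)
      moreover have "deriv (\<lambda>v. \<phi> (Z v)) u = deriv \<phi> u"
        using u(2) by (rule deriv_cong_ev) simp
      ultimately show False using u(4) by simp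
    qed
    \<comment> \<open>The sheet through \<open>(x n, y n)\<close> is the local inverse of
      \<open>Z\<close>.\<close>
    obtain \<rho> where \<rho>: "\<rho> analytic_on {Z u}" "\<rho> (Z u) = u"
      "\<forall>\<^sub>F v in nhds u. \<rho> (Z v) = v" "\<forall>\<^sub>F v in nhds (Z u). Z (\<rho> v) = v"
      by (rule analytic_local_inverse[OF u(3) dZ])
    have "\<forall>\<^sub>F v in nhds (Z u). \<rho> v \<in> mates (Z (\<rho> v))"
      using eventually_nhds_compose_cont[OF analytic_at_imp_isCont[OF \<rho>(1)], of "\<lambda>v. v \<in> mates (Z v)"] u(1) \<rho>(2)
      by simp
    with \<rho>(4) have "\<forall>\<^sub>F v in nhds (Z u). \<rho> v \<in> mates v"
      by eventually_elim simp
    then have "persistent (x n) (y n)"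
      unfolding persistent_def using \<rho>(1,2) u(5) by (auto simp: u_def)
    then show ?case using y(3)[of n] u(4) by (simp add: u_def)
  qed
  then show False by simp
qed

lemma open_tame: "open tame"
  by (subst open_subopen) (use tame_nhds in \<open>fastforce simp: eventually_nhds\<close>)

lemma countable_not_good: "countable (- good)"
proof -
  have 1: "(- {0} - tame) sparse_in - {0}" 
    by (subst sparse_in_eventually_iff) (auto intro: eventually_mono[OF tame_punctured_nhds])
  have "countable (- {0} \<inter> (- {0} - tame))"
    by (rule sparse_imp_countable[OF _ 1]) auto
  moreover have 2: "(tame - good) sparse_in tame" 
    by (subst sparse_in_eventually_iff[OF open_tame]) (auto intro: eventually_mono[OF good_punctured_nhds])
  have "countable (tame \<inter> (tame - good))"
    by (rule sparse_imp_countable[OF open_tame 2])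
  ultimately have "countable (insert 0 ((- {0} \<inter> (- {0} - tame)) \<union> (tame \<inter> (tame - good))))"
    by simp
  then show ?thesis
    by (rule countable_subset[rotated]) auto
qed

lemma frequently_good: "\<exists>\<^sub>F x in nhds z. x \<in> good"
  unfolding frequently_def
proof
  assume "\<forall>\<^sub>F x in nhds z. x \<notin> good"
  then obtain T where T: "open T" "z \<in> T" "\<And>x. x \<in> T \<Longrightarrow> x \<notin> good"
    unfolding eventually_nhds by blast
  obtain e where e: "e > 0" "ball z e \<subseteq> T" using T(1,2) openE by blast
  then have "ball z e \<subseteq> - good" using T(3) by blast
  then have "countable (ball z e)" using countable_not_good countable_subset by blast
  then show False using e(1) uncountable_ball by blast
qed

text \<open>The complement of a countable set in the plane is connected.\<close>
lemma card_mates_constant: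
  assumes "a \<in> good" "b \<in> good"
  shows "card (mates a) = card (mates b)"
proof -
  have "connected (- (- good))"
    by (rule path_connected_imp_connected, rule path_connected_complement_countable)
       (auto simp: countable_not_good)
  then have con: "connected good" by simp
  have "(\<lambda>z. card (mates z)) constant_on good"
  proof (rule locally_constant_imp_constant[OF con])
    fix z assume z: "z \<in> good"
    obtain \<rho> where "sheets z \<rho>" using sheets_exist[OF z] by blast
    note \<rho> = sheetsD[OF this]
    from \<rho>(4,5) have "\<forall>\<^sub>F x in nhds z. card (mates x) = card (mates z)"
      by eventually_elim (simp add: card_image)
    then obtain T where T: "open T" "z \<in> T" "\<And>x. x \<in> T \<Longrightarrow> card (mates x) = card (mates z)"
      unfolding eventually_nhds by blast
    show "\<exists>T. openin (top_of_set good) T \<and> z \<in> T \<and> (\<forall>x\<in>T. card (mates x) = card (mates z))"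
    proof (intro exI[of _ "good \<inter> T"] conjI ballI)
      show "openin (top_of_set good) (good \<inter> T)" using T(1) by (simp add: openin_open_Int)
      show "z \<in> good \<inter> T" using T(2) z by simp
      show "card (mates x) = card (mates z)" if "x \<in> good \<inter> T" for x
        using T(3)[of x] that by blast
    qed
  qed
  with assms show ?thesis by (auto simp: constant_on_def)
qed

section \<open>A base point whose mates lie in the disk\<close>

lemma on_circle_regular: "norm w = 1 \<Longrightarrow> w \<in> regular"
  using no_pole by (auto simp: regular_def mirror_on_circle)

lemma analytic_on_closed_disk: "\<phi> analytic_on cball 0 1"
  using analytic_off_poles no_pole by (subst analytic_on_analytic_at) auto

lemma holomorphic_on_disk: "\<phi> holomorphic_on ball 0 1"
  using analytic_on_closed_disk analytic_imp_holomorphic holomorphic_on_subset ball_subset_cball by blast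

lemma continuous_on_closed_disk: "continuous_on (cball 0 1) \<phi>"
  using analytic_on_closed_disk analytic_imp_holomorphic holomorphic_on_imp_continuous_on by blast

lemma holomorphic_radius:
  obtains R where "R > 1" "\<phi> holomorphic_on ball 0 R"
proof -
  obtain T where T: "open T" "cball 0 1 \<subseteq> T" "\<phi> holomorphic_on T"
    using analytic_on_closed_disk analytic_on_holomorphic by blast
  obtain R where "R > 1" "ball 0 R \<subseteq> T" by (rule cball_nbhd_radius[OF T(1,2)])
  with T(3) show ?thesis using that holomorphic_on_subset by blast
qed

lemma open_image_ball: "open (\<phi> ` ball 0 1)"
proof (rule open_mapping_thm[OF holomorphic_on_disk open_ball connected_ball open_ball order_refl])
  show "\<not> \<phi> constant_on ball 0 1"
  proof
    assume "\<phi> constant_on ball 0 1"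
    then obtain c where c: "\<And>z. z \<in> ball 0 1 \<Longrightarrow> \<phi> z = c" by (auto simp: constant_on_def)
    have "\<forall>\<^sub>F z in at (0::complex). z \<in> ball 0 1"
      unfolding eventually_at by (auto intro!: exI[of _ 1])
    with avoids_value[of c 0] have "\<forall>\<^sub>F z in at (0::complex). False"
      by eventually_elim (use c in blast)
    then show False by simp
  qed
qed

text \<open>Open mapping theorem.\<close>
lemma frontier_value_not_inside:
  assumes "\<phi> \<eta> \<in> frontier (\<phi> ` cball 0 1)" "\<phi> w = \<phi> \<eta>"
  shows "\<not> norm w < 1"
proof
  assume "norm w < 1"
  then have "\<phi> w \<in> \<phi> ` ball 0 1" by auto
  moreover have "\<phi> ` ball 0 1 \<subseteq> interior (\<phi> ` cball 0 1)"
    using open_image_ball by (intro interior_maximal image_mono ball_subset_cball)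
  ultimately show False using assms by (auto simp: frontier_def)
qed

text \<open>Values on the frontier of the image are only taken on the circle. There are uncountably many of
  them, while the points that are not good have countably many values.\<close>
lemma outer_point:
  obtains \<eta> where "norm \<eta> = 1" "\<eta> \<in> good" "\<phi> \<eta> \<in> frontier (\<phi> ` cball 0 1)"
proof -
  define K where "K = \<phi> ` cball 0 1"
  have K: "compact K" unfolding K_def by (intro compact_continuous_image continuous_on_closed_disk) auto
  have intK: "interior K \<noteq> {}"
  proof -
    have "\<phi> ` ball 0 1 \<subseteq> interior K"
      unfolding K_def using open_image_ball by (intro interior_maximal image_mono ball_subset_cball)
    moreover have "\<phi> ` ball 0 1 \<noteq> {}" by simp
    ultimately show ?thesis by blast
  qed
  have "K \<noteq> UNIV" using K compact_imp_bounded not_bounded_UNIV by blast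
  \<comment> \<open>A countable frontier could not separate the interior of \<open>K\<close> from its
    complement.\<close>
  have "uncountable (frontier K)"
  proof
    assume "countable (frontier K)"
    then have con: "connected (- frontier K)"
      by (intro path_connected_imp_connected path_connected_complement_countable) auto
    have "interior K \<inter> - frontier K = {} \<or> - K \<inter> - frontier K = {}"
    proof (rule connectedD[OF con])
      show "open (- K)" using K compact_imp_closed by blast
      show "interior K \<inter> - K \<inter> - frontier K = {}" using interior_subset by blast
      show "- frontier K \<subseteq> interior K \<union> - K"
        using compact_imp_closed[OF K] by (auto simp: frontier_def closure_closed)
    qed auto
    then have "interior K \<subseteq> frontier K \<or> - K \<subseteq> frontier K" by blast
    moreover have "interior K \<inter> frontier K = {}" by (auto simp: frontier_def)
    moreover have "frontier K \<subseteq> K" using K compact_imp_closed frontier_subset_closed by blast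
    ultimately show False using intK \<open>K \<noteq> UNIV\<close> by blast
  qed
  moreover have "countable (\<phi> ` (- good))" using countable_not_good by simp
  ultimately have "\<not> frontier K \<subseteq> \<phi> ` (- good)" using countable_subset by blast
  then obtain y where y: "y \<in> frontier K" "y \<notin> \<phi> ` (- good)" by blast
  then have "y \<in> K" using K compact_imp_closed frontier_subset_closed by blast
  then obtain \<eta> where \<eta>: "norm \<eta> \<le> 1" "y = \<phi> \<eta>" by (auto simp: K_def)
  have "\<not> norm \<eta> < 1" using frontier_value_not_inside[of \<eta> \<eta>] y \<eta> by (simp add: K_def)
  with \<eta> y show ?thesis using that[of \<eta>] by (auto simp: K_def)
qed

lemma sheet_captures:
  assumes z: "z \<in> good" and s: "sheets z \<rho>" and w: "w \<in> mates z"
    and X: "X \<longlonglongrightarrow> z" and Y: "Y \<longlonglongrightarrow> w" and eq: "\<And>n::nat. \<phi> (Y n) = \<phi> (X n)"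
  shows "\<forall>\<^sub>F n in sequentially. Y n = \<rho> w (X n) \<and> Y n \<in> mates (X n)"
proof -
  note \<rho> = sheetsD[OF s]
  have "deriv \<phi> w \<noteq> 0" using z w by (simp add: good_def)
  then obtain r where r: "r > 0" "inj_on \<phi> (ball w r)"
    using locally_inj regularD(2)[OF mates_regular[OF w]] by blast
  have 1: "\<forall>\<^sub>F n in sequentially. Y n \<in> ball w r"
    using Y r(1) by (metis centre_in_ball open_ball topological_tendstoD)
  have "(\<lambda>n. \<rho> w (X n)) \<longlonglongrightarrow> \<rho> w z"
    using isCont_tendsto_compose[OF analytic_at_imp_isCont[OF \<rho>(1)[OF w]] X] .
  then have 2: "\<forall>\<^sub>F n in sequentially. \<rho> w (X n) \<in> ball w r"
    using r(1) \<rho>(2)[OF w] by (metis centre_in_ball open_ball topological_tendstoD)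
  have 3: "\<forall>\<^sub>F n in sequentially. \<rho> w (X n) \<in> mates (X n)"
    using tendsto_eventually_compose[OF X \<rho>(3)[OF w]] .
  from 1 2 3 show ?thesis
  proof eventually_elim
    case (elim n)
    have "\<phi> (\<rho> w (X n)) = \<phi> (Y n)" using elim(3) eq[of n] by (simp add: mates_def)
    with elim(1,2) have "\<rho> w (X n) = Y n" using r(2) by (auto dest: inj_onD)
    then show ?case using elim(3) by simp
  qed
qed

text \<open>By compactness, further points of nearby fibres would converge to a point of the fibre of
  \<open>\<eta>\<close>; that is a mate of \<open>\<eta>\<close>, whose sheet captures them.\<close>
lemma fibre_near:
  assumes \<eta>: "\<eta> \<in> good" and fib: "\<And>w. norm w \<le> 1 \<Longrightarrow> \<phi> w = \<phi> \<eta> \<Longrightarrow> w \<in> mates \<eta>"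
  shows "\<forall>\<^sub>F x in nhds \<eta>. {w \<in> cball 0 1. \<phi> w = \<phi> x} \<subseteq> mates x"
proof (rule ccontr)
  assume "\<not> ?thesis"
  then obtain X where X: "X \<longlonglongrightarrow> \<eta>" "\<And>n. \<not> {w \<in> cball 0 1. \<phi> w = \<phi> (X n)} \<subseteq> mates (X n)"
    using not_eventually_nhds_imp_seq[of "\<lambda>x. {w \<in> cball 0 1. \<phi> w = \<phi> x} \<subseteq> mates x" \<eta>] by blast
  then have "\<forall>n. \<exists>y. y \<in> cball 0 1 \<and> \<phi> y = \<phi> (X n) \<and> y \<notin> mates (X n)" by blast
  then obtain Y where Y: "\<And>n. Y n \<in> cball 0 1" "\<And>n. \<phi> (Y n) = \<phi> (X n)" "\<And>n. Y n \<notin> mates (X n)"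
    by metis
  have \<eta>r: "\<eta> \<in> regular" using \<eta> by (simp add: good_def tame_def)
  obtain w s where s: "w \<in> cball 0 1" "strict_mono s" "(Y \<circ> s) \<longlonglongrightarrow> w"
    by (rule seq_compactE[OF compact_imp_seq_compact[OF compact_cball], of Y 0 1]) (use Y(1) in auto)
  have Xs: "(X \<circ> s) \<longlonglongrightarrow> \<eta>" using X(1) s(2) by (rule LIMSEQ_subseq_LIMSEQ)
  have "\<phi> w = \<phi> \<eta>"
    using value_limit(2)[OF Xs s(3) regularD(2)[OF \<eta>r]] Y(1,2) no_pole by simp
  then have w: "w \<in> mates \<eta>" using fib s(1) by simp
  obtain \<rho> where "sheets \<eta> \<rho>" using sheets_exist[OF \<eta>] by blast
  then have "\<forall>\<^sub>F n in sequentially. (Y \<circ> s) n = \<rho> w ((X \<circ> s) n) \<and> (Y \<circ> s) n \<in> mates ((X \<circ> s) n)"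
    by (rule sheet_captures[OF \<eta> _ w Xs s(3)]) (simp add: Y(2))
  then have "\<forall>\<^sub>F n::nat in sequentially. False"
    by eventually_elim (use Y(3) in auto)
  then show False by simp
qed

text \<open>At an outer point \<open>\<eta>\<close> the mates are exactly the points of the circle with the same
  value. A point \<open>x\<close> near \<open>\<eta>\<close> with value off the image of the closed disk has all
  its mates outside the closed disk, and reflection yields \<open>a\<close>.\<close>
lemma base_point_with_mates_in_disk:
  obtains \<eta> a where "norm \<eta> = 1" "norm a < 1" "a \<in> good" "mates a \<subseteq> ball 0 1"
    "card (mates a) = card {w \<in> sphere 0 1. \<phi> w = \<phi> \<eta>}" "{w \<in> cball 0 1. \<phi> w = \<phi> a} \<subseteq> mates a"
proof -
  obtain \<eta> where \<eta>: "norm \<eta> = 1" "\<eta> \<in> good" and fr: "\<phi> \<eta> \<in> frontier (\<phi> ` cball 0 1)"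
    by (rule outer_point)
  have mir: "mirror \<eta> = \<eta>" using \<eta>(1) by (rule mirror_on_circle)
  have fib: "w \<in> mates \<eta>" if "norm w \<le> 1" "\<phi> w = \<phi> \<eta>" for w
  proof -
    have "norm w = 1" using frontier_value_not_inside[OF fr that(2)] that(1) by simp
    then show ?thesis
      using on_circle_regular that(2) mir by (simp add: mates_def mirror_on_circle)
  qed
  have mates\<eta>: "mates \<eta> = {w \<in> sphere 0 1. \<phi> w = \<phi> \<eta>}"
  proof (intro equalityI subsetI)
    fix w assume w: "w \<in> mates \<eta>"
    then have "\<not> norm w < 1" "\<not> norm (mirror w) < 1" "w \<noteq> 0"
      using frontier_value_not_inside[OF fr] mir regularD(1)[OF mates_regular[OF w]] by (auto simp: mates_def)
    then have "norm w = 1" by (auto simp: norm_mirror divide_simps split: if_splits)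
    then show "w \<in> {w \<in> sphere 0 1. \<phi> w = \<phi> \<eta>}" using w by (simp add: mates_def)
  qed (use fib in auto)
  have \<eta>r: "\<eta> \<in> regular" and d\<eta>: "deriv \<phi> \<eta> \<noteq> 0" using \<eta>(2) by (auto simp: good_def tame_def)
  have mcont: "isCont mirror \<eta>" using isCont_mirror regularD(1)[OF \<eta>r] by blast
  define P where "P a \<longleftrightarrow> a \<in> good \<and> {w \<in> cball 0 1. \<phi> w = \<phi> a} \<subseteq> mates a" for a
  have "\<forall>\<^sub>F a in nhds \<eta>. P a"
    unfolding P_def using good_nhds[OF \<eta>(2)] fibre_near[OF \<eta>(2) fib] by (rule eventually_conj)
  then have evP: "\<forall>\<^sub>F x in nhds \<eta>. P (mirror x)"
    using eventually_nhds_compose_cont[OF mcont, of P] mir by simp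
  \<comment> \<open>The local inverse of \<open>\<phi>\<close> at \<open>\<eta>\<close> finds points near
    \<open>\<eta>\<close> whose value lies off the image of the closed disk.\<close>
  obtain g where g: "g analytic_on {\<phi> \<eta>}" "g (\<phi> \<eta>) = \<eta>"
    "\<forall>\<^sub>F u in nhds \<eta>. g (\<phi> u) = u" "\<forall>\<^sub>F v in nhds (\<phi> \<eta>). \<phi> (g v) = v"
    by (rule analytic_local_inverse[OF analytic_off_poles[OF regularD(2)[OF \<eta>r]] d\<eta>])
  have evx: "\<forall>\<^sub>F x in nhds \<eta>. x \<in> regular" by (rule regular_nhds[OF \<eta>r])
  have "\<forall>\<^sub>F v in nhds (\<phi> \<eta>). P (mirror (g v)) \<and> g v \<in> regular"
    using eventually_nhds_compose_cont[OF analytic_at_imp_isCont[OF g(1)], of "\<lambda>x. P (mirror x) \<and> x \<in> regular"]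
      eventually_conj[OF evP evx] g(2) by simp
  with g(4) have "\<forall>\<^sub>F v in nhds (\<phi> \<eta>). \<phi> (g v) = v \<and> P (mirror (g v)) \<and> g v \<in> regular"
    by (rule eventually_conj)
  then obtain T where T: "open T" "\<phi> \<eta> \<in> T" "\<And>v. v \<in> T \<Longrightarrow> \<phi> (g v) = v \<and> P (mirror (g v)) \<and> g v \<in> regular"
    unfolding eventually_nhds by blast
  have "\<phi> \<eta> \<in> closure (- \<phi> ` cball 0 1)" using fr by (simp add: frontier_closures)
  then have "T \<inter> - \<phi> ` cball 0 1 \<noteq> {}" using T(1,2) open_Int_closure_eq_empty by blast
  then obtain v where v: "v \<in> T" "v \<notin> \<phi> ` cball 0 1" by blast
  \<comment> \<open>No mate of \<open>x\<close> is in the closed disk, so all mates of its mirror image are in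
    the open disk.\<close>
  define x where "x = g v"
  have x: "\<phi> x \<notin> \<phi> ` cball 0 1" "P (mirror x)" "x \<in> regular" using T(3)[OF v(1)] v(2) by (auto simp: x_def)
  have out: "norm y > 1" if "\<phi> y = \<phi> x" for y
    using x(1) that by (metis image_eqI linorder_not_le mem_cball_0)
  show ?thesis
  proof (rule that[of \<eta> "mirror x"])
    show "norm (mirror x) < 1" using out[of x] by (simp add: norm_mirror divide_simps)
    show "mirror x \<in> good" "{w \<in> cball 0 1. \<phi> w = \<phi> (mirror x)} \<subseteq> mates (mirror x)"
      using x(2) by (auto simp: P_def)
    then show "card (mates (mirror x)) = card {w \<in> sphere 0 1. \<phi> w = \<phi> \<eta>}"
      using card_mates_constant[of "mirror x" \<eta>] \<eta>(2) mates\<eta> by simp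
    show "mates (mirror x) \<subseteq> ball 0 1"
    proof
      fix w assume w: "w \<in> mates (mirror x)"
      then have "mirror w \<in> mates x" by (simp add: mates_mirror)
      then have "norm (mirror w) > 1" using out by (simp add: mates_def)
      then show "w \<in> ball 0 1"
        using regularD(1)[OF mates_regular[OF w]] by (auto simp: norm_mirror divide_simps split: if_splits)
    qed
  qed (rule \<eta>(1))
qed

section \<open>The product over the mates\<close>

text \<open>Mates of points near \<open>z\<close> can accumulate at \<open>p\<close> only if \<open>z\<close>
  and \<open>p\<close> are mates, also when \<open>z\<close> is one of the exceptional points of the closed
  disk. For \<open>z = 0\<close> the value at \<open>p\<close> would be \<open>\<phi> 0\<close>, and a pole at
  \<open>mirror z\<close> is excluded because \<open>\<phi> (mirror p)\<close> is finite.\<close>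
lemma mates_separated:
  assumes z: "norm z \<le> 1" and p: "p \<in> regular" "\<phi> p \<noteq> \<phi> 0" "z \<notin> mates p"
  shows "\<exists>\<delta>>0. \<forall>\<^sub>F x in nhds z. x \<in> regular \<longrightarrow> (\<forall>w\<in>mates x. \<delta> \<le> norm (w - p))"
proof (rule ccontr)
  assume neg: "\<not> ?thesis"
  define Q where "Q n q \<longleftrightarrow> dist (fst q) z < 1 / real (Suc n) \<and> fst q \<in> regular \<and> snd q \<in> mates (fst q)
      \<and> norm (snd q - p) < 1 / real (Suc n)" for n q
  have "\<forall>n. \<exists>q. Q n q"
  proof (rule allI, rule ccontr)
    fix n assume nq: "\<nexists>q. Q n q"
    define d where "d = 1 / real (Suc n)"
    have d: "d > 0" by (simp add: d_def)
    have "\<forall>x. dist x z < d \<longrightarrow> x \<in> regular \<longrightarrow> (\<forall>w\<in>mates x. d \<le> norm (w - p))"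
    proof (intro allI impI ballI)
      fix x w assume "dist x z < d" "x \<in> regular" "w \<in> mates x"
      moreover have "\<not> Q n (x, w)" using nq by blast
      ultimately show "d \<le> norm (w - p)" by (simp add: Q_def d_def)
    qed
    then have "\<forall>\<^sub>F x in nhds z. x \<in> regular \<longrightarrow> (\<forall>w\<in>mates x. d \<le> norm (w - p))"
      unfolding eventually_nhds_metric using d by blast
    with neg d show False by blast
  qed
  from choice[OF this] obtain q where q: "\<And>n. Q n (q n)" by blast
  define X Y where "X n = fst (q n)" and "Y n = snd (q n)" for n
  have XY: "\<And>n. dist (X n) z < 1 / real (Suc n)" "\<And>n. X n \<in> regular"
    "\<And>n. Y n \<in> mates (X n)" "\<And>n. norm (Y n - p) < 1 / real (Suc n)"
    using q by (simp_all add: Q_def X_def Y_def)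
  have lim: "(\<lambda>n. 1 / real (Suc n)) \<longlonglongrightarrow> 0"
    using LIMSEQ_inverse_real_of_nat by (simp add: inverse_eq_divide)
  have X: "X \<longlonglongrightarrow> z"
    unfolding tendsto_dist_iff[of X] 
    by (rule tendsto_sandwich[OF _ _ tendsto_const lim]) (auto intro!: always_eventually less_imp_le XY(1) simp del: of_nat_Suc)
  have Y: "Y \<longlonglongrightarrow> p"
    unfolding tendsto_dist_iff[of Y] dist_norm
    by (rule tendsto_sandwich[OF _ _ tendsto_const lim]) (auto intro!: always_eventually less_imp_le XY(4) simp del: of_nat_Suc)
  have "\<phi> p = \<phi> z"
    using value_limit(2)[OF X Y no_pole[OF z]] XY(3) by (auto simp: mates_def regular_def)
  then have z0: "z \<noteq> 0" using p(2) by auto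
  have p0: "p \<noteq> 0" "\<not> is_pole \<phi> (mirror p)" using p(1) by (auto simp: regular_def)
  have mX: "(\<lambda>n. mirror (X n)) \<longlonglongrightarrow> mirror z" using X z0 by (rule tendsto_mirror)
  have mY: "(\<lambda>n. mirror (Y n)) \<longlonglongrightarrow> mirror p" using Y p0(1) by (rule tendsto_mirror)
  have "\<forall>\<^sub>F n in sequentially. \<phi> (mirror (X n)) = \<phi> (mirror (Y n)) \<and> \<not> is_pole \<phi> (mirror (X n))"
    using XY(2,3) by (auto simp: mates_def regular_def)
  from value_limit[OF mY mX p0(2) this] have "\<not> is_pole \<phi> (mirror z)" "\<phi> (mirror z) = \<phi> (mirror p)" .
  then have "z \<in> mates p"
    using \<open>\<phi> p = \<phi> z\<close> z0 no_pole[OF z] by (simp add: mates_def regular_def)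
  with p(3) show False by simp
qed

text \<open>The Blaschke product that factors \<open>\<phi>\<close>, before it is known to be one: it is
  constant on classes of mates by construction.\<close>
definition mate_product :: "complex \<Rightarrow> complex \<Rightarrow> complex" where
  "mate_product a z = (\<Prod>w\<in>mates z. blaschke_factor a w)"

lemma mate_product_near:
  assumes "sheets z \<rho>"
  shows "\<forall>\<^sub>F x in nhds z. mate_product a x = (\<Prod>w\<in>mates z. blaschke_factor a (\<rho> w x))"
  using sheetsD(4,5)[OF assms]
  by eventually_elim (simp add: mate_product_def prod.reindex)

lemma mate_product_analytic:
  assumes z: "z \<in> good" and a: "a \<noteq> 0" "mirror a \<notin> mates z"
  shows "mate_product a analytic_on {z}"
proof -
  obtain \<rho> where s: "sheets z \<rho>" using sheets_exist[OF z] by blast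
  have "(\<lambda>x. \<Prod>w\<in>mates z. blaschke_factor a (\<rho> w x)) analytic_on {z}"
    using sheetsD(1,2)[OF s] a
    by (intro analytic_on_prod blaschke_factor_analytic) auto
  then show ?thesis
    using analytic_at_cong[OF mate_product_near[OF s] refl] by simp
qed

lemma norm_mate_product_circle:
  assumes t: "norm t = 1" and a: "norm a < 1" "a \<notin> mates t" "a \<noteq> 0"
  shows "norm (mate_product a t) = 1"
proof -
  have mir: "mirror t = t" using t by (rule mirror_on_circle)
  have "mirror \<in> mates t \<rightarrow> mates t" using mates_mirror[of _ t] mir by auto
  then have fin: "bij_betw mirror (mates t) (mates t)"
    by (intro bij_betwI[of _ _ _ mirror]) auto
  have inv: "norm (blaschke_factor a (mirror w)) = 1 / norm (blaschke_factor a w)" if "w \<in> mates t" for w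
    using that by (intro norm_blaschke_factor_mirror) (simp add: mates_def regular_def)
  \<comment> \<open>Reflection permutes the mates of \<open>t\<close> and inverts the modulus of each factor, so
    \<open>P = 1 / P\<close>.\<close>
  define P where "P = (\<Prod>w\<in>mates t. norm (blaschke_factor a w))"
  have "P = (\<Prod>w\<in>mates t. norm (blaschke_factor a (mirror w)))"
    unfolding P_def using prod.reindex_bij_betw[OF fin, of "\<lambda>w. norm (blaschke_factor a w)"] by simp
  also have "\<dots> = (\<Prod>w\<in>mates t. 1 / norm (blaschke_factor a w))"
    using inv by (intro prod.cong) auto
  also have "\<dots> = 1 / P" by (simp add: P_def prod_dividef)
  finally have PP: "P = 1 / P" .
  have nz: "blaschke_factor a w \<noteq> 0" if w: "w \<in> mates t" for w
  proof -
    have "w \<noteq> a" using w a(2) by blast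
    moreover have "mirror w \<noteq> a" using w a(2) mates_mirror[of w t] mir by auto
    then have "w \<noteq> mirror a" by auto
    ultimately show ?thesis using blaschke_factor_mirror[OF a(3)] a(3) by simp
  qed
  have "P > 0"
    unfolding P_def using nz by (intro prod_pos) auto
  then have "P * P = 1 * 1" using PP by (simp add: field_simps)
  then have "P = 1" using \<open>P > 0\<close> by (auto simp: square_eq_1_iff)
  then show ?thesis by (simp add: P_def mate_product_def prod_norm)
qed

lemma mates_mirror_outside:
  assumes "mates a \<subseteq> ball 0 1" "norm z \<le> 1"
  shows "z \<notin> mates (mirror a)"
proof
  assume z: "z \<in> mates (mirror a)"
  then have "norm (mirror z) < 1" using assms(1) by (auto simp: mates_mirror)
  moreover have "z \<noteq> 0" using regularD(1)[OF mates_regular[OF z]] .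
  ultimately show False using assms(2) by (simp add: norm_mirror divide_simps)
qed

text \<open>The product has the same number of factors at all good points, and each factor is bounded near the
  closed disk, because the pole \<open>mirror a\<close> of \<open>blaschke_factor a\<close> has only mates
  outside.\<close>
lemma mate_product_extension:
  assumes a: "a \<in> good" "mates a \<subseteq> ball 0 1"
  obtains \<Omega> g where "open \<Omega>" "cball 0 1 \<subseteq> \<Omega>" "g holomorphic_on \<Omega>"
    "\<And>x. x \<in> \<Omega> \<Longrightarrow> x \<in> good \<Longrightarrow> g x = mate_product a x"
proof -
  have at: "a \<in> tame" and ar: "a \<in> regular" and a0: "a \<noteq> 0"
    using a(1) by (auto simp: good_def tame_def regular_def)
  \<comment> \<open>The product can be large only where some mate is close to \<open>mirror a\<close>, the pole
    of \<open>blaschke_factor a\<close>.\<close>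
  define near where "near \<delta> z \<longleftrightarrow> (\<forall>\<^sub>F x in nhds z. x \<in> regular \<longrightarrow> (\<forall>w\<in>mates x. \<delta> \<le> norm (w - mirror a)))" for \<delta> z
  define \<Omega> where "\<Omega> = {z. \<exists>\<delta>>0. near \<delta> z}"
  have "open \<Omega>"
  proof (subst open_subopen, rule ballI)
    fix z assume "z \<in> \<Omega>"
    then obtain \<delta> where \<delta>: "\<delta> > 0" "near \<delta> z" by (auto simp: \<Omega>_def)
    then have "\<forall>\<^sub>F x in nhds z. near \<delta> x" by (simp add: near_def eventually_eventually)
    then obtain T where "open T" "z \<in> T" "\<And>x. x \<in> T \<Longrightarrow> near \<delta> x" unfolding eventually_nhds by blast
    with \<delta>(1) show "\<exists>T. open T \<and> z \<in> T \<and> T \<subseteq> \<Omega>" by (intro exI[of _ T]) (auto simp: \<Omega>_def)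
  qed
  have cb: "cball 0 1 \<subseteq> \<Omega>"
  proof
    fix z :: complex assume "z \<in> cball 0 1"
    then have z: "norm z \<le> 1" by simp
    have "\<exists>\<delta>>0. near \<delta> z"
      unfolding near_def
    proof (rule mates_separated[OF z])
      show "mirror a \<in> regular" using ar by (simp add: regular_mirror)
      show "\<phi> (mirror a) \<noteq> \<phi> 0" using at by (simp add: tame_def)
      show "z \<notin> mates (mirror a)" by (rule mates_mirror_outside[OF a(2) z])
    qed
    then show "z \<in> \<Omega>" by (simp add: \<Omega>_def)
  qed
  define m where "m = card (mates a)"
  have bd: "\<exists>M. \<forall>\<^sub>F x in nhds z. x \<in> \<Omega> \<inter> good \<longrightarrow> norm (mate_product a x) \<le> M" if z: "z \<in> \<Omega>" for z
  proof -
    obtain \<delta> where \<delta>: "\<delta> > 0" "near \<delta> z" using z by (auto simp: \<Omega>_def)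
    define K where "K = (1 + norm (mirror a - a) / \<delta>) / norm a"
    from \<delta>(2) have "\<forall>\<^sub>F x in nhds z. x \<in> \<Omega> \<inter> good \<longrightarrow> norm (mate_product a x) \<le> K ^ m"
      unfolding near_def
    proof eventually_elim
      case (elim x)
      show ?case
      proof
        assume x: "x \<in> \<Omega> \<inter> good"
        then have "x \<in> regular" using good_tame tame_regular by blast
        then have "norm (mate_product a x) \<le> K ^ card (mates x)"
          unfolding mate_product_def K_def using elim \<delta>(1) a0
          by (intro prod_norm_le_power blaschke_factor_le) auto
        then show "norm (mate_product a x) \<le> K ^ m"
          using card_mates_constant[of x a] x a(1) by (simp add: m_def)
      qed
    qed
    then show ?thesis by blast
  qed
  have hol: "mate_product a holomorphic_on \<Omega> \<inter> good"
  proof -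
    have "mate_product a analytic_on {z}" if z: "z \<in> \<Omega> \<inter> good" for z
    proof (rule mate_product_analytic)
      obtain \<delta> where \<delta>: "\<delta> > 0" "near \<delta> z" using z by (auto simp: \<Omega>_def)
      have "z \<in> regular" using z good_tame tame_regular by blast
      then have "\<forall>w\<in>mates z. \<delta> \<le> norm (w - mirror a)"
        using eventually_nhds_x_imp_x[OF \<delta>(2)[unfolded near_def]] by blast
      then show "mirror a \<notin> mates z" using \<delta>(1) by auto
    qed (use z a0 in auto)
    then show ?thesis by (metis analytic_imp_holomorphic analytic_on_analytic_at)
  qed
  have dens: "\<forall>\<^sub>F y in at x. y \<in> \<Omega> \<inter> S" if "x \<in> \<Omega>" "\<forall>\<^sub>F y in at x. y \<in> S" for x S
    using eventually_conj[OF eventually_at_in_open'[OF \<open>open \<Omega>\<close> that(1)] that(2)] by simp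
  \<comment> \<open>Points outside \<open>good\<close> may accumulate at untamed points, and these at
    \<open>0\<close>; hence three rounds of removing isolated singularities.\<close>
  have "\<exists>g. g holomorphic_on \<Omega> \<inter> tame \<and> (\<forall>x\<in>\<Omega> \<inter> good. g x = mate_product a x) \<and>
    (\<forall>z\<in>\<Omega>. \<exists>M. \<forall>\<^sub>F x in nhds z. x \<in> \<Omega> \<inter> tame \<longrightarrow> norm (g x) \<le> M)"
  proof (rule removable_extension)
    show "open (\<Omega> \<inter> tame)" "open (\<Omega> \<inter> good)" using \<open>open \<Omega>\<close> open_tame open_good by blast+
    show "\<Omega> \<inter> good \<subseteq> \<Omega> \<inter> tame" using good_tame by blast
    show "\<forall>\<^sub>F y in at x. y \<in> \<Omega> \<inter> good" if "x \<in> \<Omega> \<inter> tame" for x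
      using dens[OF _ good_punctured_nhds] that by blast
    show "\<Omega> \<inter> tame \<subseteq> \<Omega>" by blast
    show "mate_product a holomorphic_on \<Omega> \<inter> good" by (rule hol)
    show "\<exists>M. \<forall>\<^sub>F x in nhds z. x \<in> \<Omega> \<inter> good \<longrightarrow> norm (mate_product a x) \<le> M" if "z \<in> \<Omega>" for z
      using that by (rule bd)
  qed
  then obtain g1 where g1: "g1 holomorphic_on \<Omega> \<inter> tame" "\<forall>x\<in>\<Omega> \<inter> good. g1 x = mate_product a x"
    "\<forall>z\<in>\<Omega>. \<exists>M. \<forall>\<^sub>F x in nhds z. x \<in> \<Omega> \<inter> tame \<longrightarrow> norm (g1 x) \<le> M" by blast
  have "\<exists>g. g holomorphic_on \<Omega> \<inter> - {0} \<and> (\<forall>x\<in>\<Omega> \<inter> tame. g x = g1 x) \<and>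
    (\<forall>z\<in>\<Omega>. \<exists>M. \<forall>\<^sub>F x in nhds z. x \<in> \<Omega> \<inter> - {0} \<longrightarrow> norm (g x) \<le> M)"
  proof (rule removable_extension)
    show "open (\<Omega> \<inter> - {0})" "open (\<Omega> \<inter> tame)" using \<open>open \<Omega>\<close> open_tame by auto
    show "\<Omega> \<inter> tame \<subseteq> \<Omega> \<inter> - {0}" using regularD(1) tame_regular by blast
    show "\<forall>\<^sub>F y in at x. y \<in> \<Omega> \<inter> tame" if "x \<in> \<Omega> \<inter> - {0}" for x
      using dens[OF _ tame_punctured_nhds] that by blast
    show "\<exists>M. \<forall>\<^sub>F x in nhds z. x \<in> \<Omega> \<inter> tame \<longrightarrow> norm (g1 x) \<le> M" if "z \<in> \<Omega>" for z
      using g1(3) that by blast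
    show "\<Omega> \<inter> - {0} \<subseteq> \<Omega>" by blast
    show "g1 holomorphic_on \<Omega> \<inter> tame" by (rule g1(1))
  qed
  then obtain g2 where g2: "g2 holomorphic_on \<Omega> \<inter> - {0}" "\<forall>x\<in>\<Omega> \<inter> tame. g2 x = g1 x"
    "\<forall>z\<in>\<Omega>. \<exists>M. \<forall>\<^sub>F x in nhds z. x \<in> \<Omega> \<inter> - {0} \<longrightarrow> norm (g2 x) \<le> M" by blast
  have "\<exists>g. g holomorphic_on \<Omega> \<and> (\<forall>x\<in>\<Omega> \<inter> - {0}. g x = g2 x) \<and>
    (\<forall>z\<in>\<Omega>. \<exists>M. \<forall>\<^sub>F x in nhds z. x \<in> \<Omega> \<longrightarrow> norm (g x) \<le> M)"
  proof (rule removable_extension)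
    show "open (\<Omega> \<inter> - {0})" using \<open>open \<Omega>\<close> by auto
    show "\<forall>\<^sub>F y in at x. y \<in> \<Omega> \<inter> - {0}" if "x \<in> \<Omega>" for x
    proof (rule dens[OF that])
      have "\<forall>\<^sub>F y in nhds x. y \<noteq> x \<longrightarrow> y \<noteq> 0"
      proof (cases "x = 0")
        case False
        from t1_space_nhds[OF this] show ?thesis by eventually_elim simp
      qed simp
      then show "\<forall>\<^sub>F y in at x. y \<in> - {0}" by (simp add: eventually_at_filter)
    qed
    show "\<exists>M. \<forall>\<^sub>F x in nhds z. x \<in> \<Omega> \<inter> - {0} \<longrightarrow> norm (g2 x) \<le> M" if "z \<in> \<Omega>" for z
      using g2(3) that by blast
    show "\<Omega> \<inter> - {0} \<subseteq> \<Omega>" "\<Omega> \<subseteq> \<Omega>" by blast+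
    show "g2 holomorphic_on \<Omega> \<inter> - {0}" by (rule g2(1))
    show "open \<Omega>" by fact
  qed
  then obtain g3 where g3: "g3 holomorphic_on \<Omega>" "\<forall>x\<in>\<Omega> \<inter> - {0}. g3 x = g2 x" by blast
  have "g3 x = mate_product a x" if "x \<in> \<Omega>" "x \<in> good" for x
  proof -
    have "x \<in> tame" "x \<noteq> 0" using that(2) good_tame tame_regular regularD(1) by blast+
    then show ?thesis using g1(2) g2(2) g3(2) that by simp
  qed
  then show ?thesis by (rule that[OF \<open>open \<Omega>\<close> cb g3(1)])
qed

lemma extension_sheet_invariant:
  assumes a: "a \<in> good" and \<rho>: "\<rho> analytic_on {a}" "\<forall>\<^sub>F x in nhds a. \<rho> x \<in> mates x"
    and \<Omega>: "open \<Omega>" "a \<in> \<Omega>" "\<rho> a \<in> \<Omega>" "g holomorphic_on \<Omega>"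
      "\<And>x. x \<in> \<Omega> \<Longrightarrow> x \<in> good \<Longrightarrow> g x = mate_product a x"
  shows "\<forall>\<^sub>F x in nhds a. g (\<rho> x) = g x"
proof -
  have ar: "a \<in> regular" "deriv \<phi> a \<noteq> 0" using a by (auto simp: good_def tame_def)
  have cont: "isCont \<rho> a" using \<rho>(1) analytic_at_imp_isCont by blast
  have "g analytic_on {a}" "g analytic_on {\<rho> a}"
    using \<Omega> holomorphic_on_imp_analytic_at by auto
  moreover from this(2) have "(g \<circ> \<rho>) analytic_on {a}"
    using analytic_on_compose[OF \<rho>(1), of g] by simp
  ultimately have han: "(\<lambda>x. g (\<rho> x) - g x) analytic_on {a}"
    by (intro analytic_intros) (simp_all add: o_def)
  have ev: "\<forall>\<^sub>F x in nhds a. x \<in> good \<and> x \<in> \<Omega> \<and> \<rho> x \<in> \<Omega> \<and> \<rho> x \<in> mates x"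
    using good_nhds[OF a] eventually_nhds_in_open[OF \<Omega>(1,2)]
      eventually_nhds_compose_cont[OF cont eventually_nhds_in_open[OF \<Omega>(1,3)]] \<rho>(2)
    by eventually_elim simp
  \<comment> \<open>The equation is known where both \<open>x\<close> and \<open>\<rho> x\<close> are good;
    otherwise \<open>\<phi>\<close> would map a disk into a countable set.\<close>
  have "\<exists>\<^sub>F x in at a. g (\<rho> x) - g x = 0"
    unfolding frequently_def
  proof
    assume "\<forall>\<^sub>F x in at a. g (\<rho> x) - g x \<noteq> 0"
    then have "\<forall>\<^sub>F x in nhds a. x \<noteq> a \<longrightarrow> g (\<rho> x) - g x \<noteq> 0" by (simp add: eventually_at_filter)
    with ev have "\<forall>\<^sub>F x in nhds a. x \<noteq> a \<longrightarrow> \<rho> x \<notin> good \<and> \<phi> (\<rho> x) = \<phi> x"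
    proof eventually_elim
      case (elim x)
      have "mate_product a (\<rho> x) = mate_product a x"
        using mates_eq[of "\<rho> x" x] elim(1) by (simp add: mate_product_def)
      then show ?case using elim \<Omega>(5)[of x] \<Omega>(5)[of "\<rho> x"] by (auto simp: mates_def)
    qed
    then obtain e where e: "e > 0" "\<And>x. dist x a < e \<Longrightarrow> x \<noteq> a \<Longrightarrow> \<rho> x \<notin> good \<and> \<phi> (\<rho> x) = \<phi> x"
      unfolding eventually_nhds_metric by blast
    obtain r where r: "r > 0" "inj_on \<phi> (ball a r)"
      using locally_inj regularD(2) ar by blast
    define s where "s = min e r"
    have "\<phi> ` (ball a s - {a}) \<subseteq> \<phi> ` (- good)"
    proof
      fix y assume "y \<in> \<phi> ` (ball a s - {a})"
      then obtain x where x: "x \<in> ball a s" "x \<noteq> a" "y = \<phi> x" by blast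
      then have "\<rho> x \<notin> good \<and> \<phi> (\<rho> x) = \<phi> x" using e(2)[of x] by (simp add: s_def dist_commute)
      then have "y = \<phi> (\<rho> x)" "\<rho> x \<in> - good" using x(3) by simp_all
      then show "y \<in> \<phi> ` (- good)" by (rule image_eqI)
    qed
    then have "countable (\<phi> ` (ball a s - {a}))"
      using countable_image[OF countable_not_good] by (rule countable_subset)
    moreover have "inj_on \<phi> (ball a s - {a})"
      using r(2) by (rule inj_on_subset) (auto simp: s_def)
    ultimately have "countable (ball a s - {a})" by (rule countable_image_inj_on)
    then have "countable (insert a (ball a s - {a}))" by (rule countable_insert)
    then have "countable (ball a s)" by (rule countable_subset[rotated]) auto
    moreover have "s > 0" using e(1) r(1) by (simp add: s_def)
    ultimately show False using uncountable_ball[of s a] by blast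
  qed
  then show ?thesis using analytic_frequently_zero[OF han] by simp
qed

lemma extension_unimodular:
  assumes a: "a \<in> good" "norm a < 1" "mates a \<subseteq> ball 0 1"
    and \<Omega>: "open \<Omega>" "cball 0 1 \<subseteq> \<Omega>" "g holomorphic_on \<Omega>"
      "\<And>x. x \<in> \<Omega> \<Longrightarrow> x \<in> good \<Longrightarrow> g x = mate_product a x"
    and t: "norm t = 1"
  shows "norm (g t) = 1"
proof (rule ccontr)
  assume n1: "norm (g t) \<noteq> 1"
  have ar: "a \<in> regular" using a(1) good_tame tame_regular by blast
  have t\<Omega>: "s \<in> \<Omega>" if "norm s = 1" for s using \<Omega>(2) that by auto
  have "isCont g t"
    using \<Omega>(1,3) t\<Omega>[OF t] holomorphic_on_imp_analytic_at analytic_at_imp_isCont by blast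
  then have "isCont (\<lambda>x. norm (g x)) t" by (rule isCont_norm)
  then have "\<forall>\<^sub>F x in nhds t. norm (g x) \<noteq> 1"
    using n1 by (rule eventually_nhds_compose_cont[OF _ t1_space_nhds])
  then obtain N where N: "open N" "t \<in> N" "\<And>x. x \<in> N \<Longrightarrow> norm (g x) \<noteq> 1"
    unfolding eventually_nhds by blast
  obtain s where s: "norm s = 1" "s \<in> N" "s \<notin> - good"
    by (rule circle_avoids_countable[OF countable_not_good t N(1,2)])
  have "a \<notin> mates s"
  proof
    assume "a \<in> mates s"
    then have "s \<in> mates a" using mates_sym on_circle_regular[OF s(1)] by blast
    then show False using a(3) s(1) by auto
  qed
  then have "norm (mate_product a s) = 1"
    using norm_mate_product_circle[OF s(1) a(2)] regularD(1)[OF ar] by blast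
  then show False using N(3)[OF s(2)] \<Omega>(4)[OF t\<Omega>[OF s(1)]] s(3) by simp
qed

text \<open>Near such a point every factor of the product is bounded below, by a bound that survives the
  limit.\<close>
lemma extension_nonzero:
  assumes a: "a \<in> good" "mates a \<subseteq> ball 0 1"
    and \<Omega>: "open \<Omega>" "cball 0 1 \<subseteq> \<Omega>" "g holomorphic_on \<Omega>"
      "\<And>x. x \<in> \<Omega> \<Longrightarrow> x \<in> good \<Longrightarrow> g x = mate_product a x"
    and z: "norm z \<le> 1" "z \<notin> mates a"
  shows "g z \<noteq> 0"
proof
  assume gz: "g z = 0"
  have at: "a \<in> tame" and ar: "a \<in> regular" and a0: "a \<noteq> 0"
    using a(1) by (auto simp: good_def tame_def regular_def)
  have "\<exists>\<delta>>0. \<forall>\<^sub>F x in nhds z. x \<in> regular \<longrightarrow> (\<forall>w\<in>mates x. \<delta> \<le> norm (w - a))"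
    using at by (intro mates_separated[OF z(1) ar _ z(2)]) (simp add: tame_def)
  then obtain \<delta> where \<delta>: "\<delta> > 0" "\<forall>\<^sub>F x in nhds z. x \<in> regular \<longrightarrow> (\<forall>w\<in>mates x. \<delta> \<le> norm (w - a))"
    by blast
  have "\<exists>\<delta>>0. \<forall>\<^sub>F x in nhds z. x \<in> regular \<longrightarrow> (\<forall>w\<in>mates x. \<delta> \<le> norm (w - mirror a))"
    using at ar mates_mirror_outside[OF a(2) z(1)]
    by (intro mates_separated[OF z(1)]) (simp_all add: tame_def regular_mirror)
  then obtain \<delta>' where \<delta>': "\<delta>' > 0"
    "\<forall>\<^sub>F x in nhds z. x \<in> regular \<longrightarrow> (\<forall>w\<in>mates x. \<delta>' \<le> norm (w - mirror a))"
    by blast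
  define e where "e = 1 / (norm a * (1 + norm (a - mirror a) / \<delta>))"
  have e: "e > 0" using a0 \<delta>(1) by (simp add: e_def add_pos_nonneg)
  define m where "m = card (mates a)"
  have z\<Omega>: "z \<in> \<Omega>" using \<Omega>(2) z(1) by auto
  have cont: "isCont g z"
    using \<Omega>(1,3) z\<Omega> holomorphic_on_imp_analytic_at analytic_at_imp_isCont by blast
  have "\<forall>\<^sub>F x in nhds z. norm (g x) < e ^ m"
  proof -
    have "isCont (\<lambda>x. norm (g x)) z" using cont by (rule isCont_norm)
    then show ?thesis
      by (rule eventually_nhds_compose_cont[where P="\<lambda>y. y < e ^ m"])
         (use gz e in \<open>auto intro!: eventually_nhds_in_open[of "{..<e ^ m}", simplified]\<close>)
  qed
  with \<delta>(2) \<delta>'(2) eventually_nhds_in_open[OF \<Omega>(1) z\<Omega>] have "\<forall>\<^sub>F x in nhds z. x \<notin> good"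
  proof eventually_elim
    case (elim x)
    show ?case
    proof
      assume x: "x \<in> good"
      then have xr: "x \<in> regular" using good_tame tame_regular by blast
      have "e ^ card (mates x) \<le> norm (mate_product a x)"
        unfolding mate_product_def
      proof (rule prod_norm_ge_power)
        fix w assume w: "w \<in> mates x"
        have "w \<noteq> mirror a" using elim(2) xr w \<delta>'(1) by force
        moreover have "\<delta> \<le> norm (w - a)" using elim(1) xr w by blast
        ultimately show "e \<le> norm (blaschke_factor a w)"
          unfolding e_def using blaschke_factor_ge[OF a0 \<delta>(1)] by blast
      qed (use e in simp)
      then have "e ^ m \<le> norm (g x)"
        using card_mates_constant[OF x a(1)] \<Omega>(4)[OF elim(3) x] by (simp add: m_def)
      then show False using elim(4) by simp
    qed
  qed
  then show False using frequently_good[of z] by (simp add: frequently_def)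
qed

text \<open>At \<open>a\<close> only the factor of the identity sheet vanishes, and it does so to first
  order.\<close>
lemma extension_deriv_nonzero:
  assumes a: "a \<in> good" "norm a < 1" "mates a \<subseteq> ball 0 1"
    and \<Omega>: "open \<Omega>" "cball 0 1 \<subseteq> \<Omega>" "g holomorphic_on \<Omega>"
      "\<And>x. x \<in> \<Omega> \<Longrightarrow> x \<in> good \<Longrightarrow> g x = mate_product a x"
  shows "deriv g a \<noteq> 0"
proof -
  have ar: "a \<in> regular" and a0: "a \<noteq> 0" and da: "deriv \<phi> a \<noteq> 0"
    using a(1) by (auto simp: good_def tame_def regular_def)
  have fin: "finite (mates a)" using finite_mates good_tame a(1) by blast
  have am: "a \<in> mates a" using mates_refl ar by blast
  have a\<Omega>: "a \<in> \<Omega>" using \<Omega>(2) a(2) by auto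
  obtain \<rho> where s: "sheets a \<rho>" using sheets_exist[OF a(1)] by blast
  note \<rho> = sheetsD[OF s]
  obtain r where r: "r > 0" "inj_on \<phi> (ball a r)"
    using locally_inj regularD(2) ar da by blast
  have "isCont (\<rho> a) a" using \<rho>(1)[OF am] analytic_at_imp_isCont by blast
  then have "\<forall>\<^sub>F x in nhds a. \<rho> a x \<in> ball a r"
    by (rule eventually_nhds_compose_cont) (use r(1) \<rho>(2)[OF am] in \<open>auto intro!: eventually_nhds_in_open simp del: mem_ball\<close>)
  moreover have "\<forall>\<^sub>F x in nhds a. x \<in> ball a r"
    using r(1) by (intro eventually_nhds_in_open) auto
  ultimately have id: "\<forall>\<^sub>F x in nhds a. \<rho> a x = x"
    using \<rho>(3)[OF am]
  proof eventually_elim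
    case (elim x)
    then show ?case using r(2) by (auto simp: mates_def dest: inj_onD)
  qed
  define H where "H x = (1 / (1 - cnj a * x)) * (\<Prod>w\<in>mates a - {a}. blaschke_factor a (\<rho> w x))" for x
  have nm: "w \<noteq> mirror a" if "w \<in> mates a" for w
  proof
    assume "w = mirror a"
    then have "norm (mirror a) < 1" using a(3) that by auto
    then show False using a(2) a0 by (simp add: norm_mirror divide_simps)
  qed
  have Han: "H analytic_on {a}"
    unfolding H_def using blaschke_factor_denom[OF a(2), of a] a(2) \<rho>(1,2) nm a0
    by (intro analytic_intros analytic_on_prod blaschke_factor_analytic) auto
  have "\<forall>\<^sub>F x in nhds a. g x = (x - a) * H x"
    using id mate_product_near[OF s, of a] good_nhds[OF a(1)] eventually_nhds_in_open[OF \<Omega>(1) a\<Omega>]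
  proof eventually_elim
    case (elim x)
    have "g x = (\<Prod>w\<in>mates a. blaschke_factor a (\<rho> w x))"
      using \<Omega>(4)[OF elim(4,3)] elim(2) by simp
    also have "\<dots> = blaschke_factor a (\<rho> a x) * (\<Prod>w\<in>mates a - {a}. blaschke_factor a (\<rho> w x))"
      using fin am by (rule prod.remove)
    also have "\<dots> = (x - a) * H x"
      using elim(1) by (simp add: blaschke_factor_def[of a x] H_def)
    finally show ?case .
  qed
  then have "deriv g a = H a" using Han by (rule deriv_of_linear_factor)
  moreover have "H a \<noteq> 0"
  proof -
    have "blaschke_factor a (\<rho> w a) \<noteq> 0" if w: "w \<in> mates a - {a}" for w
      using w \<rho>(2)[of w] nm[of w] a0 by (simp add: blaschke_factor_mirror)
    then show ?thesis
      using fin blaschke_factor_denom[OF a(2), of a] a(2) by (simp add: H_def prod_zero_iff)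
  qed
  ultimately show ?thesis by simp
qed

text \<open>The sheet from \<open>a\<close> to \<open>z\<close> carries the simple zero at \<open>a\<close> to
  \<open>z\<close>.\<close>
lemma extension_zero_mate:
  assumes a: "a \<in> good" "norm a < 1" "mates a \<subseteq> ball 0 1"
    and \<Omega>: "open \<Omega>" "cball 0 1 \<subseteq> \<Omega>" "g holomorphic_on \<Omega>"
      "\<And>x. x \<in> \<Omega> \<Longrightarrow> x \<in> good \<Longrightarrow> g x = mate_product a x"
    and z: "z \<in> mates a"
  shows "g z = 0" "deriv g z \<noteq> 0"
proof -
  have ar: "a \<in> regular" using a(1) good_tame tame_regular by blast
  have am: "a \<in> mates a" using mates_refl ar by blast
  have in\<Omega>: "w \<in> \<Omega>" if "w \<in> mates a" for w using \<Omega>(2) a(3) that ball_subset_cball by blast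
  obtain \<rho> where s: "sheets a \<rho>" using sheets_exist[OF a(1)] by blast
  note \<rho> = sheetsD[OF s]
  have inv: "\<forall>\<^sub>F x in nhds a. g (\<rho> z x) = g x"
    by (rule extension_sheet_invariant[OF a(1) \<rho>(1,3)[OF z] \<Omega>(1) in\<Omega>[OF am] _ \<Omega>(3,4)])
       (use in\<Omega>[OF z] \<rho>(2)[OF z] in auto)
  have "g a = mate_product a a" by (rule \<Omega>(4)[OF in\<Omega>[OF am] a(1)])
  also have "\<dots> = 0"
    unfolding mate_product_def using finite_mates[OF good_tame[OF a(1)]] am
    by (intro prod_zero) (auto intro!: bexI[of _ a] simp: blaschke_factor_def)
  finally show "g z = 0"
    using eventually_nhds_x_imp_x[OF inv] \<rho>(2)[OF z] by simp
  show "deriv g z \<noteq> 0"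
  proof
    assume "deriv g z = 0"
    then have 1: "(g has_field_derivative 0) (at (\<rho> z a))"
      using holomorphic_derivI[OF \<Omega>(3,1) in\<Omega>[OF z]] \<rho>(2)[OF z] by metis
    have 2: "(\<rho> z has_field_derivative deriv (\<rho> z) a) (at a)"
      using \<rho>(1)[OF z] by (metis analytic_on_imp_differentiable_at DERIV_deriv_iff_field_differentiable singletonI)
    have "deriv (\<lambda>x. g (\<rho> z x)) a = 0"
      using DERIV_chain[OF 1 2] by (simp add: o_def DERIV_imp_deriv)
    then have "deriv g a = 0" using deriv_cong_ev[OF inv refl] by simp
    then show False using extension_deriv_nonzero[OF a \<Omega>] by simp
  qed
qed

text \<open>The mate product is unimodular on the circle and its zeros in the disk are the mates of
  \<open>a\<close>, all simple; so it is a Blaschke product, of the order expected. Near \<open>a\<close> its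
  fibres consist of mates, on which \<open>\<phi>\<close> is constant. The last conclusion records that the
  Blaschke product, in turn, is constant on mates on the circle.\<close>
lemma blaschke_factorization:
  assumes a: "a \<in> good" "norm a < 1" "mates a \<subseteq> ball 0 1"
  obtains c \<psi> where "norm c = 1" "\<psi> \<in> H_infty"
    "\<And>z. norm z < 1 \<Longrightarrow> \<phi> z = \<psi> (blaschke c (mset_set (mates a)) z)"
    "\<And>t w. norm t = 1 \<Longrightarrow> norm w = 1 \<Longrightarrow> t \<in> good \<Longrightarrow> w \<in> good \<Longrightarrow> \<phi> w = \<phi> t \<Longrightarrow>
       blaschke c (mset_set (mates a)) w = blaschke c (mset_set (mates a)) t"
proof -
  have ar: "a \<in> regular" using a(1) good_tame tame_regular by blast
  have am: "a \<in> mates a" using mates_refl ar by blast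
  have fin: "finite (mates a)" using finite_mates good_tame a(1) by blast
  define A where "A = mset_set (mates a)"
  have A: "set_mset A = mates a" "size A = card (mates a)" using fin by (simp_all add: A_def)
  have A1: "set_mset A \<subseteq> ball 0 1" using A a(3) by simp
  have ne: "A \<noteq> {#}" using A(1) am by auto
  obtain \<Omega> g where \<Omega>: "open \<Omega>" "cball 0 1 \<subseteq> \<Omega>" "g holomorphic_on \<Omega>"
    "\<And>x. x \<in> \<Omega> \<Longrightarrow> x \<in> good \<Longrightarrow> g x = mate_product a x"
    by (rule mate_product_extension[OF a(1,3)]) blast
  have "\<exists>c. norm c = 1 \<and> (\<forall>z\<in>ball 0 1. g z = blaschke c (mset_set (mates a)) z)"
  proof (rule unimodular_simple_zeros_imp_blaschke[OF fin \<Omega>(1,2,3) _ a(3)])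
    show "norm (g t) = 1" if "norm t = 1" for t
      by (rule extension_unimodular[OF a \<Omega> that])
    show "g z = 0 \<longleftrightarrow> z \<in> mates a" if "norm z < 1" for z
      using extension_zero_mate(1)[OF a \<Omega>] extension_nonzero[OF a(1,3) \<Omega>, of z] that by fastforce
    show "deriv g z \<noteq> 0" if "z \<in> mates a" for z
      by (rule extension_zero_mate(2)[OF a \<Omega> that])
  qed
  then obtain c where c: "norm c = 1" and gB: "\<And>z. z \<in> ball 0 1 \<Longrightarrow> g z = blaschke c A z"
    unfolding A_def by blast
  obtain R where R: "R > 1" "\<phi> holomorphic_on ball 0 R" by (rule holomorphic_radius)
  obtain \<rho> where s: "sheets a \<rho>" using sheets_exist[OF a(1)] by blast
  note \<rho> = sheetsD[OF s]
  have in\<Omega>: "w \<in> \<Omega>" if "w \<in> mates a" for w using \<Omega>(2) a(3) that ball_subset_cball by blast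
  \<comment> \<open>Where the sheets are all present in the disk, they already exhaust the fibre of the Blaschke
    product.\<close>
  define P where "P x \<longleftrightarrow> x \<in> ball 0 1 \<and> mates x = (\<lambda>w. \<rho> w x) ` mates a \<and> inj_on (\<lambda>w. \<rho> w x) (mates a)
     \<and> (\<forall>w\<in>mates a. \<rho> w x \<in> ball 0 1 \<and> g (\<rho> w x) = g x)" for x
  have each: "\<forall>\<^sub>F x in nhds a. \<rho> w x \<in> ball 0 1 \<and> g (\<rho> w x) = g x" if w: "w \<in> mates a" for w
  proof (rule eventually_conj)
    have wb: "\<rho> w a \<in> ball 0 1" using \<rho>(2)[OF w] w a(3) by auto
    show "\<forall>\<^sub>F x in nhds a. \<rho> w x \<in> ball 0 1"
      by (rule eventually_nhds_compose_cont[OF analytic_at_imp_isCont[OF \<rho>(1)[OF w]]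
            eventually_nhds_in_open[OF open_ball wb]])
    show "\<forall>\<^sub>F x in nhds a. g (\<rho> w x) = g x"
      by (rule extension_sheet_invariant[OF a(1) \<rho>(1,3)[OF w] \<Omega>(1) in\<Omega>[OF am] _ \<Omega>(3,4)])
         (use in\<Omega>[OF w] \<rho>(2)[OF w] in auto)
  qed
  have "\<forall>\<^sub>F x in nhds a. \<forall>w\<in>mates a. \<rho> w x \<in> ball 0 1 \<and> g (\<rho> w x) = g x"
    using each by (intro eventually_ball_finite[OF fin]) blast
  moreover have "\<forall>\<^sub>F x in nhds a. x \<in> ball 0 1"
    using a(2) by (intro eventually_nhds_in_open) auto
  ultimately have "\<forall>\<^sub>F x in nhds a. P x"
    using \<rho>(4,5) unfolding P_def by eventually_elim blast
  then obtain V where V: "open V" "a \<in> V" "\<And>x. x \<in> V \<Longrightarrow> P x" unfolding eventually_nhds by blast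
  have "\<exists>\<psi>. \<psi> holomorphic_on ball 0 1 \<and> bounded (\<psi> ` ball 0 1) \<and>
    (\<forall>z\<in>ball 0 1. \<phi> z = \<psi> (blaschke c A z))"
  proof (rule factor_through_blaschke[OF A1 c ne R V(1)])
    show "V \<noteq> {}" using V(2) by blast
    show "V \<subseteq> ball 0 1" using V(3) by (auto simp: P_def)
    fix x p assume x: "x \<in> V" and p: "norm p < 1" "blaschke c A p = blaschke c A x"
    have Px: "P x" by (rule V(3)[OF x])
    then have xb: "x \<in> ball 0 1" and mx: "mates x = (\<lambda>w. \<rho> w x) ` mates a"
      and inj: "inj_on (\<lambda>w. \<rho> w x) (mates a)"
      and gw: "\<And>w. w \<in> mates a \<Longrightarrow> \<rho> w x \<in> ball 0 1 \<and> g (\<rho> w x) = g x"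
      by (auto simp: P_def)
    have "mates x = {q \<in> ball 0 1. blaschke c A q = blaschke c A x}"
    proof (rule blaschke_fibre_eqI[OF A1 c ne])
      show "norm (blaschke c A x) < 1" using norm_blaschke_less[OF A1 c _ ne] xb by simp
      show "mates x \<subseteq> {q \<in> ball 0 1. blaschke c A q = blaschke c A x}"
      proof
        fix q assume "q \<in> mates x"
        then obtain w where w: "w \<in> mates a" "q = \<rho> w x" using mx by blast
        then have "q \<in> ball 0 1" "g q = g x" using gw by auto
        then show "q \<in> {q \<in> ball 0 1. blaschke c A q = blaschke c A x}" using gB xb by auto
      qed
      show "card (mates x) = size A" unfolding mx A(2) using inj by (rule card_image)
    qed
    then have "p \<in> mates x" using p by auto
    then show "\<phi> p = \<phi> x" by (simp add: mates_def)
  qed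
  then obtain \<psi> where \<psi>: "\<psi> holomorphic_on ball 0 1" "bounded (\<psi> ` ball 0 1)"
    "\<forall>z\<in>ball 0 1. \<phi> z = \<psi> (blaschke c A z)" by blast
  obtain R1 where R1: "R1 > 1" "ball 0 R1 \<subseteq> \<Omega>" by (rule cball_nbhd_radius[OF \<Omega>(1,2)])
  obtain R2 where R2: "R2 > 1" "blaschke c A holomorphic_on ball 0 R2"
    by (rule blaschke_holomorphic_radius[OF A1])
  define R' where "R' = min R1 R2"
  have R': "R' > 1" "g holomorphic_on ball 0 R'" "blaschke c A holomorphic_on ball 0 R'"
  proof -
    show "R' > 1" using R1(1) R2(1) by (simp add: R'_def)
    have "ball 0 R' \<subseteq> ball (0::complex) R1" "ball 0 R' \<subseteq> ball (0::complex) R2"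
      by (auto simp: R'_def)
    then show "g holomorphic_on ball 0 R'" "blaschke c A holomorphic_on ball 0 R'"
      using \<Omega>(3) R1(2) R2(2) holomorphic_on_subset by blast+
  qed
  have gBc: "g t = blaschke c A t" if "norm t = 1" for t
    by (rule analytic_continuation_open[of "ball 0 1" "ball 0 R'" g "blaschke c A" t])
       (use R' gB that in auto)
  show ?thesis
  proof (rule that[OF c])
    show "\<psi> \<in> H_infty" using \<psi> by (simp add: H_infty_def)
    show "\<phi> z = \<psi> (blaschke c (mset_set (mates a)) z)" if "norm z < 1" for z
      using \<psi>(3) that by (simp add: A_def)
    fix t w assume t: "norm t = 1" "norm w = 1" "t \<in> good" "w \<in> good" "\<phi> w = \<phi> t"
    have "w \<in> mates t"
      using t on_circle_regular by (simp add: mates_def mirror_on_circle)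
    then have "mate_product a w = mate_product a t" using mates_eq by (simp add: mate_product_def)
    moreover have "t \<in> \<Omega>" "w \<in> \<Omega>" using \<Omega>(2) t(1,2) by auto
    ultimately have "g w = g t" using \<Omega>(4) t(3,4) by simp
    then show "blaschke c (mset_set (mates a)) w = blaschke c (mset_set (mates a)) t"
      using gBc t(1,2) by (simp add: A_def)
  qed
qed

section \<open>The four invariants\<close>

lemma nonconstant_on_disk: "\<exists>q. norm q < 1 \<and> \<phi> q \<noteq> c"
proof (rule ccontr)
  assume "\<not> ?thesis"
  then have c: "\<And>q. norm q < 1 \<Longrightarrow> \<phi> q = c" by blast
  have "\<forall>\<^sub>F z in at (0::complex). norm z < 1"
    unfolding eventually_at by (auto intro!: exI[of _ 1])
  with avoids_value[of c 0] have "\<forall>\<^sub>F z in at (0::complex). False"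
    by eventually_elim (use c in blast)
  then show False by simp
qed

lemma finite_circle_fibre: "finite {w \<in> sphere 0 1. \<phi> w = c}"
proof -
  obtain R where R: "R > 1" "\<phi> holomorphic_on ball 0 R" by (rule holomorphic_radius)
  have hol: "(\<lambda>x. \<phi> x - c) holomorphic_on ball 0 R" by (intro holomorphic_intros R)
  have "\<not> (\<lambda>x. \<phi> x - c) constant_on ball 0 R"
  proof
    assume "(\<lambda>x. \<phi> x - c) constant_on ball 0 R"
    then obtain k where k: "\<And>x. x \<in> ball 0 R \<Longrightarrow> \<phi> x - c = k" by (auto simp: constant_on_def)
    obtain q where "norm q < 1" "\<phi> q \<noteq> c + k" using nonconstant_on_disk by blast
    then show False using k[of q] R(1) by (simp add: algebra_simps)
  qed
  then have "finite {w \<in> sphere 0 1. \<phi> w - c = 0}"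
    by (intro holomorphic_compact_finite_zeros[OF hol open_ball connected_ball compact_sphere])
       (use R(1) in auto)
  then show ?thesis by simp
qed

text \<open>The deck maps move a point of the circle to as many points as the order, all with the same value of
  \<open>\<phi>\<close>.\<close>
lemma order_le_circle_fibre:
  assumes A: "set_mset A \<subseteq> ball 0 1" and c: "norm c = 1"
    and fac: "\<And>z. norm z < 1 \<Longrightarrow> \<phi> z = \<psi> (blaschke c A z)" and t: "norm t = 1"
  shows "size A \<le> card {w \<in> sphere 0 1. \<phi> w = \<phi> t}"
proof (cases "A = {#}")
  case False
  obtain \<sigma> :: "nat \<Rightarrow> complex \<Rightarrow> complex" where \<sigma>:
    "\<And>k t. norm t = 1 \<Longrightarrow> norm (\<sigma> k t) = 1"
    "\<And>k. continuous_on (sphere 0 1) (\<sigma> k)"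
    "\<And>t w. norm t = 1 \<Longrightarrow> norm w = 1 \<Longrightarrow>
       blaschke c A w = blaschke c A t \<longleftrightarrow> (\<exists>k<size A. w = \<sigma> k t)"
    "\<And>k l t. norm t = 1 \<Longrightarrow> k < size A \<Longrightarrow> l < size A \<Longrightarrow> \<sigma> k t = \<sigma> l t \<Longrightarrow> k = l"
    by (rule blaschke_deck_maps[OF A c False]) blast
  have "(\<lambda>k. \<sigma> k t) ` {..<size A} \<subseteq> {w \<in> sphere 0 1. \<phi> w = \<phi> t}"
  proof
    fix w assume "w \<in> (\<lambda>k. \<sigma> k t) ` {..<size A}"
    then obtain k where k: "k < size A" "w = \<sigma> k t" by blast
    have w: "norm w = 1" using \<sigma>(1)[OF t] k(2) by simp
    have eq: "blaschke c A w = blaschke c A t" using \<sigma>(3)[OF t w] k by blast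
    have "\<phi> w = \<phi> t"
      by (rule factor_boundary[OF A c False continuous_on_closed_disk _ t w eq]) (rule fac)
    with w show "w \<in> {w \<in> sphere 0 1. \<phi> w = \<phi> t}" by simp
  qed
  then have "card ((\<lambda>k. \<sigma> k t) ` {..<size A}) \<le> card {w \<in> sphere 0 1. \<phi> w = \<phi> t}"
    by (rule card_mono[OF finite_circle_fibre])
  moreover have "inj_on (\<lambda>k. \<sigma> k t) {..<size A}"
    using \<sigma>(4)[OF t] by (intro inj_onI) auto
  ultimately show ?thesis by (simp add: card_image)
qed simp

lemma wind_eq_sum_zorder:
  assumes "norm a < 1" "\<phi> a \<notin> \<phi> ` sphere 0 1"
  shows "wind \<phi> (\<phi> a) = of_int (\<Sum>p\<in>{p \<in> ball 0 1. \<phi> p = \<phi> a}. zorder (\<lambda>x. \<phi> x - \<phi> a) p)"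
    "finite {p \<in> ball 0 1. \<phi> p = \<phi> a}"
proof -
  obtain R where R: "R > 1" "\<phi> holomorphic_on ball 0 R" by (rule holomorphic_radius)
  have nz: "\<phi> t \<noteq> \<phi> a" if "norm t = 1" for t using assms(2) that by (metis image_eqI mem_sphere_0)
  show "wind \<phi> (\<phi> a) = of_int (\<Sum>p\<in>{p \<in> ball 0 1. \<phi> p = \<phi> a}. zorder (\<lambda>x. \<phi> x - \<phi> a) p)"
    unfolding wind_def by (rule winding_number_image_circle[OF R nz])
  show "finite {p \<in> ball 0 1. \<phi> p = \<phi> a}"
    by (rule argument_principle_circle(1)[OF R R(2) nz])
qed

text \<open>The winding number counts the zeros of \<open>\<phi> - \<phi> a\<close>, among them a whole fibre of
  the Blaschke product.\<close>
lemma order_le_wind: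
  assumes A: "set_mset A \<subseteq> ball 0 1" and c: "norm c = 1" and ne: "A \<noteq> {#}"
    and \<psi>: "\<psi> holomorphic_on ball 0 1"
    and fac: "\<And>z. norm z < 1 \<Longrightarrow> \<phi> z = \<psi> (blaschke c A z)"
    and a: "norm a < 1" "\<phi> a \<notin> \<phi> ` sphere 0 1" "wind \<phi> (\<phi> a) = of_int k"
  shows "int (size A) \<le> k"
proof -
  let ?B = "blaschke c A"
  let ?S = "{p \<in> ball 0 1. \<phi> p = \<phi> a}" and ?F = "{p \<in> ball 0 1. ?B p = ?B a}"
  have lt: "norm (?B z) < 1" if "norm z < 1" for z using norm_blaschke_less[OF A c that ne] .
  have hB: "?B holomorphic_on ball 0 1"
    by (rule blaschke_holomorphic) (use A blaschke_factor_denom in auto)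
  have hol: "\<phi> holomorphic_on ball 0 1" by (rule holomorphic_on_disk)
  obtain q where q: "norm q < 1" "\<phi> q \<noteq> \<phi> a" using nonconstant_on_disk by blast
  have sub: "?F \<subseteq> ?S" using fac a(1) by auto
  have "int (size A) = (\<Sum>p\<in>?F. zorder (\<lambda>x. ?B x - ?B a) p)"
    using sum_zorder_blaschke[OF A c lt[OF a(1)]] by simp
  also have "\<dots> \<le> (\<Sum>p\<in>?F. zorder (\<lambda>x. \<phi> x - \<phi> a) p)"
  proof (rule sum_mono)
    fix p assume p: "p \<in> ?F"
    then have "\<phi> p = \<phi> a" "?B p = ?B a" "norm p < 1" using sub by auto
    then show "zorder (\<lambda>x. ?B x - ?B a) p \<le> zorder (\<lambda>x. \<phi> x - \<phi> a) p"
      using zorder_composition_ge[OF hB lt \<psi> fac, of p] q by auto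
  qed
  also have "\<dots> \<le> (\<Sum>p\<in>?S. zorder (\<lambda>x. \<phi> x - \<phi> a) p)"
  proof (rule sum_mono2[OF wind_eq_sum_zorder(2)[OF a(1,2)] sub])
    fix p assume p: "p \<in> ?S - ?F"
    have "zorder (\<lambda>x. \<phi> x - \<phi> a) p > 0"
      by (rule zorder_zero_pos[OF hol open_ball connected_ball, of p "\<phi> a" q]) (use p q in auto)
    then show "0 \<le> zorder (\<lambda>x. \<phi> x - \<phi> a) p" by simp
  qed
  also have "\<dots> = k"
  proof -
    have "complex_of_int (\<Sum>p\<in>?S. zorder (\<lambda>x. \<phi> x - \<phi> a) p) = of_int k"
      using wind_eq_sum_zorder(1)[OF a(1,2)] a(3) by (simp only:)
    then show ?thesis by (simp only: of_int_eq_iff)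
  qed
  finally show ?thesis .
qed

text \<open>The deck maps of the Blaschke product are symmetries of \<open>\<phi>\<close>. Conversely a symmetry
  preserves the Blaschke product off a countable set, hence everywhere, so at each point it agrees with some
  deck map; the circle being connected, it is always the same one.\<close>
lemma symmetry_count:
  assumes A: "set_mset A \<subseteq> ball 0 1" and c: "norm c = 1" and ne: "A \<noteq> {#}"
    and fac: "\<And>z. norm z < 1 \<Longrightarrow> \<phi> z = \<psi> (blaschke c A z)"
    and sep: "\<And>t w. norm t = 1 \<Longrightarrow> norm w = 1 \<Longrightarrow> t \<in> good \<Longrightarrow> w \<in> good \<Longrightarrow> \<phi> w = \<phi> t \<Longrightarrow>
       blaschke c A w = blaschke c A t"
  shows "card (G_inv \<phi>) = size A"
proof -
  let ?B = "blaschke c A"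
  obtain \<sigma> :: "nat \<Rightarrow> complex \<Rightarrow> complex" where \<sigma>:
    "\<And>k t. norm t = 1 \<Longrightarrow> norm (\<sigma> k t) = 1"
    "\<And>k. continuous_on (sphere 0 1) (\<sigma> k)"
    "\<And>t w. norm t = 1 \<Longrightarrow> norm w = 1 \<Longrightarrow>
       blaschke c A w = blaschke c A t \<longleftrightarrow> (\<exists>k<size A. w = \<sigma> k t)"
    "\<And>k l t. norm t = 1 \<Longrightarrow> k < size A \<Longrightarrow> l < size A \<Longrightarrow> \<sigma> k t = \<sigma> l t \<Longrightarrow> k = l"
    by (rule blaschke_deck_maps[OF A c ne]) blast
  obtain R where R: "R > 1" "?B holomorphic_on ball 0 R" by (rule blaschke_holomorphic_radius[OF A])
  have contB: "continuous_on (sphere 0 1) ?B"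
    using holomorphic_on_imp_continuous_on[OF R(2)] by (rule continuous_on_subset) (use R(1) in auto)
  define \<tau> where "\<tau> k = restrict (\<sigma> k) (sphere 0 1)" for k
  have "G_inv \<phi> = \<tau> ` {..<size A}"
  proof (intro equalityI subsetI)
    fix \<rho> assume "\<rho> \<in> \<tau> ` {..<size A}"
    then obtain k where k: "k < size A" "\<rho> = \<tau> k" by blast
    have "continuous_on (sphere 0 1) \<rho>"
      using \<sigma>(2)[of k] by (rule continuous_on_eq) (simp add: k \<tau>_def)
    moreover have "\<phi> (\<rho> t) = \<phi> t" if t: "t \<in> sphere 0 1" for t
    proof -
      have t1: "norm t = 1" using t by simp
      have eq: "?B (\<sigma> k t) = ?B t" using \<sigma>(3)[OF t1 \<sigma>(1)[OF t1]] k(1) by blast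
      have "\<phi> (\<sigma> k t) = \<phi> t"
        by (rule factor_boundary[OF A c ne continuous_on_closed_disk _ t1 \<sigma>(1)[OF t1] eq]) (rule fac)
      then show ?thesis using t by (simp add: k \<tau>_def)
    qed
    moreover have "\<rho> \<in> sphere 0 1 \<rightarrow>\<^sub>E sphere 0 1" using \<sigma>(1) by (auto simp: k \<tau>_def)
    ultimately show "\<rho> \<in> G_inv \<phi>" by (simp add: G_inv_def)
  next
    fix \<rho> assume "\<rho> \<in> G_inv \<phi>"
    then have \<rho>: "\<rho> \<in> sphere 0 1 \<rightarrow>\<^sub>E sphere 0 1" "continuous_on (sphere 0 1) \<rho>"
      "\<And>t. t \<in> sphere 0 1 \<Longrightarrow> \<phi> (\<rho> t) = \<phi> t"
      by (auto simp: G_inv_def)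
    have \<rho>1: "norm (\<rho> t) = 1" if "norm t = 1" for t
      using PiE_mem[OF \<rho>(1), of t] that by simp
    \<comment> \<open>Off this countable set both \<open>t\<close> and \<open>\<rho> t\<close> are good.\<close>
    define C where "C = - good \<union> (\<Union>y\<in>\<phi> ` (- good). {w \<in> sphere 0 1. \<phi> w = y})"
    have C: "countable C"
      unfolding C_def
      by (intro countable_Un countable_not_good countable_UN countable_image
            countable_finite[OF finite_circle_fibre])
    have contB\<rho>: "continuous_on (sphere 0 1) (\<lambda>t. ?B (\<rho> t))"
      by (rule continuous_on_compose2[OF contB \<rho>(2)]) (use \<rho>1 in auto)
    have B\<rho>: "?B (\<rho> t) = ?B t" if t: "norm t = 1" for t
    proof (rule ccontr)
      assume "?B (\<rho> t) \<noteq> ?B t"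
      then have pos: "dist (?B (\<rho> t)) (?B t) > 0" by simp
      define d where "d s = dist (?B (\<rho> s)) (?B s)" for s
      have "continuous_on (sphere 0 1) d"
        unfolding d_def by (intro continuous_intros contB\<rho> contB)
      then have "\<exists>e>0. \<forall>s\<in>sphere 0 1. dist s t < e \<longrightarrow> dist (d s) (d t) < d t"
        using pos t unfolding continuous_on_iff d_def by simp
      then obtain e where e: "e > 0" "\<And>s. norm s = 1 \<Longrightarrow> dist s t < e \<Longrightarrow> dist (d s) (d t) < d t"
        by auto
      obtain s where s: "norm s = 1" "s \<in> ball t e" "s \<notin> C"
        by (rule circle_avoids_countable[OF C t open_ball]) (use e(1) in auto)
      have "s \<in> good" using s(3) by (simp add: C_def)
      moreover have "\<rho> s \<in> good"
      proof (rule ccontr)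
        assume "\<rho> s \<notin> good"
        then have "\<phi> s \<in> \<phi> ` (- good)" using \<rho>(3)[of s] s(1) by (intro image_eqI[of _ _ "\<rho> s"]) auto
        then show False using s(1,3) by (auto simp: C_def)
      qed
      ultimately have sg: "s \<in> good" "\<rho> s \<in> good" .
      have "?B (\<rho> s) = ?B s"
        by (rule sep[OF s(1) \<rho>1[OF s(1)] sg \<rho>(3)]) (use s(1) in simp)
      then have "d s = 0" by (simp add: d_def)
      then show False using e(2)[OF s(1)] s(2) by (simp add: dist_commute d_def dist_real_def)
    qed
    \<comment> \<open>The sets where \<open>\<rho>\<close> agrees with a given deck map partition the circle
      into finitely many closed pieces.\<close>
    define T where "T k = {t \<in> sphere 0 1. \<rho> t = \<sigma> k t}" for k
    have clT: "closedin (top_of_set (sphere 0 1)) (T k)" for k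
    proof -
      have "T k = sphere 0 1 \<inter> (\<lambda>t. \<rho> t - \<sigma> k t) -` {0}" by (auto simp: T_def)
      moreover have "continuous_on (sphere 0 1) (\<lambda>t. \<rho> t - \<sigma> k t)"
        by (intro continuous_intros \<rho>(2) \<sigma>(2))
      ultimately show ?thesis by (simp add: continuous_closedin_preimage)
    qed
    have cover: "\<exists>k<size A. t \<in> T k" if t: "norm t = 1" for t
      using \<sigma>(3)[OF t \<rho>1[OF t]] B\<rho>[OF t] t by (auto simp: T_def)
    obtain k where k: "k < size A" "1 \<in> T k" using cover[of 1] by auto
    have "sphere 0 1 - T k = (\<Union>l\<in>{..<size A} - {k}. T l)"
    proof (intro equalityI subsetI)
      fix t assume "t \<in> sphere 0 1 - T k"
      then show "t \<in> (\<Union>l\<in>{..<size A} - {k}. T l)" using cover[of t] by auto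
    next
      fix t assume "t \<in> (\<Union>l\<in>{..<size A} - {k}. T l)"
      then obtain l where l: "l < size A" "l \<noteq> k" "t \<in> T l" by auto
      then show "t \<in> sphere 0 1 - T k" using \<sigma>(4)[of t l k] k(1) by (auto simp: T_def)
    qed
    moreover have "closedin (top_of_set (sphere 0 1)) (\<Union>l\<in>{..<size A} - {k}. T l)"
      using clT by (intro closedin_Union) auto
    ultimately have "openin (top_of_set (sphere 0 1)) (T k)"
      using closedin_subset[OF clT[of k]] by (simp add: openin_closedin_eq)
    moreover have "connected (sphere (0::complex) 1)" by (intro connected_sphere) simp
    ultimately have Tk: "T k = sphere 0 1"
      using clT[of k] k(2) unfolding connected_clopen by blast
    have eq: "\<rho> t = \<sigma> k t" if "t \<in> sphere 0 1" for t
    proof -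
      have "t \<in> T k" unfolding Tk by (rule that)
      then show ?thesis by (simp add: T_def)
    qed
    have "\<rho> = \<tau> k"
    proof
      fix t
      show "\<rho> t = \<tau> k t"
      proof (cases "t \<in> sphere 0 1")
        case True
        then show ?thesis using eq by (simp add: \<tau>_def)
      next
        case False
        then show ?thesis using PiE_arb[OF \<rho>(1) False] by (simp add: \<tau>_def)
      qed
    qed
    then show "\<rho> \<in> \<tau> ` {..<size A}" using k(1) by blast
  qed
  moreover have "inj_on \<tau> {..<size A}"
  proof (rule inj_onI)
    fix k l assume kl: "k \<in> {..<size A}" "l \<in> {..<size A}" "\<tau> k = \<tau> l"
    then have "\<tau> k 1 = \<tau> l 1" by simp
    then have "\<sigma> k 1 = \<sigma> l 1" by (simp add: \<tau>_def)
    then show "k = l" using \<sigma>(4)[of 1 k l] kl by simp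
  qed
  ultimately show ?thesis by (simp add: card_image)
qed

end

theorem theorem1p5:
  fixes \<phi> :: "complex \<Rightarrow> complex"
  assumes "\<phi> \<in> mero_closed_disk"
    and "\<not> \<phi> constant_on UNIV"
  shows "n_inv \<phi> = int (b_inv \<phi>) \<and> b_inv \<phi> = o_inv \<phi> \<and> o_inv \<phi> = N_inv \<phi>"
proof -
  interpret mero_disk \<phi>
    using assms by unfold_locales (auto simp: mero_closed_disk_def)
  obtain \<eta> a where \<eta>: "norm \<eta> = 1" and a: "norm a < 1" "a \<in> good" "mates a \<subseteq> ball 0 1"
    and card\<eta>: "card (mates a) = card {w \<in> sphere 0 1. \<phi> w = \<phi> \<eta>}"
    and fib: "{w \<in> cball 0 1. \<phi> w = \<phi> a} \<subseteq> mates a"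
    by (rule base_point_with_mates_in_disk)
  have ar: "a \<in> regular" using a(2) good_tame tame_regular by blast
  have am: "a \<in> mates a" using mates_refl ar by blast
  have fin: "finite (mates a)" using finite_mates good_tame a(2) by blast
  define A where "A = mset_set (mates a)"
  have A: "set_mset A \<subseteq> ball 0 1" "size A = card (mates a)" "A \<noteq> {#}"
    using fin a(3) am by (auto simp: A_def mset_set_empty_iff)
  obtain c \<psi> where c: "norm c = 1" and \<psi>: "\<psi> \<in> H_infty"
    and fac: "\<And>z. norm z < 1 \<Longrightarrow> \<phi> z = \<psi> (blaschke c A z)"
    and sep: "\<And>t w. norm t = 1 \<Longrightarrow> norm w = 1 \<Longrightarrow> t \<in> good \<Longrightarrow> w \<in> good \<Longrightarrow> \<phi> w = \<phi> t \<Longrightarrow>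
       blaschke c A w = blaschke c A t"
    unfolding A_def using blaschke_factorization[OF a(2,1,3)] by blast
  have o: "o_inv \<phi> = size A"
    unfolding o_inv_def by (rule symmetry_count[OF A(1) c A(3) fac sep])
  have N: "N_inv \<phi> = size A"
    unfolding N_inv_def
  proof (rule Least_equality)
    show "\<exists>\<eta>\<in>unit_circle. size A = card {w \<in> unit_circle. \<phi> w = \<phi> \<eta>}"
      using \<eta> card\<eta> A(2) by (intro bexI[of _ \<eta>]) auto
    show "size A \<le> k" if "\<exists>\<eta>\<in>unit_circle. k = card {w \<in> unit_circle. \<phi> w = \<phi> \<eta>}" for k
      using that order_le_circle_fibre[OF A(1) c fac] by auto
  qed
  have b: "b_inv \<phi> = size A"
    unfolding b_inv_def
  proof (rule Greatest_equality)
    show "\<exists>B. finite_blaschke_product B \<and> blaschke_order B = size A \<and>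
        (\<exists>\<psi>\<in>H_infty. \<forall>z\<in>unit_disk. \<phi> z = \<psi> (B z))"
    proof (intro exI[of _ "blaschke c A"] conjI)
      show "finite_blaschke_product (blaschke c A)"
        unfolding finite_blaschke_product_iff using A(1) c by blast
      show "blaschke_order (blaschke c A) = size A"
        by (rule blaschke_order_eq_size[OF A(1) c]) simp
      show "\<exists>\<psi>\<in>H_infty. \<forall>z\<in>unit_disk. \<phi> z = \<psi> (blaschke c A z)"
        using \<psi> fac by (intro bexI[of _ \<psi>]) auto
    qed
    fix k assume "\<exists>B. finite_blaschke_product B \<and> blaschke_order B = k \<and>
        (\<exists>\<psi>\<in>H_infty. \<forall>z\<in>unit_disk. \<phi> z = \<psi> (B z))"
    then obtain B \<psi>' c' A' where B: "blaschke_order B = k" "\<forall>z\<in>ball 0 1. \<phi> z = \<psi>' (B z)"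
      and A': "norm c' = 1" "set_mset A' \<subseteq> ball 0 1" "\<forall>z\<in>ball 0 1. B z = blaschke c' A' z"
      unfolding finite_blaschke_product_iff by blast
    have "k = size A'"
      using blaschke_order_eq_size[OF A'(2,1), of B] A'(3) B(1) by simp
    also have "\<dots> \<le> card {w \<in> sphere 0 1. \<phi> w = \<phi> \<eta>}"
      by (rule order_le_circle_fibre[OF A'(2,1) _ \<eta>, of \<psi>']) (use A'(3) B(2) in auto)
    finally show "k \<le> size A" using card\<eta> A(2) by simp
  qed
  have n: "n_inv \<phi> = int (size A)"
    unfolding n_inv_def
  proof (rule Least_equality)
    have notin: "\<phi> a \<notin> \<phi> ` sphere 0 1"
    proof
      assume "\<phi> a \<in> \<phi> ` sphere 0 1"
      then obtain t where t: "norm t = 1" "\<phi> t = \<phi> a" by auto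
      then have "t \<in> mates a" using fib by auto
      then show False using a(3) t(1) by auto
    qed
    have S: "{p \<in> ball 0 1. \<phi> p = \<phi> a} = mates a"
    proof (intro equalityI subsetI)
      fix p assume "p \<in> {p \<in> ball 0 1. \<phi> p = \<phi> a}"
      then have "p \<in> {w \<in> cball 0 1. \<phi> w = \<phi> a}" by simp
      then show "p \<in> mates a" using fib by blast
    next
      fix p assume "p \<in> mates a"
      then show "p \<in> {p \<in> ball 0 1. \<phi> p = \<phi> a}" using a(3) by (auto simp: mates_def)
    qed
    have "zorder (\<lambda>x. \<phi> x - \<phi> a) p = 1" if p: "p \<in> mates a" for p
    proof (rule zorder_zero_eqI[of _ "ball 0 1"])
      show "(\<lambda>x. \<phi> x - \<phi> a) holomorphic_on ball 0 1" by (intro holomorphic_intros holomorphic_on_disk)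
      show pb: "p \<in> ball 0 1" using p a(3) by blast
      show "(deriv ^^ i) (\<lambda>x. \<phi> x - \<phi> a) p = 0" if "i < nat 1" for i
        using that p by (simp add: mates_def)
      have "\<phi> field_differentiable at p"
        using holomorphic_on_disk pb holomorphic_on_imp_differentiable_at open_ball by blast
      moreover have "deriv \<phi> p \<noteq> 0" using a(2) p by (simp add: good_def)
      ultimately show "(deriv ^^ nat 1) (\<lambda>x. \<phi> x - \<phi> a) p \<noteq> 0" by simp
    qed auto
    then have "wind \<phi> (\<phi> a) = of_int (int (size A))"
      using wind_eq_sum_zorder(1)[OF a(1) notin] unfolding S by (simp add: A(2))
    then show "\<exists>a\<in>unit_disk. \<phi> a \<notin> \<phi> ` unit_circle \<and> wind \<phi> (\<phi> a) = of_int (int (size A))"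
      using a(1) notin by (intro bexI[of _ a]) auto
    have h\<psi>: "\<psi> holomorphic_on ball 0 1" using \<psi> by (simp add: H_infty_def)
    show "int (size A) \<le> k"
      if "\<exists>a\<in>unit_disk. \<phi> a \<notin> \<phi> ` unit_circle \<and> wind \<phi> (\<phi> a) = of_int k" for k
      using that order_le_wind[OF A(1) c A(3) h\<psi> fac] by auto
  qed
  show ?thesis using n b o N by simp
qed

end
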